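(* Let $\lambda\in\mathbf{k}$ with $\lambda\ne0$. Let $A$ be a commutative algebra with a presentation $A=\mathbf{k}[X]/I_A$, with $X$ well-ordered, and let $S_A$ be a Gröbner(-Shirshov) basis of $I_A$ in $\mathbf{k}[X]$ with respect to the deg-lex order on $[X]$. Let $\overline{S_A}:=\{\overline s\in[X]\mid s\in S_A\}$ and $\hat S_A:=\hat i_X(S_A)$. Then the set of differential $\hat S_A$-irreducible words is $$\mathrm{DIrr}(\hat S_A)=\left\{\mathfrak x\in[\Delta(X)]\ \big|\ \overline s^{[n]}\nmid\mathfrak x\ \text{for any }\overline s\in\overline{S_A},\ n\ge0\right\},$$ and it gives a $\mathbf{k}$-linear basis of the free commutative differential algebra $\mathcal{CD}_\lambda(A)=\mathbf{k}[\Delta(X)]/\mathrm{DI}(\hat S_A)$ of weight $\lambda$ on $A$.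
   Context: $\mathbf{k}$ is a field of characteristic $0$; algebras are associative unital $\mathbf{k}$-algebras. **Differential algebras.** A differential algebra of weight $\lambda$ is an algebra $R$ with a linear map $d:R\to R$ such that $d(xy)=d(x)y+x\,d(y)+\lambda d(x)d(y)$ for all $x,y\in R$ and $d(1)=0$; homomorphisms are algebra homomorphisms commuting with the operators. A differential ideal is an ideal $I$ with $d(I)\subseteq I$; $\mathrm{DI}(U)$ is the smallest differential ideal containing $U$. The free commutative differential algebra of weight $\lambda$ on a commutative algebra $A$ is a commutative differential algebra $(\mathcal{CD}_\lambda(A),d_A)$ of weight $\lambda$ with an algebra homomorphism $i_A:A\to\mathcal{CD}_\lambda(A)$ such that every algebra homomorphism $\varphi:A\to R$ to a commutative differential algebra $(R,d)$ of weight $\lambda$ factors as $\varphi=\bar\varphi\circ i_A$ for a unique differential algebra homomorphism $\bar\varphi$. **The algebra $\mathbf{k}[\Delta(X)]$.** $\Delta(X)=\{x^{(n)}\mid x\in X,\ n\ge0\}$ (distinct symbols). $\mathbf{k}[\Delta(X)]$ is the commutative polynomial algebra, with the unique weight-$\lambda$ differential operator $d_X$ such that $d_X(x^{(n)})=x^{(n+1)}$. $[Y]$ is the free commutative monoid on $Y$ (monomials, including $1$). $\hat i_X:\mathbf{k}[X]\to\mathbf{k}[\Delta(X)]$ is the algebra embedding $x\mapsto x^{(0)}$. **Orders.** The well-order $<$ on $X$ is extended to $\Delta(X)$ by: $x^{(m)}\prec y^{(n)}$ iff $m<n$, or $m=n$ and $x<y$. On $[\Delta(X)]$: for $\mathfrak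 u=u_1\cdots u_p$, $\mathfrak v=v_1\cdots v_q$ with $u_1\succeq\cdots\succeq u_p$, $v_1\succeq\cdots\succeq v_q$, $\mathfrak u\prec\mathfrak v$ iff $p<q$, or $p=q$ and for some $k\le p$, $u_1=v_1,\dots,u_{k-1}=v_{k-1}$, $u_k\prec v_k$. The deg-lex order on $[X]$ is defined in the same way from $<$ on $X$. $|u|$ is the number of letters of $u$ counted with multiplicity. $\overline f$ is the leading monomial of $f\neq0$ (only formed for nonzero polynomials). **Gröbner(-Shirshov) basis of $I\subseteq\mathbf{k}[X]$.** A set $S$ of monic polynomials generating $I$ such that for all $f,g\in S$ and $w=\overline f u=\overline g v$ with $u,v\in[X]$, $|w|<|\overline f|+|\overline g|$, the element $fu-gv$ equals a finite sum $\sum_r c_r s_r u_r$ with $c_r\in\mathbf{k}$, $s_r\in S$, $u_r\in[X]$, $\overline{s_r}u_r<w$. **Notation.** For $S\subseteq\mathbf{k}[\Delta(X)]$ monic, $\mathrm{DIrr}(S):=[\Delta(X)]\setminus\{\overline{d_X^i(s)}\,u\mid s\in S,\ u\in[\Delta(X)],\ i\ge0\}$. For $\mathfrak a,\mathfrak b\in[\Delta(X)]$, $\mathfrak a\mid\mathfrak b$ means $\mathfrak b=\mathfrak a\mathfrak c$ for some $\mathfrak c\in[\Delta(X)]$; $\mathfrak a\nmid\mathfrak b$ is the negation. For a monomial $\mathfrak x=x_1\cdots x_k\in[X]$ and $n\ge0$, since $\lambda\neq0$, put $\mathfrak x^{[n]}:=x_1^{(n)}\cdots x_k^{(n)}$ (empty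 product $=1$). A set of monomials "gives a basis" of a quotient if the residue classes of its (distinct) elements form a basis. *)

theory Defs
  imports
    "HOL-Algebra.QuotRing"
    "HOL-Algebra.Algebraic_Closure_Type"
    "HOL-Library.Poly_Mapping"
    "HOL-Library.Multiset"
    "HOL-Library.FuncSet"
    "Jordan_Normal_Form.Missing_VectorSpace"
begin

text \<open>
  The base field is a type of class \<open>field_char_0\<close>, seen as the HOL-Algebra ring
  \<^const>\<open>ring_of_type_algebra\<close>; a commutative algebra is an instance of the locale
  \<^locale>\<open>algebra\<close>, which allows the zero algebra.
\<close>

definition alg_hom ::
  "('k::field, 'a) module \<Rightarrow> ('k, 'b) module \<Rightarrow> ('a \<Rightarrow> 'b) set"
  where "alg_hom A B = ring_hom A B \<inter> module_hom (ring_of_type_algebra :: 'k ring) A B"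

definition quot_alg :: "('k, 'a) module \<Rightarrow> 'a set \<Rightarrow> ('k, 'a set) module"
  where "quot_alg R I =
    \<lparr>carrier = carrier (R Quot I), monoid.mult = monoid.mult (R Quot I), monoid.one = \<one>\<^bsub>R Quot I\<^esub>,
     ring.zero = \<zero>\<^bsub>R Quot I\<^esub>, ring.add = ring.add (R Quot I),
     module.smult = (\<lambda>c C. \<Union>p\<in>C. I +>\<^bsub>R\<^esub> (c \<odot>\<^bsub>R\<^esub> p))\<rparr>"

text \<open>
  The operator induced on cosets by an operator preserving \<open>I\<close>, written like
  \<^const>\<open>rcoset_mult\<close>: all members of the union are then the same coset.
\<close>

definition quot_op :: "('k, 'a) module \<Rightarrow> 'a set \<Rightarrow> ('a \<Rightarrow> 'a) \<Rightarrow> 'a set \<Rightarrow> 'a set"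
  where "quot_op R I f C = (\<Union>p\<in>C. I +>\<^bsub>R\<^esub> f p)"

locale comm_diff_algebra =
  algebra "ring_of_type_algebra :: 'k ring" R
  for R :: "('k::field, 'a) module" (structure) +
  fixes lam :: 'k and d :: "'a \<Rightarrow> 'a"
  assumes d_linear: "d \<in> module_hom (ring_of_type_algebra :: 'k ring) R R"
    and d_mult: "\<lbrakk>x \<in> carrier R; y \<in> carrier R\<rbrakk> \<Longrightarrow>
      d (x \<otimes> y) = d x \<otimes> y \<oplus> x \<otimes> d y \<oplus> lam \<odot>\<^bsub>R\<^esub> (d x \<otimes> d y)"
    and d_one: "d \<one> = \<zero>"

definition diff_alg_hom ::
  "('k::field, 'a) module \<Rightarrow> ('a \<Rightarrow> 'a) \<Rightarrow> ('k, 'b) module \<Rightarrow> ('b \<Rightarrow> 'b) \<Rightarrow> ('a \<Rightarrow> 'b) set"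
  where "diff_alg_hom R d R' d' =
    {h \<in> alg_hom R R'. \<forall>x\<in>carrier R. h (d x) = d' (h x)}"

definition diff_ideal_gen :: "('k, 'a) module \<Rightarrow> ('a \<Rightarrow> 'a) \<Rightarrow> 'a set \<Rightarrow> 'a set"
  where "diff_ideal_gen R d U = \<Inter>{I. ideal I R \<and> d ` I \<subseteq> I \<and> U \<subseteq> I}"

text \<open>
  \<open>(Q, dQ)\<close> with \<open>i : A \<rightarrow> Q\<close> is the free commutative differential algebra of weight
  \<open>lam\<close> on \<open>A\<close>. HOL cannot quantify over types inside a formula, so the type \<open>'r\<close> of the
  test algebras is an argument. The restriction to \<^const>\<open>extensional\<close> makes
  uniqueness refer to the values on \<open>carrier Q\<close> only.
\<close>

definition free_comm_diff_algebra ::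
  "'r itself \<Rightarrow> 'k::field \<Rightarrow> ('k, 'a) module \<Rightarrow> ('k, 'q) module \<Rightarrow> ('q \<Rightarrow> 'q) \<Rightarrow> ('a \<Rightarrow> 'q) \<Rightarrow> bool"
  where "free_comm_diff_algebra (_ :: 'r itself) lam A Q dQ i \<longleftrightarrow>
    comm_diff_algebra Q lam dQ \<and> i \<in> alg_hom A Q \<and>
    (\<forall>(R :: ('k, 'r) module) d \<phi>.
       comm_diff_algebra R lam d \<and> \<phi> \<in> alg_hom A R \<longrightarrow>
       (\<exists>!\<psi>. \<psi> \<in> extensional (carrier Q) \<and> \<psi> \<in> diff_alg_hom Q dQ R d \<and>
          (\<forall>a\<in>carrier A. \<psi> (i a) = \<phi> a)))"

text \<open>
  A monomial is the multiset of its letters, so the product of monomials is \<open>+\<close>,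
  the monomial 1 is \<open>{#}\<close> and \<open>|u|\<close> is \<^const>\<open>size\<close>. A polynomial is a finitely
  supported function on monomials.
\<close>

type_synonym ('v, 'k) mpol = "'v multiset \<Rightarrow>\<^sub>0 'k"

definition monomials :: "'v set \<Rightarrow> 'v multiset set"
  where "monomials Y = {m. set_mset m \<subseteq> Y}"

definition mon_poly :: "'v multiset \<Rightarrow> ('v, 'k::field) mpol"
  where "mon_poly m = Poly_Mapping.single m 1"

definition poly_alg :: "'v set \<Rightarrow> ('k::field, ('v, 'k) mpol) module"
  where "poly_alg Y =
    \<lparr>carrier = {p. Poly_Mapping.keys p \<subseteq> monomials Y}, monoid.mult = (*), monoid.one = 1,
     ring.zero = 0, ring.add = (+), module.smult = (\<lambda>c. Poly_Mapping.map ((*) c))\<rparr>"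

definition mon_dvd :: "'v set \<Rightarrow> 'v multiset \<Rightarrow> 'v multiset \<Rightarrow> bool"
  where "mon_dvd Y a b \<longleftrightarrow> (\<exists>c\<in>monomials Y. b = a + c)"

text \<open>
  \<open>s\<close> is a strict order on letters; the words compared by \<^const>\<open>lenlex\<close> list the letters
  of the two monomials in weakly decreasing order.
\<close>

definition deglex :: "'v rel \<Rightarrow> 'v multiset rel"
  where "deglex s = {(u, v). \<exists>us vs. mset us = u \<and> mset vs = v \<and>
    sorted_wrt (\<lambda>a b. (b, a) \<in> s\<^sup>=) us \<and> sorted_wrt (\<lambda>a b. (b, a) \<in> s\<^sup>=) vs \<and>
    (us, vs) \<in> lenlex s}"

definition lead_mon :: "'v rel \<Rightarrow> ('v, 'k::field) mpol \<Rightarrow> 'v multiset"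
  where "lead_mon s p = (THE m. m \<in> Poly_Mapping.keys p \<and>
    (\<forall>m'\<in>Poly_Mapping.keys p. m' \<noteq> m \<longrightarrow> (m', m) \<in> deglex s))"

definition monic :: "'v rel \<Rightarrow> ('v, 'k::field) mpol \<Rightarrow> bool"
  where "monic s p \<longleftrightarrow> p \<noteq> 0 \<and> Poly_Mapping.lookup p (lead_mon s p) = 1"

definition groebner_basis ::
  "'v rel \<Rightarrow> 'v set \<Rightarrow> ('v, 'k::field) mpol set \<Rightarrow> ('v, 'k) mpol set \<Rightarrow> bool"
  where "groebner_basis s Y I S \<longleftrightarrow>
    S \<subseteq> carrier (poly_alg Y) \<and> (\<forall>f\<in>S. monic s f) \<and> Idl\<^bsub>poly_alg Y\<^esub> S = I \<and>
    (\<forall>f\<in>S. \<forall>g\<in>S. \<forall>u\<in>monomials Y. \<forall>v\<in>monomials Y. \<forall>w.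
       w = lead_mon s f + u \<and> w = lead_mon s g + v \<and>
       size w < size (lead_mon s f) + size (lead_mon s g) \<longrightarrow>
       (\<exists>(N :: nat) c t q.
          (\<forall>j<N. t j \<in> S \<and> q j \<in> monomials Y \<and> (lead_mon s (t j) + q j, w) \<in> deglex s) \<and>
          f * mon_poly u - g * mon_poly v =
            (\<Sum>j<N. Poly_Mapping.map ((*) (c j)) (t j * mon_poly (q j)))))"

text \<open>
  \<open>A = k[V]/I\<close>, with \<open>prj\<close> the residue class map \<open>k[V] \<rightarrow> A\<close>.
\<close>

definition presentation ::
  "'v set \<Rightarrow> ('v, 'k::field) mpol set \<Rightarrow> ('k, 'a) module \<Rightarrow> (('v, 'k) mpol \<Rightarrow> 'a) \<Rightarrow> bool"
  where "presentation V I A prj \<longleftrightarrow>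
    algebra (ring_of_type_algebra :: 'k ring) A \<and> prj \<in> alg_hom (poly_alg V) A \<and>
    prj ` carrier (poly_alg V) = carrier A \<and> a_kernel (poly_alg V) A prj = I"

text \<open>The letter \<open>x\<^sup>(\<^sup>n\<^sup>)\<close> is the pair \<open>(x, n)\<close>.\<close>

definition Delta :: "'x set \<Rightarrow> ('x \<times> nat) set"
  where "Delta V = V \<times> UNIV"

definition Delta_less :: "'x rel \<Rightarrow> ('x \<times> nat) rel"
  where "Delta_less s = {((x, m), (y, n)). m < n \<or> m = n \<and> (x, y) \<in> s}"

text \<open>\<open>bracket n u\<close> is \<open>u\<^sup>[\<^sup>n\<^sup>]\<close>.\<close>

definition bracket :: "nat \<Rightarrow> 'x multiset \<Rightarrow> ('x \<times> nat) multiset"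
  where "bracket n u = image_mset (\<lambda>x. (x, n)) u"

definition hat_i :: "('x, 'k::field) mpol \<Rightarrow> ('x \<times> nat, 'k) mpol"
  where "hat_i p = (\<Sum>u\<in>Poly_Mapping.keys p.
    Poly_Mapping.single (bracket 0 u) (Poly_Mapping.lookup p u))"

definition diff_op ::
  "'k::field \<Rightarrow> 'x set \<Rightarrow> ('x \<times> nat, 'k) mpol \<Rightarrow> ('x \<times> nat, 'k) mpol"
  where "diff_op lam V = (THE d. d \<in> extensional (carrier (poly_alg (Delta V))) \<and>
    comm_diff_algebra (poly_alg (Delta V)) lam d \<and>
    (\<forall>x\<in>V. \<forall>n. d (mon_poly {#(x, n)#}) = mon_poly {#(x, Suc n)#}))"

text \<open>
  \<open>s\<close> is the strict order on \<open>V\<close>. Leading monomials are formed for nonzero polynomials only;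
  this matters for \<open>1 \<in> S\<close>, as \<open>d 1 = 0\<close>.
\<close>

definition DIrr ::
  "'k::field \<Rightarrow> 'x rel \<Rightarrow> 'x set \<Rightarrow> ('x \<times> nat, 'k) mpol set \<Rightarrow> ('x \<times> nat) multiset set"
  where "DIrr lam s V S = monomials (Delta V) -
    {lead_mon (Delta_less s) ((diff_op lam V ^^ i) f) + u | f u i.
       f \<in> S \<and> u \<in> monomials (Delta V) \<and> (diff_op lam V ^^ i) f \<noteq> 0}"

end

theory Submission
  imports Defs
begin

text \<open>
  For an operator \<open>d\<close> of weight \<open>lam \<noteq> 0\<close> the map \<open>sigma = 1 + lam d\<close> is an algebra endomorphism,
  and an ideal is differential iff \<open>sigma\<close> maps it into itself. On \<open>k[Delta(X)]\<close> let \<open>tau\<close> be the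
  shift of letters \<open>(x, n) \<mapsto> (x, n + 1)\<close> and \<open>theta\<close> the substitution \<open>(x, n) \<mapsto> sigma\<^sup>n (x, 0)\<close>. Then
  \<open>theta\<close> is surjective, intertwines \<open>tau\<close> with \<open>sigma\<close>, fixes the copy of \<open>k[X]\<close> at level 0, and sends a
  monomial to a nonzero multiple of itself plus smaller monomials, so it preserves leading
  monomials. Hence the differential ideal generated by the level 0 copy of \<open>S\<close> is the image under \<open>theta\<close> of
  the ordinary ideal generated by the copies of \<open>S\<close> at all levels. These copies form a Groebner
  basis, because copies at different levels have no letter in common. Moreover
  \<open>d\<^sup>i\<close> acts on the level 0 copy of \<open>s\<close> as \<open>theta ((tau - 1) / lam)\<^sup>i\<close>, whose leading monomial is that of
  the level \<open>i\<close> copy of \<open>s\<close>, unless \<open>s = 1\<close> and \<open>i > 0\<close>, where the result is 0.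
\<close>

section \<open>The deg-lex order\<close>

text \<open>What forces the detour through \<open>theta\<close>: \<open>d\<close> is not
  multiplicative, so an S-polynomial of \<open>d^i f\<close> and \<open>d^i g\<close> is not
  \<open>d^i\<close> of an S-polynomial of \<open>f\<close> and \<open>g\<close>, and the Groebner
  hypothesis on \<open>S\<close> cannot simply be differentiated. The powers of \<open>sigma\<close>
  are multiplicative, but they turn monomials into sums, so monomial multiples are still not carried
  along. In the coordinates \<open>sigma^n x\<close>, which \<open>theta\<close> introduces,
  \<open>sigma\<close> is a mere relabelling of letters and both defects vanish. The price is that
  this change of coordinates has to respect leading monomials; it does because
  \<open>sigma^n x\<close> is \<open>lam^n\<close> times the letter at level \<open>n\<close> plus
  letters of lower level, with \<open>lam^n \<noteq> 0\<close>. The weight also explains the form of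
  the result: for \<open>lam \<noteq> 0\<close> the leading monomial of \<open>d(x^2)\<close> is the
  square of the level 1 letter, whereas in weight 0 it would be the product of the letters at levels
  0 and 1.\<close>

lemma sorted_wrt_mset_unique:
  assumes "trans s" "irrefl s" "mset us = mset vs"
    and "sorted_wrt (\<lambda>a b. (b, a) \<in> s\<^sup>=) us" "sorted_wrt (\<lambda>a b. (b, a) \<in> s\<^sup>=) vs"
  shows "us = vs"
  using assms(3-)
proof (induction us arbitrary: vs)
  case (Cons u us)
  then obtain v vs' where vs: "vs = v # vs'" by (cases vs) auto
  have "u \<in> set (v # vs')" "v \<in> set (u # us)"
    using Cons.prems(1) vs by (metis list.set_intros(1) set_mset_mset)+
  \<comment> \<open>Both heads are greatest letters of the same multiset; asymmetry of
    \<open>s\<close> then identifies them.\<close>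
  hence "(u, v) \<in> s\<^sup>=" "(v, u) \<in> s\<^sup>="
    using Cons.prems vs by auto
  hence "u = v"
    using assms(1,2) by (auto simp: irrefl_def dest: transD)
  with Cons vs show ?case by auto
qed auto

text \<open>A monomial has at most one sorted word, so choosing it with \<open>SOME\<close> places
  \<open>deglex s\<close> inside an inverse image of the well-founded \<open>lenlex s\<close>.
  Multisets without a sorted word get an arbitrary list, but \<open>deglex\<close> does not relate
  them to anything.\<close>

lemma deglex_wf:
  assumes "trans s" "wf s"
  shows "wf (deglex s)"
proof (rule wf_subset)
  let ?l = "\<lambda>u. SOME us. mset us = u \<and> sorted_wrt (\<lambda>a b. (b, a) \<in> s\<^sup>=) us"
  show "wf (inv_image (lenlex s) ?l)"
    using assms by (auto intro: wf_inv_image)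
  have *: "?l (mset us) = us" if "sorted_wrt (\<lambda>a b. (b, a) \<in> s\<^sup>=) us" for us
    using that sorted_wrt_mset_unique[OF assms(1), of _ us] wf_irrefl[OF assms(2)]
    by (intro some_equality) (auto simp: irrefl_def)
  show "deglex s \<subseteq> inv_image (lenlex s) ?l"
  proof (rule subrelI)
    fix u v assume "(u, v) \<in> deglex s"
    then obtain us vs where "mset us = u" "mset vs = v" "(us, vs) \<in> lenlex s"
      "sorted_wrt (\<lambda>a b. (b, a) \<in> s\<^sup>=) us" "sorted_wrt (\<lambda>a b. (b, a) \<in> s\<^sup>=) vs"
      unfolding deglex_def by blast
    with *[of us] *[of vs] show "(u, v) \<in> inv_image (lenlex s) ?l" by simp
  qed
qed

lemma deglex_trans:
  assumes "trans s" "irrefl s"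
  shows "trans (deglex s)"
proof (rule transI)
  fix x y z
  assume "(x, y) \<in> deglex s" "(y, z) \<in> deglex s"
  then obtain us vs vs' ws where
    "mset us = x" "mset vs = y" "mset vs' = y" "mset ws = z"
    and srt: "sorted_wrt (\<lambda>a b. (b, a) \<in> s\<^sup>=) us" "sorted_wrt (\<lambda>a b. (b, a) \<in> s\<^sup>=) vs"
      "sorted_wrt (\<lambda>a b. (b, a) \<in> s\<^sup>=) vs'" "sorted_wrt (\<lambda>a b. (b, a) \<in> s\<^sup>=) ws"
    and ll: "(us, vs) \<in> lenlex s" "(vs', ws) \<in> lenlex s"
    unfolding deglex_def by blast
  moreover have "vs = vs'"
    using calculation by (intro sorted_wrt_mset_unique[OF assms]) auto
  ultimately show "(x, z) \<in> deglex s"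
    using lenlex_trans[OF ll(1) _ assms(1), of ws] ll(2) srt unfolding deglex_def by blast
qed

lemma total_on_greatest:
  assumes "finite F" "F \<noteq> {}" "F \<subseteq> Y" "total_on Y s" "trans s"
  shows "\<exists>a\<in>F. \<forall>b\<in>F. (b, a) \<in> s\<^sup>="
  using assms(1-3)
proof (induction rule: finite_ne_induct)
  case (insert x F)
  then obtain a where a: "a \<in> F" "\<forall>b\<in>F. (b, a) \<in> s\<^sup>=" by auto
  show ?case
  proof (cases "(a, x) \<in> s")
    case True
    with a show ?thesis using assms(5) by (auto dest: transD intro!: bexI[of _ x])
  next
    case False
    have "(x, a) \<in> s\<^sup>="
      using False assms(4) insert.prems a(1) by (auto simp: total_on_def)
    with a show ?thesis by auto
  qed
qed auto

lemma sorted_wrt_mset_exists: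
  assumes "total_on Y s" "trans s" "set_mset m \<subseteq> Y"
  shows "\<exists>us. mset us = m \<and> sorted_wrt (\<lambda>a b. (b, a) \<in> s\<^sup>=) us"
  using assms(3)
proof (induction "size m" arbitrary: m)
  case (Suc n)
  hence "m \<noteq> {#}" by auto
  then obtain a where a: "a \<in># m" "\<forall>b\<in>#m. (b, a) \<in> s\<^sup>="
    using total_on_greatest[of "set_mset m" Y s] assms Suc by auto
  have "set_mset (m - {#a#}) \<subseteq> Y" using Suc.prems by (auto dest: in_diffD)
  moreover have "n = size (m - {#a#})" using Suc a by (simp add: size_Diff_singleton)
  ultimately obtain us where us: "mset us = m - {#a#}" "sorted_wrt (\<lambda>a b. (b, a) \<in> s\<^sup>=) us"
    using Suc.hyps(1) by blast
  have "set us \<subseteq> set_mset m" using us(1) by (metis in_diffD set_mset_mset subsetI)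
  hence "sorted_wrt (\<lambda>a b. (b, a) \<in> s\<^sup>=) (a # us)" using us a by auto
  moreover have "mset (a # us) = m" using us a by simp
  ultimately show ?case by blast
qed auto

lemma lenlex_total_on:
  assumes "total_on Y s" "set us \<subseteq> Y" "set vs \<subseteq> Y" "us \<noteq> vs"
  shows "(us, vs) \<in> lenlex s \<or> (vs, us) \<in> lenlex s"
  using assms(2-)
proof (induction us arbitrary: vs)
  case (Cons u us)
  show ?case
  proof (cases vs)
    case (Cons v vs')
    then show ?thesis
      using Cons.IH[of vs'] Cons.prems assms(1) by (auto simp: Cons_lenlex_iff total_on_def)
  qed auto
qed auto

lemma deglex_total:
  assumes "total_on Y s" "trans s"
  shows "total_on (monomials Y) (deglex s)"
  unfolding total_on_def
proof (intro ballI impI)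
  fix u v assume uv: "u \<in> monomials Y" "v \<in> monomials Y" "u \<noteq> v"
  obtain us vs where 1: "mset us = u" "mset vs = v"
    and 2: "sorted_wrt (\<lambda>a b. (b, a) \<in> s\<^sup>=) us" "sorted_wrt (\<lambda>a b. (b, a) \<in> s\<^sup>=) vs"
    using sorted_wrt_mset_exists[OF assms, of u] sorted_wrt_mset_exists[OF assms, of v] uv
    by (auto simp: monomials_def)
  have "set us \<subseteq> Y" "set vs \<subseteq> Y" using uv 1 by (auto simp: monomials_def)
  hence "(us, vs) \<in> lenlex s \<or> (vs, us) \<in> lenlex s"
    using lenlex_total_on[OF assms(1)] uv 1 by blast
  thus "(u, v) \<in> deglex s \<or> (v, u) \<in> deglex s"
    using 1 2 unfolding deglex_def by blast
qed

section \<open>The deg-lex order in terms of exponents\<close>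

text \<open>The witness \<open>a\<close> is the largest letter at which the exponents differ. Unlike
  the comparison of sorted words, this form is visibly unaffected by a common factor.\<close>

definition count_less :: "'v rel \<Rightarrow> 'v multiset \<Rightarrow> 'v multiset \<Rightarrow> bool"
  where "count_less s u v \<longleftrightarrow> size u < size v \<or> size u = size v \<and>
    (\<exists>a. count u a < count v a \<and> (\<forall>b. (a, b) \<in> s \<longrightarrow> count u b = count v b))"

text \<open>At the first difference of the sorted words \<open>us\<close> continues with
  \<open>x\<close> and \<open>vs\<close> with a larger \<open>y\<close>. Sortedness bars
  \<open>y\<close> and all larger letters from the rest of \<open>us\<close>, and all letters larger
  than \<open>y\<close> from the rest of \<open>vs\<close>, so \<open>y\<close> is the
  witness.\<close>

lemma deglex_imp_count_less:
  assumes "trans s" "irrefl s" "(u, v) \<in> deglex s"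
  shows "count_less s u v"
proof -
  from assms(3) obtain us vs where uv: "mset us = u" "mset vs = v"
    and srt: "sorted_wrt (\<lambda>a b. (b, a) \<in> s\<^sup>=) us" "sorted_wrt (\<lambda>a b. (b, a) \<in> s\<^sup>=) vs"
    and ll: "(us, vs) \<in> lenlex s"
    unfolding deglex_def by blast
  have asym: "(b, a) \<notin> s" if "(a, b) \<in> s" for a b
    using that assms(1,2) by (metis irrefl_def transD)
  consider "length us < length vs" | "length us = length vs" "(us, vs) \<in> lex s"
    using ll by (auto simp: lenlex_conv)
  then show ?thesis
  proof cases
    case 1 then show ?thesis using uv by (auto simp: count_less_def)
  next
    case 2
    then obtain xs x xs' y ys' where
      us: "us = xs @ x # xs'" and vs: "vs = xs @ y # ys'" and xy: "(x, y) \<in> s"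
      by (auto simp: lex_conv)
    have xs': "z \<notin> set xs'" if "z = y \<or> (y, z) \<in> s" for z
    proof
      assume "z \<in> set xs'"
      hence "z = x \<or> (z, x) \<in> s" using srt(1) by (auto simp: us sorted_wrt_append)
      hence "(z, y) \<in> s" using xy assms(1) by (auto dest: transD)
      thus False using that asym[of z y] by auto
    qed
    have ys': "z \<notin> set ys'" if "(y, z) \<in> s" for z
    proof
      assume "z \<in> set ys'"
      hence "z = y \<or> (z, y) \<in> s" using srt(2) by (auto simp: vs sorted_wrt_append)
      thus False using that asym[of y z] by auto
    qed
    have c0: "count (mset zs) z = 0" if "z \<notin> set zs" for z and zs :: "'a list"
      using that by (simp add: count_eq_zero_iff)
    have "x \<noteq> y" using xy assms(2) by (auto simp: irrefl_def)
    hence "count u y < count v y"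
      using xs'[of y] uv by (auto simp: us vs c0)
    moreover have "count u b = count v b" if "(y, b) \<in> s" for b
    proof -
      have "b \<noteq> x" "b \<noteq> y" using that xy asym assms(2) by (auto simp: irrefl_def)
      thus ?thesis using xs'[of b] ys'[of b] that uv by (auto simp: us vs c0)
    qed
    ultimately show ?thesis using 2(1) uv by (auto simp: count_less_def)
  qed
qed

lemma count_less_asym:
  assumes "total_on Y s" "u \<in> monomials Y" "v \<in> monomials Y" "count_less s u v" "count_less s v u"
  shows False
proof -
  have "size u = size v" using assms(4,5) by (auto simp: count_less_def)
  with assms(4) obtain a where a: "count u a < count v a" "\<And>c. (a, c) \<in> s \<Longrightarrow> count u c = count v c"
    unfolding count_less_def by auto
  from \<open>size u = size v\<close> assms(5) obtain b
    where b: "count v b < count u b" "\<And>c. (b, c) \<in> s \<Longrightarrow> count v c = count u c"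
    unfolding count_less_def by auto
  \<comment> \<open>A letter of positive multiplicity occurs in its monomial; this puts both
    witnesses into \<open>Y\<close>, where \<open>s\<close> compares them.\<close>
  have "a \<in># v" "b \<in># u" using a(1) b(1) by (auto intro: count_inI)
  hence "a \<in> Y" "b \<in> Y" using assms(2,3) by (auto simp: monomials_def)
  then consider "a = b" | "(a, b) \<in> s" | "(b, a) \<in> s" using assms(1) by (auto simp: total_on_def)
  then show False
    by cases (use a(1) b(1) a(2)[of b] b(2)[of a] in simp_all)
qed

text \<open>The converse needs no reconstruction of words: \<open>deglex s\<close> is total on
  \<open>monomials Y\<close>, and the opposite comparison would give \<open>count_less\<close> in
  both directions.\<close>

lemma deglex_iff_count_less:
  assumes "total_on Y s" "trans s" "irrefl s" "u \<in> monomials Y" "v \<in> monomials Y"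
  shows "(u, v) \<in> deglex s \<longleftrightarrow> count_less s u v"
proof
  assume c: "count_less s u v"
  hence "u \<noteq> v" by (auto simp: count_less_def)
  moreover have "(v, u) \<notin> deglex s"
    using deglex_imp_count_less[OF assms(2,3)] count_less_asym[OF assms(1,4,5) c] by blast
  ultimately show "(u, v) \<in> deglex s"
    using deglex_total[OF assms(1,2)] assms(4,5) by (auto simp: total_on_def)
qed (rule deglex_imp_count_less[OF assms(2,3)])

lemma count_less_add_right_iff: "count_less s (u + w) (v + w) \<longleftrightarrow> count_less s u v"
  by (auto simp: count_less_def)

lemma monomials_add: "u + v \<in> monomials Y \<longleftrightarrow> u \<in> monomials Y \<and> v \<in> monomials Y"
  by (auto simp: monomials_def)

lemma monomials_empty [simp]: "{#} \<in> monomials Y" "0 \<in> monomials Y"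
  by (auto simp: monomials_def)

section \<open>Representations by multiples and Groebner bases\<close>

abbreviation single :: "'a \<Rightarrow> 'b::zero \<Rightarrow> 'a \<Rightarrow>\<^sub>0 'b"
  where "single \<equiv> Poly_Mapping.single"

abbreviation keys :: "('a \<Rightarrow>\<^sub>0 'b::zero) \<Rightarrow> 'a set"
  where "keys \<equiv> Poly_Mapping.keys"

abbreviation lookup :: "('a \<Rightarrow>\<^sub>0 'b::zero) \<Rightarrow> 'a \<Rightarrow> 'b"
  where "lookup \<equiv> Poly_Mapping.lookup"

abbreviation scal :: "'k::field \<Rightarrow> ('v, 'k) mpol \<Rightarrow> ('v, 'k) mpol"
  where "scal c \<equiv> Poly_Mapping.map ((*) c)"

text \<open>Turns scalar multiplication into a product with a constant polynomial, so that ring laws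
  and closure under products take care of scalars.\<close>

lemma scal_eq: "scal c p = single {#} c * p"
  by (simp add: mult_map_scale_conv_mult)

lemma carrier_poly_alg: "carrier (poly_alg Y) = {p. keys p \<subseteq> monomials Y}"
  by (simp add: poly_alg_def)

lemma poly_alg_sel [simp]:
  "monoid.mult (poly_alg Y) = (*)" "monoid.one (poly_alg Y) = 1" "ring.zero (poly_alg Y) = 0"
  "ring.add (poly_alg Y) = (+)" "module.smult (poly_alg Y) = scal"
  by (simp_all add: poly_alg_def)

lemma ring_of_type_algebra_sel [simp]:
  "carrier ring_of_type_algebra = UNIV" "monoid.mult ring_of_type_algebra = (*)"
  "monoid.one ring_of_type_algebra = 1" "ring.zero ring_of_type_algebra = 0"
  "ring.add ring_of_type_algebra = (+)"
  by (simp_all add: ring_of_type_algebra_def)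

lemma single_empty_one: "single {#} 1 = 1"
  by (rule single_one[unfolded zero_multiset_def])

lemma single_in_poly_alg: "u \<in> monomials Y \<Longrightarrow> single u c \<in> carrier (poly_alg Y)"
  by (simp add: carrier_poly_alg)

lemma mon_poly_in_poly_alg: "u \<in> monomials Y \<Longrightarrow> mon_poly u \<in> carrier (poly_alg Y)"
  by (simp add: mon_poly_def single_in_poly_alg)

lemma zero_in_poly_alg: "0 \<in> carrier (poly_alg Y)"
  by (simp add: carrier_poly_alg)

lemma one_in_poly_alg: "1 \<in> carrier (poly_alg Y)"
  using single_in_poly_alg[of "{#}" Y 1] by (simp add: single_empty_one)

lemma add_in_poly_alg:
  "p \<in> carrier (poly_alg Y) \<Longrightarrow> q \<in> carrier (poly_alg Y) \<Longrightarrow> p + q \<in> carrier (poly_alg Y)"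
  using keys_add[of p q] by (auto simp: carrier_poly_alg)

lemma mult_in_poly_alg:
  "p \<in> carrier (poly_alg Y) \<Longrightarrow> q \<in> carrier (poly_alg Y) \<Longrightarrow> p * q \<in> carrier (poly_alg Y)"
  using keys_mult[of p q] by (force simp: carrier_poly_alg monomials_add)

lemma scal_in_poly_alg: "p \<in> carrier (poly_alg Y) \<Longrightarrow> scal c p \<in> carrier (poly_alg Y)"
  by (simp add: scal_eq mult_in_poly_alg single_in_poly_alg)

lemma uminus_eq_single: "- p = single {#} (- 1) * (p :: ('v, 'k::field) mpol)"
  by (simp add: single_uminus single_empty_one)

lemma uminus_in_poly_alg: "p \<in> carrier (poly_alg Y) \<Longrightarrow> - p \<in> carrier (poly_alg Y)"
  by (simp add: uminus_eq_single mult_in_poly_alg single_in_poly_alg)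

lemma diff_in_poly_alg:
  "p \<in> carrier (poly_alg Y) \<Longrightarrow> q \<in> carrier (poly_alg Y) \<Longrightarrow> p - q \<in> carrier (poly_alg Y)"
  using add_in_poly_alg[of p Y "- q"] uminus_in_poly_alg by auto

lemmas poly_alg_closed = single_in_poly_alg mon_poly_in_poly_alg zero_in_poly_alg one_in_poly_alg
  add_in_poly_alg mult_in_poly_alg scal_in_poly_alg uminus_in_poly_alg diff_in_poly_alg

text \<open>Induction term by term. The finite set \<open>F\<close> only bounds the support, which
  shrinks when one term is subtracted.\<close>

lemma poly_alg_induct [consumes 1, case_names zero add]:
  fixes P :: "('v, 'k::field) mpol \<Rightarrow> bool"
  assumes "p \<in> carrier (poly_alg Y)" "P 0"
    and "\<And>u c p. \<lbrakk>u \<in> monomials Y; p \<in> carrier (poly_alg Y); P p\<rbrakk> \<Longrightarrow> P (single u c + p)"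
  shows "P p"
proof -
  have "keys p \<subseteq> F \<Longrightarrow> p \<in> carrier (poly_alg Y) \<Longrightarrow> P p"
    if "finite F" for F p
    using that
  proof (induction F arbitrary: p)
    case empty
    hence "p = 0" by simp
    thus ?case using assms(2) by simp
  next
    case (insert u F)
    define q where "q = p - single u (lookup p u)"
    have q: "lookup q v = (if v = u then 0 else lookup p v)" for v
      by (auto simp: q_def lookup_minus lookup_single)
    have kq: "keys q \<subseteq> F" "keys q \<subseteq> keys p"
      using insert.prems(1) by (auto simp: in_keys_iff q split: if_splits)
    have qc: "q \<in> carrier (poly_alg Y)"
      using kq insert.prems(2) by (auto simp: carrier_poly_alg)
    have eq: "p = single u (lookup p u) + q" by (simp add: q_def)
    show ?case
    proof (cases "u \<in> keys p")
      case True
      hence "u \<in> monomials Y" using insert.prems(2) by (auto simp: carrier_poly_alg)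
      with insert.IH[OF kq(1) qc] qc show ?thesis by (subst eq) (rule assms(3))
    next
      case False
      with insert.prems(1) insert.IH[of p] insert.prems(2) show ?thesis by blast
    qed
  qed
  from this[OF finite_keys order.refl assms(1)] show ?thesis .
qed

lemma poly_alg_UNIV [simp]: "p \<in> carrier (poly_alg UNIV)"
  by (simp add: carrier_poly_alg monomials_def)

lemma mpol_sum_single:
  "(\<Sum>m\<in>keys p. single m (lookup p m)) = p"
proof (rule poly_mapping_eqI)
  fix k
  have "lookup (\<Sum>m\<in>keys p. single m (lookup p m)) k
      = (\<Sum>m\<in>keys p. if m = k then lookup p k else 0)"
    unfolding lookup_sum by (rule sum.cong) (auto simp: lookup_single when_def)
  also have "\<dots> = lookup p k"
    using not_in_keys_iff_lookup_eq_zero[of k p] by simp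
  finally show "lookup
      (\<Sum>m\<in>keys p. single m (lookup p m)) k = lookup p k" .
qed

section \<open>Leading monomials over a well-ordered alphabet\<close>

locale letter_order =
  fixes Y :: "'v set" and s :: "'v rel"
  assumes total: "total_on Y s" and trans: "trans s" and wf: "wf s"
begin

abbreviation mless (infix \<open>\<sqsubset>\<close> 50) where "u \<sqsubset> v \<equiv> (u, v) \<in> deglex s"

lemma irrefl: "irrefl s"
  using wf wf_irrefl by (auto simp: irrefl_def)

lemma mless_trans: "u \<sqsubset> v \<Longrightarrow> v \<sqsubset> w \<Longrightarrow> u \<sqsubset> w"
  using deglex_trans[OF trans irrefl] by (rule transD)

lemma mless_irrefl [simp]: "\<not> u \<sqsubset> u"
  using deglex_wf[OF trans wf] by (rule wf_irrefl) auto

lemma mless_total: "u \<in> monomials Y \<Longrightarrow> v \<in> monomials Y \<Longrightarrow> u \<sqsubset> v \<or> u = v \<or> v \<sqsubset> u"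
  using deglex_total[OF total trans] by (auto simp: total_on_def)

lemma mless_add_right:
  assumes "u \<sqsubset> v" "u \<in> monomials Y" "v \<in> monomials Y" "w \<in> monomials Y"
  shows "u + w \<sqsubset> v + w"
  using assms deglex_iff_count_less[OF total trans irrefl] count_less_add_right_iff[of s u w v]
  by (simp add: monomials_add)

lemma lead_mon_eqI:
  assumes "m \<in> keys p" "\<And>m'. m' \<in> keys p \<Longrightarrow> m' \<noteq> m \<Longrightarrow> m' \<sqsubset> m"
  shows "lead_mon s p = m"
  unfolding lead_mon_def
proof (rule the_equality)
  fix m' assume "m' \<in> keys p \<and>
    (\<forall>m''\<in>keys p. m'' \<noteq> m' \<longrightarrow> m'' \<sqsubset> m')"
  thus "m' = m" using assms(1) assms(2)[of m'] mless_trans[of m m' m] mless_irrefl[of m] by metis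
qed (use assms in auto)

lemma lead_mon_in_keys:
  assumes "p \<in> carrier (poly_alg Y)" "p \<noteq> 0"
  shows "lead_mon s p \<in> keys p"
    and "m' \<in> keys p \<Longrightarrow> m' \<noteq> lead_mon s p \<Longrightarrow> m' \<sqsubset> lead_mon s p"
proof -
  obtain m where "m \<in> keys p" "\<forall>m'\<in>keys p. m' = m \<or> m' \<sqsubset> m"
    using total_on_greatest[OF finite_keys _ _ deglex_total[OF total trans] deglex_trans[OF trans irrefl],
        of p] assms by (auto simp: carrier_poly_alg)
  moreover from this have "lead_mon s p = m" by (intro lead_mon_eqI) auto
  ultimately show "lead_mon s p \<in> keys p"
    "m' \<in> keys p \<Longrightarrow> m' \<noteq> lead_mon s p \<Longrightarrow> m' \<sqsubset> lead_mon s p"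
    by auto
qed

lemma lead_mon_in_monomials:
  "p \<in> carrier (poly_alg Y) \<Longrightarrow> p \<noteq> 0 \<Longrightarrow> lead_mon s p \<in> monomials Y"
  using lead_mon_in_keys(1)[of p] by (auto simp: carrier_poly_alg)

lemma lead_mon_single_add:
  assumes "c \<noteq> 0" "\<And>m'. m' \<in> keys q \<Longrightarrow> m' \<sqsubset> m"
  shows "lead_mon s (single m c + q) = m"
    and "lookup (single m c + q) m = c"
    and "single m c + q \<noteq> 0"
proof -
  have "m \<notin> keys q" using assms(2) mless_irrefl by blast
  thus c: "lookup (single m c + q) m = c"
    by (simp add: lookup_add in_keys_iff)
  thus "single m c + q \<noteq> 0" using assms(1) by auto
  show "lead_mon s (single m c + q) = m"
  proof (rule lead_mon_eqI)
    show "m \<in> keys (single m c + q)" unfolding in_keys_iff c by (rule assms(1))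
    fix m' assume "m' \<in> keys (single m c + q)" "m' \<noteq> m"
    hence "m' \<in> keys q" by (auto simp: in_keys_iff lookup_add lookup_single)
    thus "m' \<sqsubset> m" by (rule assms(2))
  qed
qed

lemma monic_split:
  assumes "p \<in> carrier (poly_alg Y)" "monic s p"
  obtains q where "p = mon_poly (lead_mon s p) + q" "q \<in> carrier (poly_alg Y)"
    "\<And>m'. m' \<in> keys q \<Longrightarrow> m' \<sqsubset> lead_mon s p"
proof -
  define q where "q = p - mon_poly (lead_mon s p)"
  have q: "q \<in> carrier (poly_alg Y)"
    using assms lead_mon_in_monomials[of p] by (auto simp: q_def monic_def poly_alg_closed)
  have "m' \<sqsubset> lead_mon s p" if "m' \<in> keys q" for m'
  proof -
    have "m' \<noteq> lead_mon s p"
      using that assms(2) by (auto simp: q_def in_keys_iff lookup_minus mon_poly_def monic_def)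
    hence "m' \<in> keys p"
      using that by (auto simp: q_def in_keys_iff lookup_minus mon_poly_def lookup_single)
    thus ?thesis using lead_mon_in_keys(2)[of p m'] assms \<open>m' \<noteq> _\<close> by (auto simp: monic_def)
  qed
  with q show ?thesis by (intro that[of q]) (simp_all add: q_def)
qed

section \<open>Standard representations and Buchberger's criterion\<close>

text \<open>Sums of monomial multiples of elements of \<open>S\<close> whose leading words stay in
  \<open>W\<close>. With \<open>W = monomials Y\<close> this plays the part of the ideal generated
  by \<open>S\<close>; with the words below \<open>w\<close> it is the kind of sum demanded of
  S-polynomials in a Groebner basis.\<close>

inductive_set reps :: "('v, 'k::field) mpol set \<Rightarrow> 'v multiset set \<Rightarrow> ('v, 'k) mpol set"
  for S W where
  reps_zero: "0 \<in> reps S W"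
| reps_step: "\<lbrakk>f \<in> S; u \<in> monomials Y; lead_mon s f + u \<in> W; p \<in> reps S W\<rbrakk>
    \<Longrightarrow> single u c * f + p \<in> reps S W"

lemma reps_term:
  "\<lbrakk>f \<in> S; u \<in> monomials Y; lead_mon s f + u \<in> W\<rbrakk> \<Longrightarrow> single u c * f \<in> reps S W"
  using reps_step[OF _ _ _ reps_zero, of f S u W c] by simp

lemma reps_add: "p \<in> reps S W \<Longrightarrow> q \<in> reps S W \<Longrightarrow> p + q \<in> reps S W"
  by (induction rule: reps.induct) (auto simp: add.assoc intro: reps_step)

lemma reps_mult_single:
  assumes "p \<in> reps S W" "v \<in> monomials Y" "\<And>w. w \<in> W \<Longrightarrow> w + v \<in> W'"
  shows "single v d * p \<in> reps S W'"
  using assms(1)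
proof (induction rule: reps.induct)
  case (reps_step f u p c)
  have "single v d * (single u c * f + p) =
    single (u + v) (d * c) * f + single v d * p"
    by (simp add: distrib_left mult.assoc[symmetric] mult_single add.commute)
  also have "\<dots> \<in> reps S W'"
    using reps_step assms(2,3)
    by (intro reps.reps_step) (auto simp: monomials_add add.assoc[symmetric])
  finally show ?case .
qed (simp add: reps_zero)

lemma reps_uminus: "p \<in> reps S W \<Longrightarrow> - p \<in> reps S W"
  using reps_mult_single[of p S W "{#}" W "- 1"] by (simp add: uminus_eq_single)

lemma reps_diff: "p \<in> reps S W \<Longrightarrow> q \<in> reps S W \<Longrightarrow> p - q \<in> reps S W"
  using reps_add[of p S W "- q"] reps_uminus by auto

lemma reps_mono: "p \<in> reps S W \<Longrightarrow> W \<subseteq> W' \<Longrightarrow> S \<subseteq> S' \<Longrightarrow> p \<in> reps S' W'"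
  by (induction rule: reps.induct) (auto intro: reps.intros)

lemma reps_mult:
  assumes "g \<in> S" "q \<in> carrier (poly_alg Y)"
    and "\<And>m. m \<in> keys q \<Longrightarrow> lead_mon s g + m \<in> W"
  shows "q * g \<in> reps S W"
proof -
  have "q * g = (\<Sum>m\<in>keys q. single m (lookup q m)) * g"
    by (simp add: mpol_sum_single)
  also have "\<dots> = (\<Sum>m\<in>keys q. single m (lookup q m) * g)"
    by (simp add: sum_distrib_right)
  also have "\<dots> \<in> reps S W"
  proof -
    have "(\<Sum>m\<in>F. single m (lookup q m) * g) \<in> reps S W"
      if "finite F" "F \<subseteq> keys q" for F
      using that
    proof (induction F)
      case (insert m F)
      have "single m (lookup q m) * g \<in> reps S W"
        using insert.prems assms by (intro reps_term) (auto simp: carrier_poly_alg)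
      with insert show ?case by (auto intro: reps_add)
    qed (simp add: reps_zero)
    thus ?thesis by simp
  qed
  finally show ?thesis .
qed

lemma reps_in_poly_alg:
  "p \<in> reps S W \<Longrightarrow> S \<subseteq> carrier (poly_alg Y) \<Longrightarrow> p \<in> carrier (poly_alg Y)"
  by (induction rule: reps.induct) (auto simp: poly_alg_closed subset_iff)

text \<open>A representation is a finite sum, so the largest of its words bounds the others;
  \<open>p \<noteq> 0\<close> excludes the empty sum, which has no word. This starts the descent in
  \<open>reps_lead_mon\<close>.\<close>

lemma reps_bound:
  assumes "p \<in> reps S W" "W \<subseteq> monomials Y" "p \<noteq> 0"
  shows "\<exists>w\<in>W. p \<in> reps S {m. m = w \<or> m \<sqsubset> w}"
  using assms(1,3)
proof (induction rule: reps.induct)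
  case (reps_step f u p c)
  let ?W = "\<lambda>w. {m. m = w \<or> m \<sqsubset> w}"
  let ?v = "lead_mon s f + u"
  have 1: "single u c * f \<in> reps S (?W ?v)"
    using reps_step.hyps by (intro reps_term) auto
  show ?case
  proof (cases "p = 0")
    case True
    with 1 reps_step.hyps show ?thesis by auto
  next
    case False
    then obtain w where w: "w \<in> W" "p \<in> reps S (?W w)" using reps_step.IH by blast
    consider "?v \<sqsubset> w \<or> ?v = w" | "w \<sqsubset> ?v"
      using mless_total[of ?v w] w(1) reps_step.hyps assms(2) by blast
    then show ?thesis
    proof cases
      case 1
      hence "?W ?v \<subseteq> ?W w" using mless_trans by auto
      from reps_mono[OF \<open>_ \<in> reps S (?W ?v)\<close> this order.refl]
      have "single u c * f \<in> reps S (?W w)" .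
      with w show ?thesis by (auto intro: reps_add)
    next
      case 2
      hence "?W w \<subseteq> ?W ?v" using mless_trans by auto
      from reps_mono[OF w(2) this order.refl]
      have "p \<in> reps S (?W ?v)" .
      with 1 reps_step.hyps show ?thesis by (auto intro: reps_add)
    qed
  qed
qed auto

lemma keys_single_mult_lead:
  assumes "f \<in> carrier (poly_alg Y)" "monic s f" "u \<in> monomials Y" "c \<noteq> 0"
    and "p \<in> carrier (poly_alg Y)"
    and "\<And>m. m \<in> keys p \<Longrightarrow> m \<sqsubset> lead_mon s f + u"
  shows "lead_mon s (single u c * f + p) = lead_mon s f + u"
proof -
  obtain q where q: "f = mon_poly (lead_mon s f) + q" "q \<in> carrier (poly_alg Y)"
    "\<And>m'. m' \<in> keys q \<Longrightarrow> m' \<sqsubset> lead_mon s f"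
    using monic_split[OF assms(1,2)] by blast
  have lf: "lead_mon s f \<in> monomials Y" using assms lead_mon_in_monomials by (auto simp: monic_def)
  have "single u c * f + p =
      single (lead_mon s f + u) c + (single u c * q + p)"
    by (subst q(1)) (simp add: distrib_left mon_poly_def mult_single add.commute add.left_commute)
  also have "lead_mon s \<dots> = lead_mon s f + u"
  proof (rule lead_mon_single_add(1)[OF assms(4)])
    fix m' assume "m' \<in> keys (single u c * q + p)"
    then consider "m' \<in> keys p" | "m' \<in> keys (single u c * q)"
      using keys_add[of "single u c * q" p] by blast
    thus "m' \<sqsubset> lead_mon s f + u"
    proof cases
      case 2
      then obtain m where m: "m \<in> keys q" "m' = u + m"
        using keys_mult[of "single u c" q] by (auto split: if_splits)
      have "m + u \<sqsubset> lead_mon s f + u"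
        using m(1) q(2) lf assms(3) by (intro mless_add_right q(3)) (auto simp: carrier_poly_alg)
      thus ?thesis by (simp add: m(2) add.commute)
    qed (rule assms(6))
  qed
  finally show ?thesis .
qed

lemma reps_keys:
  assumes "p \<in> reps S {m. m \<sqsubset> w}" "S \<subseteq> carrier (poly_alg Y)" "\<forall>f\<in>S. monic s f"
    and "m \<in> keys p"
  shows "m \<sqsubset> w"
  using assms(1,4)
proof (induction rule: reps.induct)
  case (reps_step f u p c)
  have f: "f \<in> carrier (poly_alg Y)" "f \<noteq> 0" using reps_step assms by (auto simp: monic_def)
  show ?case
  proof (cases "m \<in> keys p")
    case False
    then obtain m' where m': "m' \<in> keys f" "m = m' + u"
      using reps_step.prems keys_add[of "single u c * f" p]
        keys_mult[of "single u c" f] by (fastforce split: if_splits simp: add.commute)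
    have "m' + u = lead_mon s f + u \<or> m' + u \<sqsubset> lead_mon s f + u"
      using lead_mon_in_keys[OF f] m'(1) f reps_step.hyps(2)
      by (cases "m' = lead_mon s f") (auto intro!: mless_add_right simp: carrier_poly_alg)
    with reps_step.hyps(3) m'(2) show ?thesis using mless_trans by auto
  qed (use reps_step in auto)
qed auto

text \<open>Modulo \<open>reps S {m. m \<sqsubset> w}\<close> all multiples of elements of \<open>S\<close> with leading monomial \<open>w\<close>
  agree, so a sum of such multiples either keeps \<open>w\<close> as its leading monomial or drops below \<open>w\<close>.\<close>

lemma reps_top:
  fixes S :: "('v, 'k::field) mpol set"
  assumes crit: "\<And>f g u v w. \<lbrakk>f \<in> S; g \<in> S; u \<in> monomials Y; v \<in> monomials Y;
      w = lead_mon s f + u; w = lead_mon s g + v\<rbrakk> \<Longrightarrow>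
      f * mon_poly u - g * mon_poly v \<in> reps S {m. m \<sqsubset> w}"
    and "p \<in> reps S {m. m = w \<or> m \<sqsubset> w}"
  shows "p \<in> reps S {m. m \<sqsubset> w} \<or> (\<exists>f\<in>S. \<exists>u\<in>monomials Y. \<exists>c. c \<noteq> 0 \<and> w = lead_mon s f + u \<and>
    (\<exists>q\<in>reps S {m. m \<sqsubset> w}. p = single u c * f + q))"
  using assms(2)
proof (induction rule: reps.induct)
  case (reps_step f u p c)
  show ?case
  proof (cases "lead_mon s f + u \<sqsubset> w \<or> c = 0")
    case True
    hence 1: "single u c * f \<in> reps S {m. m \<sqsubset> w}"
      using reps_step.hyps by (auto intro: reps_term reps_zero)
    from reps_step.IH show ?thesis
    proof
      assume "p \<in> reps S {m. m \<sqsubset> w}"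
      with 1 show ?thesis by (auto intro: reps_add)
    next
      assume "\<exists>f\<in>S. \<exists>u\<in>monomials Y. \<exists>c. c \<noteq> 0 \<and> w = lead_mon s f + u \<and>
        (\<exists>q\<in>reps S {m. m \<sqsubset> w}. p = single u c * f + q)"
      then obtain g v d q where g: "g \<in> S" "v \<in> monomials Y" "d \<noteq> 0" "w = lead_mon s g + v"
        "q \<in> reps S {m. m \<sqsubset> w}" "p = single v d * g + q" by blast
      hence "single u c * f + p =
        single v d * g + (single u c * f + q)" by (simp add: algebra_simps)
      with g 1 show ?thesis using reps_add by blast
    qed
  next
    case False
    with reps_step.hyps have w: "w = lead_mon s f + u" "c \<noteq> 0" by auto
    from reps_step.IH show ?thesis
    proof
      assume "p \<in> reps S {m. m \<sqsubset> w}"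
      with w reps_step.hyps show ?thesis by blast
    next
      assume "\<exists>f\<in>S. \<exists>u\<in>monomials Y. \<exists>c. c \<noteq> 0 \<and> w = lead_mon s f + u \<and>
        (\<exists>q\<in>reps S {m. m \<sqsubset> w}. p = single u c * f + q)"
      then obtain g v d q where g: "g \<in> S" "v \<in> monomials Y" "d \<noteq> 0" "w = lead_mon s g + v"
        "q \<in> reps S {m. m \<sqsubset> w}" "p = single v d * g + q" by blast
      \<comment> \<open>The former top multiple of \<open>g\<close> is traded for one of
        \<open>f\<close>: \<open>crit\<close> makes the difference lower, and the coefficients merge
        into \<open>c + d\<close>, which may vanish.\<close>
      define e where "e = single {#} d * (g * mon_poly v - f * mon_poly u) + q"
      have "g * mon_poly v - f * mon_poly u \<in> reps S {m. m \<sqsubset> w}"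
        using g w reps_step.hyps by (intro crit) auto
      hence e: "e \<in> reps S {m. m \<sqsubset> w}"
        unfolding e_def by (intro reps_add g reps_mult_single) auto
      have m: "single {#} d * (h * mon_poly t) = single t d * h"
        for h :: "('v, 'k) mpol" and t
      proof -
        have "single t d = single {#} d * mon_poly t"
          by (simp add: mon_poly_def mult_single)
        thus ?thesis by (simp add: ac_simps)
      qed
      have "single u c * f + p = single u (c + d) * f + e"
        unfolding e_def g(6) by (simp add: m right_diff_distrib single_add distrib_right)
      with e w(1) reps_step.hyps show ?thesis
        by (cases "c + d = 0") auto
    qed
  qed
qed (simp add: reps_zero)

text \<open>Buchberger's criterion, by well-founded descent on a bound \<open>w\<close> for the
  words of a representation: either the multiples at \<open>w\<close> cancel and a smaller bound
  serves, or one survives and \<open>w\<close> is the leading monomial.\<close>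

theorem reps_lead_mon:
  assumes crit: "\<And>f g u v w. \<lbrakk>f \<in> S; g \<in> S; u \<in> monomials Y; v \<in> monomials Y;
      w = lead_mon s f + u; w = lead_mon s g + v\<rbrakk> \<Longrightarrow>
      f * mon_poly u - g * mon_poly v \<in> reps S {m. m \<sqsubset> w}"
    and S: "S \<subseteq> carrier (poly_alg Y)" "\<forall>f\<in>S. monic s f"
    and "p \<in> reps S (monomials Y)" "p \<noteq> 0"
  shows "\<exists>f\<in>S. \<exists>u\<in>monomials Y. lead_mon s p = lead_mon s f + u"
proof -
  have main: "\<exists>f\<in>S. \<exists>u\<in>monomials Y. lead_mon s p = lead_mon s f + u"
    if "w \<in> monomials Y" "p \<in> reps S {m. m = w \<or> m \<sqsubset> w}" "p \<noteq> 0" for w p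
    using that
  proof (induction w arbitrary: p rule: wf_induct_rule[OF deglex_wf[OF trans wf]])
    case (1 w)
    from reps_top[OF crit 1(3)] show ?case
    proof
      assume "p \<in> reps S {m. m \<sqsubset> w}"
      \<comment> \<open>\<open>reps_bound\<close> compares words by totality, which is available
        inside \<open>monomials Y\<close> only.\<close>
      hence "p \<in> reps S {m \<in> monomials Y. m \<sqsubset> w}"
      proof (induction rule: reps.induct)
        case (reps_step f u p c)
        have "lead_mon s f \<in> monomials Y"
          using reps_step S by (intro lead_mon_in_monomials) (auto simp: monic_def)
        with reps_step show ?case by (intro reps.reps_step) (auto simp: monomials_add)
      qed (rule reps_zero)
      from reps_bound[OF this _ 1(4)] 1(1)[OF _ _ _ 1(4)] show ?case by auto
    next
      assume "\<exists>f\<in>S. \<exists>u\<in>monomials Y. \<exists>c. c \<noteq> 0 \<and> w = lead_mon s f + u \<and>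
        (\<exists>q\<in>reps S {m. m \<sqsubset> w}. p = single u c * f + q)"
      then obtain f u c q where f: "f \<in> S" "u \<in> monomials Y" "c \<noteq> 0" "w = lead_mon s f + u"
        "q \<in> reps S {m. m \<sqsubset> w}" "p = single u c * f + q" by blast
      have "lead_mon s p = lead_mon s f + u"
        unfolding f(6) using f S reps_keys[OF f(5) S] reps_in_poly_alg[OF f(5) S(1)]
        by (intro keys_single_mult_lead) auto
      with f show ?case by blast
    qed
  qed
  from reps_bound[OF assms(4) _ assms(5)] main assms(5) show ?thesis by blast
qed

text \<open>Buchberger's product criterion. Removing the leading monomials from \<open>f\<close> and
  \<open>g\<close> leaves tails \<open>f'\<close> and \<open>g'\<close>, and the difference becomes
  \<open>f' g - g' f\<close> times the monomial \<open>c\<close>; tails have smaller monomials, so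
  all words drop below the bound. This resolves every common multiple that the product of the two
  leading monomials divides, hence all of them when these are coprime.\<close>

lemma reps_coprime:
  assumes "f \<in> S" "g \<in> S" "S \<subseteq> carrier (poly_alg Y)" "\<forall>f\<in>S. monic s f" "c \<in> monomials Y"
  shows "f * mon_poly (lead_mon s g + c) - g * mon_poly (lead_mon s f + c) \<in>
    reps S {m. m \<sqsubset> lead_mon s f + lead_mon s g + c}"
proof -
  have fg: "f \<in> carrier (poly_alg Y)" "g \<in> carrier (poly_alg Y)" "monic s f" "monic s g"
    using assms by auto
  obtain f' where f': "f = mon_poly (lead_mon s f) + f'" "f' \<in> carrier (poly_alg Y)"
    "\<And>m'. m' \<in> keys f' \<Longrightarrow> m' \<sqsubset> lead_mon s f"
    using monic_split[OF fg(1,3)] by blast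
  obtain g' where g': "g = mon_poly (lead_mon s g) + g'" "g' \<in> carrier (poly_alg Y)"
    "\<And>m'. m' \<in> keys g' \<Longrightarrow> m' \<sqsubset> lead_mon s g"
    using monic_split[OF fg(2,4)] by blast
  have l: "lead_mon s f \<in> monomials Y" "lead_mon s g \<in> monomials Y"
    using fg lead_mon_in_monomials by (auto simp: monic_def)
  let ?W = "{m \<in> monomials Y. m \<sqsubset> lead_mon s f + lead_mon s g}"
  have A: "f' * g \<in> reps S ?W"
  proof (rule reps_mult)
    fix m assume "m \<in> keys f'"
    hence "m + lead_mon s g \<sqsubset> lead_mon s f + lead_mon s g"
      using f' l by (intro mless_add_right) (auto simp: carrier_poly_alg)
    thus "lead_mon s g + m \<in> ?W"
      using f'(2) l \<open>m \<in> _\<close> by (auto simp: add.commute monomials_add carrier_poly_alg)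
  qed (use assms f' in auto)
  have B: "g' * f \<in> reps S ?W"
  proof (rule reps_mult)
    fix m assume "m \<in> keys g'"
    hence "m + lead_mon s f \<sqsubset> lead_mon s g + lead_mon s f"
      using g' l by (intro mless_add_right) (auto simp: carrier_poly_alg)
    thus "lead_mon s f + m \<in> ?W"
      using g'(2) l \<open>m \<in> _\<close> by (auto simp: add.commute monomials_add carrier_poly_alg)
  qed (use assms g' in auto)
  have L: "mon_poly (u + c) = mon_poly u * mon_poly c" for u
    by (simp add: mon_poly_def mult_single)
  have "f * mon_poly (lead_mon s g + c) - g * mon_poly (lead_mon s f + c) =
      mon_poly c * (f * (g - g') - g * (f - f'))"
  proof -
    have "f - f' = mon_poly (lead_mon s f)" "g - g' = mon_poly (lead_mon s g)"
      using f'(1) g'(1) by (metis add_diff_cancel_right')+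
    thus ?thesis unfolding L by (simp add: right_diff_distrib ac_simps)
  qed
  also have "\<dots> = single c 1 * (f' * g - g' * f)"
    by (simp add: mon_poly_def algebra_simps)
  also have "\<dots> \<in> reps S {m. m \<sqsubset> lead_mon s f + lead_mon s g + c}"
  proof (rule reps_mult_single)
    show "f' * g - g' * f \<in> reps S ?W" by (rule reps_diff[OF A B])
  qed (use assms l in \<open>auto intro!: mless_add_right simp: monomials_add\<close>)
  finally show ?thesis .
qed

end

section \<open>Algebra homomorphisms and quotient algebras\<close>

lemma poly_alg_algebra: "algebra (ring_of_type_algebra :: 'k::field ring) (poly_alg Y :: ('k, ('v, 'k) mpol) module)"
proof (rule algebraI)
  show "cring (ring_of_type_algebra :: 'k ring)" by (rule cring_from_type_algebra)
  show "cring (poly_alg Y :: ('k, ('v, 'k) mpol) module)"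
  proof (rule cringI)
    show "abelian_group (poly_alg Y :: ('k, ('v, 'k) mpol) module)"
    proof (rule abelian_groupI)
      fix x :: "('v, 'k) mpol" assume "x \<in> carrier (poly_alg Y)"
      thus "\<exists>y\<in>carrier (poly_alg Y). y \<oplus>\<^bsub>poly_alg Y\<^esub> x = \<zero>\<^bsub>poly_alg Y\<^esub>"
        by (intro bexI[of _ "- x"]) (simp_all add: poly_alg_closed)
    qed (simp_all add: poly_alg_closed ac_simps)
    show "comm_monoid (poly_alg Y :: ('k, ('v, 'k) mpol) module)"
      by (rule comm_monoidI) (simp_all add: poly_alg_closed ac_simps)
  qed (simp_all add: distrib_right)
qed (simp_all add: poly_alg_closed, simp_all add: scal_eq mult_single single_add algebra_simps
  single_empty_one)

lemma alg_homI:
  assumes "\<And>x. x \<in> carrier A \<Longrightarrow> h x \<in> carrier B"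
    and "\<And>x y. x \<in> carrier A \<Longrightarrow> y \<in> carrier A \<Longrightarrow> h (x \<otimes>\<^bsub>A\<^esub> y) = h x \<otimes>\<^bsub>B\<^esub> h y"
    and "\<And>x y. x \<in> carrier A \<Longrightarrow> y \<in> carrier A \<Longrightarrow> h (x \<oplus>\<^bsub>A\<^esub> y) = h x \<oplus>\<^bsub>B\<^esub> h y"
    and "h \<one>\<^bsub>A\<^esub> = \<one>\<^bsub>B\<^esub>"
    and "\<And>c x. x \<in> carrier A \<Longrightarrow> h (c \<odot>\<^bsub>A\<^esub> x) = c \<odot>\<^bsub>B\<^esub> h x"
  shows "h \<in> alg_hom A B"
  using assms by (auto simp: alg_hom_def ring_hom_def module_hom_def)

lemma alg_homD:
  assumes "h \<in> alg_hom A B"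
  shows "x \<in> carrier A \<Longrightarrow> h x \<in> carrier B"
    and "x \<in> carrier A \<Longrightarrow> y \<in> carrier A \<Longrightarrow> h (x \<otimes>\<^bsub>A\<^esub> y) = h x \<otimes>\<^bsub>B\<^esub> h y"
    and "x \<in> carrier A \<Longrightarrow> y \<in> carrier A \<Longrightarrow> h (x \<oplus>\<^bsub>A\<^esub> y) = h x \<oplus>\<^bsub>B\<^esub> h y"
    and "h \<one>\<^bsub>A\<^esub> = \<one>\<^bsub>B\<^esub>"
    and "x \<in> carrier A \<Longrightarrow> h (c \<odot>\<^bsub>A\<^esub> x) = c \<odot>\<^bsub>B\<^esub> h x"
  using assms by (auto simp: alg_hom_def ring_hom_def module_hom_def)

lemma alg_hom_comp: "g \<in> alg_hom A B \<Longrightarrow> h \<in> alg_hom B C \<Longrightarrow> (\<lambda>x. h (g x)) \<in> alg_hom A C"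
  by (rule alg_homI) (simp_all add: alg_homD[of g A B] alg_homD[of h B C])

lemma alg_hom_id: "(\<lambda>x. x) \<in> alg_hom A A"
  by (rule alg_homI) simp_all

context
  fixes R :: "('k::field, 'r) module" and A :: "('k, 'a) module"
  assumes R: "algebra (ring_of_type_algebra :: 'k ring) R"
    and A: "algebra (ring_of_type_algebra :: 'k ring) A"
begin

interpretation R: algebra "ring_of_type_algebra :: 'k ring" R by (rule R)
interpretation A: algebra "ring_of_type_algebra :: 'k ring" A by (rule A)

lemma alg_hom_zero: "h \<in> alg_hom A R \<Longrightarrow> h \<zero>\<^bsub>A\<^esub> = \<zero>\<^bsub>R\<^esub>"
  using alg_homD(5)[of h A R "\<zero>\<^bsub>A\<^esub>" 0] alg_homD(1)[of h A R "\<zero>\<^bsub>A\<^esub>"]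
    A.smult_l_null[of "\<zero>\<^bsub>A\<^esub>"] R.smult_l_null[of "h \<zero>\<^bsub>A\<^esub>"]
  by simp

lemma alg_hom_minus:
  assumes "h \<in> alg_hom A R" "x \<in> carrier A" "y \<in> carrier A"
  shows "h (x \<ominus>\<^bsub>A\<^esub> y) = h x \<ominus>\<^bsub>R\<^esub> h y"
proof -
  note h = alg_homD[OF assms(1)]
  have "h (\<ominus>\<^bsub>A\<^esub> y) \<oplus>\<^bsub>R\<^esub> h y = \<zero>\<^bsub>R\<^esub>"
    using h(3)[of "\<ominus>\<^bsub>A\<^esub> y" y] assms alg_hom_zero[OF assms(1)] by (simp add: A.l_neg)
  hence "h (\<ominus>\<^bsub>A\<^esub> y) = \<ominus>\<^bsub>R\<^esub> h y"
    using assms h(1) by (intro R.minus_equality[symmetric]) auto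
  thus ?thesis using assms h(3)[of x "\<ominus>\<^bsub>A\<^esub> y"] by (simp add: a_minus_def)
qed

end

context
  fixes R :: "('k::field, 'r) module"
  assumes R: "algebra (ring_of_type_algebra :: 'k ring) R"
begin

interpretation R: algebra "ring_of_type_algebra :: 'k ring" R by (rule R)

text \<open>The main device for operator identities in what follows. Derivations are not
  homomorphisms, so it reaches them through the endomorphism \<open>1 + lam d\<close>.\<close>

lemma poly_alg_hom_eqI:
  fixes h :: "('v, 'k) mpol \<Rightarrow> 'r"
  assumes h: "h \<in> alg_hom (poly_alg Y) R" and h': "h' \<in> alg_hom (poly_alg Y) R"
    and eq: "\<And>x. x \<in> Y \<Longrightarrow> h (mon_poly {#x#}) = h' (mon_poly {#x#})"
    and p: "p \<in> carrier (poly_alg Y)"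
  shows "h p = h' p"
proof -
  note hD = alg_homD[OF h, simplified] and h'D = alg_homD[OF h', simplified]
  have mon: "h (mon_poly m) = h' (mon_poly m)" if "m \<in> monomials Y" for m
    using that
  proof (induction m)
    case empty
    show ?case using hD(4) h'D(4) by (simp add: mon_poly_def single_empty_one)
  next
    case (add x m)
    hence x: "x \<in> Y" "{#x#} \<in> monomials Y" "m \<in> monomials Y" by (auto simp: monomials_def)
    have "mon_poly (add_mset x m) = mon_poly {#x#} * (mon_poly m :: ('v, 'k) mpol)"
      by (simp add: mon_poly_def mult_single)
    thus ?case using add.IH x eq[OF x(1)] hD(2)[of "mon_poly {#x#}" "mon_poly m"]
        h'D(2)[of "mon_poly {#x#}" "mon_poly m"] by (simp add: poly_alg_closed)
  qed
  have "h (single u c) = h' (single u c)" if "u \<in> monomials Y" for u c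
  proof -
    have "single u c = scal c (mon_poly u)" by (simp add: mon_poly_def)
    thus ?thesis using mon[OF that] hD(5)[of "mon_poly u" c] h'D(5)[of "mon_poly u" c] that
      by (simp add: poly_alg_closed)
  qed
  with p show ?thesis
  proof (induction p rule: poly_alg_induct)
    case zero
    show ?case using alg_hom_zero[OF R poly_alg_algebra h] alg_hom_zero[OF R poly_alg_algebra h'] by simp
  qed (simp add: hD(3) h'D(3) poly_alg_closed)
qed

section \<open>Evaluation of polynomials in a commutative algebra\<close>

text \<open>\<open>finprod\<close> ranges over a set, so multiplicities enter as exponents.\<close>

definition mon_eval :: "('v \<Rightarrow> 'r) \<Rightarrow> 'v multiset \<Rightarrow> 'r"
  where "mon_eval f m = (\<Otimes>\<^bsub>R\<^esub>x\<in>set_mset m. f x [^]\<^bsub>R\<^esub> count m x)"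

definition poly_eval :: "('v \<Rightarrow> 'r) \<Rightarrow> ('v, 'k) mpol \<Rightarrow> 'r"
  where "poly_eval f p =
    (\<Oplus>\<^bsub>R\<^esub>m\<in>keys p. lookup p m \<odot>\<^bsub>R\<^esub> mon_eval f m)"

lemma mon_eval_closed:
  assumes "f \<in> Y \<rightarrow> carrier R" "m \<in> monomials Y"
  shows "mon_eval f m \<in> carrier R"
  unfolding mon_eval_def using assms by (intro R.finprod_closed) (auto simp: monomials_def)

lemma mon_eval_add:
  assumes f: "f \<in> Y \<rightarrow> carrier R" and m: "m \<in> monomials Y" "n \<in> monomials Y"
  shows "mon_eval f (m + n) = mon_eval f m \<otimes>\<^bsub>R\<^esub> mon_eval f n"
proof -
  have fc: "f x \<in> carrier R" if "x \<in># m + n" for x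
    using that f m by (auto simp: monomials_def)
  \<comment> \<open>Over the common support of both factors the additional letters have exponent 0
    and contribute 1.\<close>
  have *: "mon_eval f a = (\<Otimes>\<^bsub>R\<^esub>x\<in>set_mset (m + n). f x [^]\<^bsub>R\<^esub> count a x)"
    if a: "set_mset a \<subseteq> set_mset (m + n)" for a
    unfolding mon_eval_def
  proof (rule R.finprod_mono_neutral_cong_left)
    fix x assume "x \<in> set_mset (m + n) - set_mset a"
    hence "count a x = 0" using not_in_iff[of x a] by blast
    thus "f x [^]\<^bsub>R\<^esub> count a x = \<one>\<^bsub>R\<^esub>" by simp
  qed (use a fc in auto)
  have "mon_eval f (m + n) =
    (\<Otimes>\<^bsub>R\<^esub>x\<in>set_mset (m + n). f x [^]\<^bsub>R\<^esub> count m x \<otimes>\<^bsub>R\<^esub> f x [^]\<^bsub>R\<^esub> count n x)"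
    unfolding mon_eval_def
  proof (rule R.finprod_cong')
    fix x assume "x \<in> set_mset (m + n)"
    thus "f x [^]\<^bsub>R\<^esub> count (m + n) x = f x [^]\<^bsub>R\<^esub> count m x \<otimes>\<^bsub>R\<^esub> f x [^]\<^bsub>R\<^esub> count n x"
      by (simp only: count_union R.nat_pow_mult[OF fc])
  qed (use fc in \<open>simp_all add: Pi_def\<close>)
  also have "\<dots> = (\<Otimes>\<^bsub>R\<^esub>x\<in>set_mset (m + n). f x [^]\<^bsub>R\<^esub> count m x) \<otimes>\<^bsub>R\<^esub>
      (\<Otimes>\<^bsub>R\<^esub>x\<in>set_mset (m + n). f x [^]\<^bsub>R\<^esub> count n x)"
    using fc by (intro R.finprod_multf) (simp_all add: Pi_def)
  also have "\<dots> = mon_eval f m \<otimes>\<^bsub>R\<^esub> mon_eval f n"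
    by (subst (1 2) *) simp_all
  finally show ?thesis .
qed

text \<open>Terms may cancel in \<open>p + q\<close>, so the supports of \<open>p\<close>,
  \<open>q\<close> and \<open>p + q\<close> differ; the three sums are compared over one finite
  superset.\<close>

lemma poly_eval_superset:
  assumes f: "f \<in> Y \<rightarrow> carrier R" and "finite F" "keys p \<subseteq> F" "F \<subseteq> monomials Y"
  shows "poly_eval f p = (\<Oplus>\<^bsub>R\<^esub>m\<in>F. lookup p m \<odot>\<^bsub>R\<^esub> mon_eval f m)"
proof -
  have c: "mon_eval f m \<in> carrier R" if "m \<in> F" for m
    using that assms(4) by (intro mon_eval_closed[OF f]) auto
  have z: "lookup p m = 0" if "m \<in> F - keys p" for m
    using that not_in_keys_iff_lookup_eq_zero[of m p] by blast
  show ?thesis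
    unfolding poly_eval_def using assms(2,3) c z R.smult_l_null
    by (intro R.add.finprod_mono_neutral_cong_left) (auto simp: subset_iff)
qed

lemma poly_eval_closed:
  assumes f: "f \<in> Y \<rightarrow> carrier R" and "p \<in> carrier (poly_alg Y)"
  shows "poly_eval f p \<in> carrier R"
  unfolding poly_eval_def using mon_eval_closed[OF f] assms(2)
  by (intro R.finsum_closed) (auto simp: carrier_poly_alg)

lemma poly_eval_add:
  assumes f: "f \<in> Y \<rightarrow> carrier R" and "p \<in> carrier (poly_alg Y)" "q \<in> carrier (poly_alg Y)"
  shows "poly_eval f (p + q) = poly_eval f p \<oplus>\<^bsub>R\<^esub> poly_eval f q"
proof -
  let ?F = "keys p \<union> keys q"
  have F: "finite ?F" "?F \<subseteq> monomials Y" using assms by (auto simp: carrier_poly_alg)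
  have c: "mon_eval f m \<in> carrier R" if "m \<in> ?F" for m
    using that F(2) by (intro mon_eval_closed[OF f]) auto
  have "poly_eval f (p + q) =
    (\<Oplus>\<^bsub>R\<^esub>m\<in>?F. (lookup p m + lookup q m) \<odot>\<^bsub>R\<^esub> mon_eval f m)"
    by (subst poly_eval_superset[OF f F(1) keys_add F(2)]) (simp add: lookup_add)
  also have "\<dots> = (\<Oplus>\<^bsub>R\<^esub>m\<in>?F. lookup p m \<odot>\<^bsub>R\<^esub> mon_eval f m
      \<oplus>\<^bsub>R\<^esub> lookup q m \<odot>\<^bsub>R\<^esub> mon_eval f m)"
    using c R.smult_l_distr by (intro R.finsum_cong') auto
  also have "\<dots> = (\<Oplus>\<^bsub>R\<^esub>m\<in>?F. lookup p m \<odot>\<^bsub>R\<^esub> mon_eval f m)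
      \<oplus>\<^bsub>R\<^esub> (\<Oplus>\<^bsub>R\<^esub>m\<in>?F. lookup q m \<odot>\<^bsub>R\<^esub> mon_eval f m)"
    using c by (intro R.finsum_addf) auto
  also have "\<dots> = poly_eval f p \<oplus>\<^bsub>R\<^esub> poly_eval f q"
    by (subst (1 2) poly_eval_superset[OF f F(1) _ F(2)]) auto
  finally show ?thesis .
qed

lemma poly_eval_single:
  assumes f: "f \<in> Y \<rightarrow> carrier R" and "u \<in> monomials Y"
  shows "poly_eval f (single u c) = c \<odot>\<^bsub>R\<^esub> mon_eval f u"
  using poly_eval_superset[OF f, of "{u}" "single u c"] mon_eval_closed[OF f assms(2)]
    assms(2) by (simp split: if_splits)

lemma poly_eval_single_mult:
  assumes f: "f \<in> Y \<rightarrow> carrier R" and "u \<in> monomials Y" "q \<in> carrier (poly_alg Y)"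
  shows "poly_eval f (single u c * q) = poly_eval f (single u c) \<otimes>\<^bsub>R\<^esub> poly_eval f q"
  using assms(3)
proof (induction q rule: poly_alg_induct)
  case zero
  have "poly_eval f 0 = \<zero>\<^bsub>R\<^esub>" by (simp add: poly_eval_def)
  thus ?case using poly_eval_closed[OF f, of "single u c"] assms(2)
    by (simp add: poly_alg_closed)
next
  case (add v d q)
  have m: "mon_eval f u \<in> carrier R" "mon_eval f v \<in> carrier R"
    using mon_eval_closed[OF f] assms(2) add by auto
  have "poly_eval f (single u c * (single v d + q)) =
    poly_eval f (single (u + v) (c * d)) \<oplus>\<^bsub>R\<^esub> poly_eval f (single u c * q)"
    using assms(2) add by (subst poly_eval_add[OF f, symmetric])
      (auto simp: poly_alg_closed monomials_add distrib_left mult_single)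
  also have "poly_eval f (single (u + v) (c * d)) =
      poly_eval f (single u c) \<otimes>\<^bsub>R\<^esub> poly_eval f (single v d)"
  proof -
    \<comment> \<open>\<open>smult_assoc2\<close> extracts scalars from the left factor only;
      commutativity brings \<open>d\<close> out of the right one.\<close>
    have 1: "mon_eval f u \<otimes>\<^bsub>R\<^esub> (d \<odot>\<^bsub>R\<^esub> mon_eval f v) = d \<odot>\<^bsub>R\<^esub> (mon_eval f u \<otimes>\<^bsub>R\<^esub> mon_eval f v)"
      using m R.smult_assoc2[of d "mon_eval f v" "mon_eval f u"]
        R.m_comm[of "mon_eval f u" "d \<odot>\<^bsub>R\<^esub> mon_eval f v"] R.m_comm[of "mon_eval f u" "mon_eval f v"]
      by (metis R.smult_closed UNIV_I ring_of_type_algebra_sel(1))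
    have "(c \<odot>\<^bsub>R\<^esub> mon_eval f u) \<otimes>\<^bsub>R\<^esub> (d \<odot>\<^bsub>R\<^esub> mon_eval f v) =
        c \<odot>\<^bsub>R\<^esub> (mon_eval f u \<otimes>\<^bsub>R\<^esub> (d \<odot>\<^bsub>R\<^esub> mon_eval f v))"
      using m by (intro R.smult_assoc2) simp_all
    also have "\<dots> = (c * d) \<odot>\<^bsub>R\<^esub> (mon_eval f u \<otimes>\<^bsub>R\<^esub> mon_eval f v)"
      unfolding 1 using m R.smult_assoc1[of c d "mon_eval f u \<otimes>\<^bsub>R\<^esub> mon_eval f v"] by simp
    finally show ?thesis
      using assms(2) add.hyps(1)
      by (simp only: poly_eval_single[OF f] monomials_add mon_eval_add[OF f] simp_thms)
  qed
  also note add.IH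
  also have "poly_eval f (single u c) \<otimes>\<^bsub>R\<^esub> poly_eval f (single v d) \<oplus>\<^bsub>R\<^esub>
      poly_eval f (single u c) \<otimes>\<^bsub>R\<^esub> poly_eval f q =
      poly_eval f (single u c) \<otimes>\<^bsub>R\<^esub>
        (poly_eval f (single v d) \<oplus>\<^bsub>R\<^esub> poly_eval f q)"
    using assms(2) add.hyps by (intro R.r_distr[symmetric] poly_eval_closed[OF f] poly_alg_closed)
  also have "poly_eval f (single v d) \<oplus>\<^bsub>R\<^esub> poly_eval f q =
      poly_eval f (single v d + q)"
    using add.hyps by (intro poly_eval_add[OF f, symmetric] poly_alg_closed)
  finally show ?case .
qed

lemma poly_eval_mult:
  assumes f: "f \<in> Y \<rightarrow> carrier R" and "p \<in> carrier (poly_alg Y)" "q \<in> carrier (poly_alg Y)"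
  shows "poly_eval f (p * q) = poly_eval f p \<otimes>\<^bsub>R\<^esub> poly_eval f q"
  using assms(2)
proof (induction p rule: poly_alg_induct)
  case zero
  have "poly_eval f 0 = \<zero>\<^bsub>R\<^esub>" by (simp add: poly_eval_def)
  thus ?case using poly_eval_closed[OF f assms(3)] by simp
next
  case (add u c p)
  have "poly_eval f ((single u c + p) * q) =
    poly_eval f (single u c * q) \<oplus>\<^bsub>R\<^esub> poly_eval f (p * q)"
    using add assms(3) by (simp add: distrib_right poly_eval_add[OF f] poly_alg_closed)
  also note add.IH
  also have "poly_eval f (single u c * q) =
      poly_eval f (single u c) \<otimes>\<^bsub>R\<^esub> poly_eval f q"
    using add.hyps assms(3) by (intro poly_eval_single_mult[OF f])
  also have "poly_eval f (single u c) \<otimes>\<^bsub>R\<^esub> poly_eval f q \<oplus>\<^bsub>R\<^esub>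
      poly_eval f p \<otimes>\<^bsub>R\<^esub> poly_eval f q =
      (poly_eval f (single u c) \<oplus>\<^bsub>R\<^esub> poly_eval f p) \<otimes>\<^bsub>R\<^esub> poly_eval f q"
    using add.hyps assms(3) by (intro R.l_distr[symmetric] poly_eval_closed[OF f] poly_alg_closed)
  also have "poly_eval f (single u c) \<oplus>\<^bsub>R\<^esub> poly_eval f p =
      poly_eval f (single u c + p)"
    using add.hyps by (intro poly_eval_add[OF f, symmetric] poly_alg_closed)
  finally show ?case .
qed

lemma poly_eval_one:
  assumes f: "f \<in> Y \<rightarrow> carrier R"
  shows "poly_eval f 1 = \<one>\<^bsub>R\<^esub>"
proof -
  have "poly_eval f (single {#} 1) = 1 \<odot>\<^bsub>R\<^esub> mon_eval f {#}"
    by (rule poly_eval_single[OF f monomials_empty(1)])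
  also have "mon_eval f {#} = \<one>\<^bsub>R\<^esub>" by (simp add: mon_eval_def)
  also have "1 \<odot>\<^bsub>R\<^esub> \<one>\<^bsub>R\<^esub> = \<one>\<^bsub>R\<^esub>"
    using R.smult_one[OF R.one_closed] by (simp only: ring_of_type_algebra_sel)
  finally show ?thesis by (simp only: single_empty_one)
qed

lemma poly_eval_scal:
  assumes f: "f \<in> Y \<rightarrow> carrier R" and p: "p \<in> carrier (poly_alg Y)"
  shows "poly_eval f (scal c p) = c \<odot>\<^bsub>R\<^esub> poly_eval f p"
proof -
  note E = poly_eval_closed[OF f p]
  have "poly_eval f (scal c p) = poly_eval f (single {#} c) \<otimes>\<^bsub>R\<^esub> poly_eval f p"
    unfolding scal_eq by (rule poly_eval_single_mult[OF f monomials_empty(1) p])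
  also have "poly_eval f (single {#} c) = c \<odot>\<^bsub>R\<^esub> mon_eval f {#}"
    by (rule poly_eval_single[OF f monomials_empty(1)])
  also have "mon_eval f {#} = \<one>\<^bsub>R\<^esub>" by (simp add: mon_eval_def)
  also have "(c \<odot>\<^bsub>R\<^esub> \<one>\<^bsub>R\<^esub>) \<otimes>\<^bsub>R\<^esub> poly_eval f p = c \<odot>\<^bsub>R\<^esub> (\<one>\<^bsub>R\<^esub> \<otimes>\<^bsub>R\<^esub> poly_eval f p)"
    using E by (intro R.smult_assoc2) simp_all
  also have "\<one>\<^bsub>R\<^esub> \<otimes>\<^bsub>R\<^esub> poly_eval f p = poly_eval f p" using E by (rule R.l_one)
  finally show ?thesis .
qed

lemma poly_eval_hom: "f \<in> Y \<rightarrow> carrier R \<Longrightarrow> poly_eval f \<in> alg_hom (poly_alg Y) R"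
  by (rule alg_homI)
    (simp_all only: poly_alg_sel poly_eval_closed poly_eval_mult poly_eval_add poly_eval_one poly_eval_scal)

lemma poly_eval_var:
  assumes f: "f \<in> Y \<rightarrow> carrier R" and x: "x \<in> Y"
  shows "poly_eval f (mon_poly {#x#}) = f x"
proof -
  have fx: "f x \<in> carrier R" using f x by blast
  have "mon_eval f {#x#} = f x" using fx by (simp add: mon_eval_def)
  moreover have "{#x#} \<in> monomials Y" using x by (simp add: monomials_def)
  ultimately show ?thesis
    using poly_eval_single[OF f, of "{#x#}" 1] R.smult_one[OF fx]
    unfolding mon_poly_def ring_of_type_algebra_sel by simp
qed

section \<open>Quotient algebras and induced operators\<close>

lemma quot_alg_smult:
  assumes J: "ideal J R" and p: "p \<in> carrier R"
  shows "c \<odot>\<^bsub>quot_alg R J\<^esub> (J +>\<^bsub>R\<^esub> p) = J +>\<^bsub>R\<^esub> (c \<odot>\<^bsub>R\<^esub> p)"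
proof -
  interpret J: ideal J R by (rule J)
  have eq: "J +>\<^bsub>R\<^esub> (c \<odot>\<^bsub>R\<^esub> q) = J +>\<^bsub>R\<^esub> (c \<odot>\<^bsub>R\<^esub> p)" if q: "q \<in> J +>\<^bsub>R\<^esub> p" for q
  proof -
    from q obtain j where j: "j \<in> J" "q = j \<oplus>\<^bsub>R\<^esub> p" by (auto simp: a_r_coset_def')
    have jc: "j \<in> carrier R" using j J.a_subset by auto
    \<comment> \<open>A scalar multiple is a ring multiple by \<open>c\<close> times the unit, so a
      ring ideal absorbs it.\<close>
    have "c \<odot>\<^bsub>R\<^esub> j = (c \<odot>\<^bsub>R\<^esub> \<one>\<^bsub>R\<^esub>) \<otimes>\<^bsub>R\<^esub> j" using jc R.smult_assoc2[of c "\<one>\<^bsub>R\<^esub>" j] by simp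
    also have "\<dots> \<in> J" using j by (intro J.I_l_closed) auto
    finally have "c \<odot>\<^bsub>R\<^esub> q \<in> J +>\<^bsub>R\<^esub> (c \<odot>\<^bsub>R\<^esub> p)"
      using j jc p by (auto simp: a_r_coset_def' R.smult_r_distr)
    thus ?thesis using p by (intro J.a_repr_independence'[symmetric]) auto
  qed
  have "p \<in> J +>\<^bsub>R\<^esub> p" using p by (rule J.a_rcos_self)
  hence "J +>\<^bsub>R\<^esub> p \<noteq> {}" by blast
  hence "(\<Union>q\<in>J +>\<^bsub>R\<^esub> p. J +>\<^bsub>R\<^esub> (c \<odot>\<^bsub>R\<^esub> q)) = J +>\<^bsub>R\<^esub> (c \<odot>\<^bsub>R\<^esub> p)"
    by (rule SUP_eq_const) (rule eq)
  thus ?thesis by (simp add: quot_alg_def)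
qed

text \<open>The laws of a commutative algebra are identities, apart from negatives, which are images
  of negatives; so they pass along a surjection that respects the operations. Applied to the residue
  map, this avoids computing with cosets.\<close>

lemma algebra_of_surj:
  fixes Q :: "('k, 'q) module"
  assumes carr: "carrier Q = h ` carrier R"
    and mult: "\<And>x y. x \<in> carrier R \<Longrightarrow> y \<in> carrier R \<Longrightarrow> h x \<otimes>\<^bsub>Q\<^esub> h y = h (x \<otimes>\<^bsub>R\<^esub> y)"
    and add: "\<And>x y. x \<in> carrier R \<Longrightarrow> y \<in> carrier R \<Longrightarrow> h x \<oplus>\<^bsub>Q\<^esub> h y = h (x \<oplus>\<^bsub>R\<^esub> y)"
    and one: "\<one>\<^bsub>Q\<^esub> = h \<one>\<^bsub>R\<^esub>" and zero: "\<zero>\<^bsub>Q\<^esub> = h \<zero>\<^bsub>R\<^esub>"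
    and smult: "\<And>c x. x \<in> carrier R \<Longrightarrow> c \<odot>\<^bsub>Q\<^esub> h x = h (c \<odot>\<^bsub>R\<^esub> x)"
  shows "algebra (ring_of_type_algebra :: 'k ring) Q"
proof (rule algebraI)
  have sc: "c \<odot>\<^bsub>R\<^esub> x \<in> carrier R" if "x \<in> carrier R" for c x
    using R.smult_closed[of c x] that by simp
  show "cring (ring_of_type_algebra :: 'k ring)" by (rule cring_from_type_algebra)
  have hc: "h a \<in> carrier Q" if "a \<in> carrier R" for a
    unfolding carr using that by (rule imageI)
  have rep: "\<exists>a\<in>carrier R. x = h a" if "x \<in> carrier Q" for x
    using that unfolding carr by (rule imageE) blast
  show "cring Q"
  proof (rule cringI)
    show "abelian_group Q"
    proof (rule abelian_groupI)
      fix x y z assume "x \<in> carrier Q" "y \<in> carrier Q" "z \<in> carrier Q"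
      then obtain a b c where abc: "a \<in> carrier R" "b \<in> carrier R" "c \<in> carrier R"
        and x: "x = h a" and y: "y = h b" and z: "z = h c" using rep by metis
      show "x \<oplus>\<^bsub>Q\<^esub> y \<in> carrier Q"
        unfolding x y add[OF abc(1,2)] by (intro hc R.a_closed abc)
      show "x \<oplus>\<^bsub>Q\<^esub> y \<oplus>\<^bsub>Q\<^esub> z = x \<oplus>\<^bsub>Q\<^esub> (y \<oplus>\<^bsub>Q\<^esub> z)"
        unfolding x y z by (simp only: add abc R.a_closed R.a_assoc)
      show "x \<oplus>\<^bsub>Q\<^esub> y = y \<oplus>\<^bsub>Q\<^esub> x"
        unfolding x y add[OF abc(1,2)] add[OF abc(2,1)] R.a_comm[OF abc(1,2)] ..
      show "\<zero>\<^bsub>Q\<^esub> \<oplus>\<^bsub>Q\<^esub> x = x"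
        unfolding x zero add[OF R.zero_closed abc(1)] R.l_zero[OF abc(1)] ..
      have "h (\<ominus>\<^bsub>R\<^esub> a) \<oplus>\<^bsub>Q\<^esub> x = \<zero>\<^bsub>Q\<^esub>"
        unfolding x zero add[OF R.a_inv_closed[OF abc(1)] abc(1)] R.l_neg[OF abc(1)] ..
      thus "\<exists>y\<in>carrier Q. y \<oplus>\<^bsub>Q\<^esub> x = \<zero>\<^bsub>Q\<^esub>"
        using hc[OF R.a_inv_closed[OF abc(1)]] by blast
    next
      show "\<zero>\<^bsub>Q\<^esub> \<in> carrier Q" unfolding zero by (rule hc[OF R.zero_closed])
    qed
    show "comm_monoid Q"
    proof (rule comm_monoidI)
      fix x y z assume "x \<in> carrier Q" "y \<in> carrier Q" "z \<in> carrier Q"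
      then obtain a b c where abc: "a \<in> carrier R" "b \<in> carrier R" "c \<in> carrier R"
        and x: "x = h a" and y: "y = h b" and z: "z = h c" using rep by metis
      show "x \<otimes>\<^bsub>Q\<^esub> y \<in> carrier Q"
        unfolding x y mult[OF abc(1,2)] by (intro hc R.m_closed abc)
      show "x \<otimes>\<^bsub>Q\<^esub> y \<otimes>\<^bsub>Q\<^esub> z = x \<otimes>\<^bsub>Q\<^esub> (y \<otimes>\<^bsub>Q\<^esub> z)"
        unfolding x y z by (simp only: mult abc R.m_closed R.m_assoc)
      show "x \<otimes>\<^bsub>Q\<^esub> y = y \<otimes>\<^bsub>Q\<^esub> x"
        unfolding x y mult[OF abc(1,2)] mult[OF abc(2,1)] R.m_comm[OF abc(1,2)] ..
      show "\<one>\<^bsub>Q\<^esub> \<otimes>\<^bsub>Q\<^esub> x = x"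
        unfolding x one mult[OF R.one_closed abc(1)] R.l_one[OF abc(1)] ..
    next
      show "\<one>\<^bsub>Q\<^esub> \<in> carrier Q" unfolding one by (rule hc[OF R.one_closed])
    qed
    fix x y z assume "x \<in> carrier Q" "y \<in> carrier Q" "z \<in> carrier Q"
    then obtain a b c where abc: "a \<in> carrier R" "b \<in> carrier R" "c \<in> carrier R"
      and x: "x = h a" and y: "y = h b" and z: "z = h c" using rep by metis
    show "(x \<oplus>\<^bsub>Q\<^esub> y) \<otimes>\<^bsub>Q\<^esub> z = x \<otimes>\<^bsub>Q\<^esub> z \<oplus>\<^bsub>Q\<^esub> y \<otimes>\<^bsub>Q\<^esub> z"
      unfolding x y z by (simp only: add mult abc R.a_closed R.m_closed R.l_distr)
  qed
  fix a b :: 'k and x y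
  assume "x \<in> carrier Q"
  then obtain p where p: "p \<in> carrier R" "x = h p" unfolding carr by blast
  show "a \<odot>\<^bsub>Q\<^esub> x \<in> carrier Q" unfolding p(2) smult[OF p(1)] by (intro hc sc p(1))
  show "(a \<oplus>\<^bsub>ring_of_type_algebra\<^esub> b) \<odot>\<^bsub>Q\<^esub> x = a \<odot>\<^bsub>Q\<^esub> x \<oplus>\<^bsub>Q\<^esub> b \<odot>\<^bsub>Q\<^esub> x"
    unfolding p(2) smult[OF p(1)] add[OF sc[OF p(1)] sc[OF p(1)]]
    using R.smult_l_distr[OF _ _ p(1), of a b] by simp
  show "(a \<otimes>\<^bsub>ring_of_type_algebra\<^esub> b) \<odot>\<^bsub>Q\<^esub> x = a \<odot>\<^bsub>Q\<^esub> (b \<odot>\<^bsub>Q\<^esub> x)"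
    unfolding p(2) smult[OF p(1)] smult[OF sc[OF p(1)]]
    using R.smult_assoc1[OF _ _ p(1), of a b] by simp
  show "\<one>\<^bsub>ring_of_type_algebra\<^esub> \<odot>\<^bsub>Q\<^esub> x = x"
    using R.smult_one[OF p(1)] by (simp only: smult[OF p(1)] p(2))
  assume "y \<in> carrier Q"
  then obtain q where q: "q \<in> carrier R" "y = h q" unfolding carr by blast
  show "a \<odot>\<^bsub>Q\<^esub> (x \<oplus>\<^bsub>Q\<^esub> y) = a \<odot>\<^bsub>Q\<^esub> x \<oplus>\<^bsub>Q\<^esub> a \<odot>\<^bsub>Q\<^esub> y"
    unfolding p(2) q(2) add[OF p(1) q(1)] smult[OF p(1)] smult[OF q(1)] smult[OF R.a_closed[OF p(1) q(1)]]
      add[OF sc[OF p(1)] sc[OF q(1)]]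
    using R.smult_r_distr[OF _ p(1) q(1), of a] by simp
  show "(a \<odot>\<^bsub>Q\<^esub> x) \<otimes>\<^bsub>Q\<^esub> y = a \<odot>\<^bsub>Q\<^esub> (x \<otimes>\<^bsub>Q\<^esub> y)"
    unfolding p(2) q(2) mult[OF p(1) q(1)] smult[OF p(1)] smult[OF R.m_closed[OF p(1) q(1)]]
      mult[OF sc[OF p(1)] q(1)]
    using R.smult_assoc2[OF _ p(1) q(1), of a] by simp
qed

context
  fixes J assumes J: "ideal J R"
begin

interpretation J: ideal J R by (rule J)

lemma quot_alg_carrier: "carrier (quot_alg R J) = (\<lambda>p. J +>\<^bsub>R\<^esub> p) ` carrier R"
  by (auto simp: quot_alg_def FactRing_def A_RCOSETS_def')

lemma quot_alg_zero: "\<zero>\<^bsub>quot_alg R J\<^esub> = J +>\<^bsub>R\<^esub> \<zero>\<^bsub>R\<^esub>"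
  using R.a_coset_add_zero[OF J.a_subset]
  by (simp add: quot_alg_def FactRing_def R.a_coset_join2[OF R.zero_closed J.a_subgroup J.zero_closed])

lemma quot_alg_add:
  "p \<in> carrier R \<Longrightarrow> q \<in> carrier R \<Longrightarrow>
    (J +>\<^bsub>R\<^esub> p) \<oplus>\<^bsub>quot_alg R J\<^esub> (J +>\<^bsub>R\<^esub> q) = J +>\<^bsub>R\<^esub> (p \<oplus>\<^bsub>R\<^esub> q)"
  by (simp add: quot_alg_def FactRing_def J.a_rcos_sum)

lemma quot_alg_mult:
  "p \<in> carrier R \<Longrightarrow> q \<in> carrier R \<Longrightarrow>
    (J +>\<^bsub>R\<^esub> p) \<otimes>\<^bsub>quot_alg R J\<^esub> (J +>\<^bsub>R\<^esub> q) = J +>\<^bsub>R\<^esub> (p \<otimes>\<^bsub>R\<^esub> q)"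
  by (simp add: quot_alg_def FactRing_def J.rcoset_mult_add)

lemma quot_alg_one: "\<one>\<^bsub>quot_alg R J\<^esub> = J +>\<^bsub>R\<^esub> \<one>\<^bsub>R\<^esub>"
  by (simp add: quot_alg_def FactRing_def)

lemma quot_alg_algebra: "algebra (ring_of_type_algebra :: 'k ring) (quot_alg R J)"
  by (rule algebra_of_surj[where h = "\<lambda>p. J +>\<^bsub>R\<^esub> p"])
    (simp_all only: quot_alg_carrier quot_alg_mult quot_alg_add quot_alg_one quot_alg_zero
      quot_alg_smult[OF J])

lemma quot_alg_res_hom: "(\<lambda>p. J +>\<^bsub>R\<^esub> p) \<in> alg_hom R (quot_alg R J)"
  by (rule alg_homI)
    (simp_all only: quot_alg_carrier quot_alg_mult quot_alg_add quot_alg_one quot_alg_smult[OF J] imageI)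

lemma quot_alg_eq_iff:
  "p \<in> carrier R \<Longrightarrow> q \<in> carrier R \<Longrightarrow> J +>\<^bsub>R\<^esub> p = J +>\<^bsub>R\<^esub> q \<longleftrightarrow> p \<ominus>\<^bsub>R\<^esub> q \<in> J"
  by (rule R.quotient_eq_iff_same_a_r_cos[OF J, symmetric])

lemma quot_op_coset:
  assumes d: "d \<in> module_hom (ring_of_type_algebra :: 'k ring) R R" and "d ` J \<subseteq> J"
    and p: "p \<in> carrier R"
  shows "quot_op R J d (J +>\<^bsub>R\<^esub> p) = J +>\<^bsub>R\<^esub> d p"
proof -
  have dc: "d x \<in> carrier R" if "x \<in> carrier R" for x
    using module_hom_closed[OF d] that by blast
  have eq: "J +>\<^bsub>R\<^esub> d q = J +>\<^bsub>R\<^esub> d p" if q: "q \<in> J +>\<^bsub>R\<^esub> p" for q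
  proof -
    from q obtain j where j: "j \<in> J" "q = j \<oplus>\<^bsub>R\<^esub> p" by (auto simp: a_r_coset_def')
    have jc: "j \<in> carrier R" using j J.a_subset by auto
    have "d q = d j \<oplus>\<^bsub>R\<^esub> d p" unfolding j(2) using module_hom_add[OF d jc p] .
    moreover have "d j \<in> J" using j(1) assms(2) by auto
    ultimately have "d q \<in> J +>\<^bsub>R\<^esub> d p" by (auto simp: a_r_coset_def')
    thus ?thesis using dc[OF p] by (intro J.a_repr_independence'[symmetric]) auto
  qed
  have "p \<in> J +>\<^bsub>R\<^esub> p" using p by (rule J.a_rcos_self)
  hence "J +>\<^bsub>R\<^esub> p \<noteq> {}" by blast
  hence "(\<Union>q\<in>J +>\<^bsub>R\<^esub> p. J +>\<^bsub>R\<^esub> d q) = J +>\<^bsub>R\<^esub> d p"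
    by (rule SUP_eq_const) (rule eq)
  thus ?thesis by (simp add: quot_op_def)
qed

end

end

section \<open>Copies of the polynomial algebra at each level\<close>

text \<open>Taken over the full alphabet \<open>UNIV\<close>, where every polynomial lies in the
  carrier: the homomorphism laws then hold without side conditions, and only the passage to smaller
  alphabets needs an argument, \<open>mpol_hom_in_poly_alg\<close>.\<close>

definition mpol_subst :: "('v \<Rightarrow> ('w, 'k::field) mpol) \<Rightarrow> ('v, 'k) mpol \<Rightarrow> ('w, 'k) mpol"
  where "mpol_subst = poly_eval (poly_alg UNIV)"

lemma mpol_subst_hom: "mpol_subst f \<in> alg_hom (poly_alg UNIV) (poly_alg UNIV)"
  unfolding mpol_subst_def by (rule poly_eval_hom[OF poly_alg_algebra]) simp

lemma mpol_subst_var: "mpol_subst f (mon_poly {#x#}) = f x"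
  unfolding mpol_subst_def
  by (rule poly_eval_var[OF poly_alg_algebra, where Y = UNIV]) simp_all

lemma mpol_hom_eqI:
  fixes g h :: "('v, 'k::field) mpol \<Rightarrow> ('w, 'k) mpol"
  assumes "g \<in> alg_hom (poly_alg UNIV) (poly_alg UNIV)" "h \<in> alg_hom (poly_alg UNIV) (poly_alg UNIV)"
    and "\<And>x. g (mon_poly {#x#}) = h (mon_poly {#x#})"
  shows "g p = h p"
  by (rule poly_alg_hom_eqI[OF poly_alg_algebra assms(1,2) assms(3) poly_alg_UNIV])

context
  fixes h :: "('v, 'k::field) mpol \<Rightarrow> ('w, 'k) mpol"
  assumes h: "h \<in> alg_hom (poly_alg UNIV) (poly_alg UNIV)"
begin

lemma mpol_hom_mult: "h (p * q) = h p * h q"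
  using alg_homD(2)[OF h, of p q] by simp

lemma mpol_hom_add: "h (p + q) = h p + h q"
  using alg_homD(3)[OF h, of p q] by simp

lemma mpol_hom_one: "h 1 = 1"
  using alg_homD(4)[OF h] by simp

lemma mpol_hom_scal: "h (scal c p) = scal c (h p)"
  using alg_homD(5)[OF h, of p c] by simp

lemma mpol_hom_zero: "h 0 = 0"
  using mpol_hom_add[of 0 0] by simp

lemma mpol_hom_diff: "h (p - q) = h p - h q"
  using mpol_hom_add[of "p - q" q] by (simp add: eq_diff_eq)

lemma mpol_hom_sum: "h (\<Sum>i\<in>F. g i) = (\<Sum>i\<in>F. h (g i))"
  by (induction F rule: infinite_finite_induct) (simp_all add: mpol_hom_zero mpol_hom_add)

lemma mpol_hom_single: "h (single u c) = scal c (h (mon_poly u))"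
  using mpol_hom_scal[of c "mon_poly u"] by (simp add: mon_poly_def)

lemma mpol_hom_expand:
  "h p = (\<Sum>m\<in>keys p. scal (lookup p m) (h (mon_poly m)))"
proof -
  have "h p = h (\<Sum>m\<in>keys p. single m (lookup p m))"
    by (simp only: mpol_sum_single)
  thus ?thesis by (simp only: mpol_hom_sum mpol_hom_single)
qed

lemma mpol_hom_in_poly_alg:
  assumes "\<And>x. x \<in> Y \<Longrightarrow> h (mon_poly {#x#}) \<in> carrier (poly_alg Z)" "p \<in> carrier (poly_alg Y)"
  shows "h p \<in> carrier (poly_alg Z)"
proof -
  have mon: "h (mon_poly m) \<in> carrier (poly_alg Z)" if "m \<in> monomials Y" for m
    using that
  proof (induction m)
    case empty
    show ?case by (simp only: mon_poly_def single_empty_one mpol_hom_one one_in_poly_alg)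
  next
    case (add x m)
    hence x: "x \<in> Y" "m \<in> monomials Y" by (auto simp: monomials_def)
    have "mon_poly (add_mset x m) = mon_poly {#x#} * (mon_poly m :: ('v, 'k) mpol)"
      by (simp add: mon_poly_def mult_single)
    thus ?case using assms(1)[OF x(1)] add.IH[OF x(2)] by (simp only: mpol_hom_mult mult_in_poly_alg)
  qed
  from assms(2) show ?thesis
  proof (induction p rule: poly_alg_induct)
    case zero show ?case by (simp only: mpol_hom_zero zero_in_poly_alg)
  next
    case (add u c p)
    with mon show ?case
      by (simp only: mpol_hom_add mpol_hom_single add_in_poly_alg scal_in_poly_alg)
  qed
qed

end

lemma alg_hom_funpow: "g \<in> alg_hom B B \<Longrightarrow> g ^^ n \<in> alg_hom B B"
proof (induction n)
  case 0 show ?case using alg_hom_id by (simp add: id_def)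
next
  case (Suc n)
  have "g ^^ Suc n = (\<lambda>x. g ((g ^^ n) x))" by auto
  with alg_hom_comp[OF Suc.IH[OF Suc.prems] Suc.prems] show ?case by simp
qed

section \<open>The copy at level n and its leading monomials\<close>

definition shift :: "nat \<Rightarrow> ('x, 'k::field) mpol \<Rightarrow> ('x \<times> nat, 'k) mpol"
  where "shift n = mpol_subst (\<lambda>x. mon_poly {#(x, n)#})"

lemma shift_hom: "shift n \<in> alg_hom (poly_alg UNIV) (poly_alg UNIV)"
  unfolding shift_def by (rule mpol_subst_hom)

lemma shift_var: "shift n (mon_poly {#x#}) = mon_poly {#(x, n)#}"
  by (simp only: shift_def mpol_subst_var)

lemma shift_mon: "shift n (mon_poly u :: ('x, 'k::field) mpol) = mon_poly (bracket n u)"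
proof (induction u)
  case empty
  show ?case
    by (simp only: bracket_def image_mset_empty mon_poly_def single_empty_one mpol_hom_one[OF shift_hom])
next
  case (add x u)
  have "mon_poly (add_mset x u) = mon_poly {#x#} * (mon_poly u :: ('x, 'k) mpol)"
    by (simp add: mon_poly_def mult_single)
  hence "shift n (mon_poly (add_mset x u) :: ('x, 'k) mpol) = mon_poly {#(x, n)#} * mon_poly (bracket n u)"
    by (simp only: mpol_hom_mult[OF shift_hom] add.IH shift_var)
  also have "\<dots> = mon_poly (bracket n (add_mset x u))"
    by (simp add: mon_poly_def mult_single bracket_def)
  finally show ?case .
qed

lemma scal_mon_poly: "scal c (mon_poly u) = single u c"
  by (simp add: mon_poly_def)

lemma shift_expand:
  "shift n p = (\<Sum>u\<in>keys p. single (bracket n u) (lookup p u))"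
  by (subst mpol_hom_expand[OF shift_hom]) (simp only: shift_mon scal_mon_poly)

lemma hat_i_eq_shift: "hat_i = shift 0"
  by (rule ext) (simp only: hat_i_def shift_expand)

lemma bracket_add: "bracket n (u + v) = bracket n u + bracket n v"
  by (simp add: bracket_def)

lemma bracket_monomials: "u \<in> monomials V \<Longrightarrow> bracket n u \<in> monomials (Delta V)"
  by (auto simp: monomials_def bracket_def Delta_def)

lemma shift_keys: "keys (shift n p) \<subseteq> bracket n ` keys p"
proof -
  have "keys (\<Sum>u\<in>F. single (bracket n u) (lookup p u)) \<subseteq> bracket n ` F"
    if "finite F" for F
    using that
  proof (induction F)
    case (insert u F)
    have "keys (single (bracket n u) (lookup p u)) \<subseteq> {bracket n u}"
      by simp
    with insert keys_add show ?case by fastforce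
  qed simp
  thus ?thesis unfolding shift_expand by simp
qed

lemma shift_in_poly_alg: "p \<in> carrier (poly_alg V) \<Longrightarrow> shift n p \<in> carrier (poly_alg (Delta V))"
  using shift_keys[of n p] bracket_monomials by (fastforce simp: carrier_poly_alg)

lemma Delta_less_letter_order:
  assumes "letter_order V s"
  shows "letter_order (Delta V) (Delta_less s)"
proof -
  interpret letter_order V s by (rule assms)
  have "Delta_less s = inv_image (less_than <*lex*> s) (\<lambda>(x, n). (n, x))"
    by (auto simp: Delta_less_def)
  hence "wf (Delta_less s)" using wf by (simp only: wf_inv_image wf_lex_prod wf_less_than)
  moreover have "Relation.trans (Delta_less s)"
    using trans by (auto simp: Delta_less_def trans_def)
  moreover have "total_on (Delta V) (Delta_less s)"
    using total by (auto simp: Delta_less_def total_on_def Delta_def)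
  ultimately show ?thesis by unfold_locales
qed

lemma count_bracket: "count (bracket n u) (x, m) = (if m = n then count u x else 0)"
  by (induction u) (auto simp: bracket_def)

text \<open>Seen through exponents: on one level the letters keep their order, and letters of any
  higher level have exponent 0 on both sides.\<close>

lemma deglex_bracket:
  assumes V: "letter_order V s" and "u \<in> monomials V" "v \<in> monomials V" "(u, v) \<in> deglex s"
  shows "(bracket n u, bracket n v) \<in> deglex (Delta_less s)"
proof -
  interpret letter_order V s by (rule V)
  interpret D: letter_order "Delta V" "Delta_less s" by (rule Delta_less_letter_order[OF V])
  have "count_less s u v" using deglex_imp_count_less[OF trans irrefl assms(4)] .
  hence "count_less (Delta_less s) (bracket n u) (bracket n v)"
    unfolding count_less_def
  proof
    assume "size u = size v \<and> (\<exists>a. count u a < count v a \<and> (\<forall>b. (a, b) \<in> s \<longrightarrow> count u b = count v b))"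
    then obtain a where a: "size u = size v" "count u a < count v a"
      "\<And>b. (a, b) \<in> s \<Longrightarrow> count u b = count v b" by blast
    have "count (bracket n u) (a, n) < count (bracket n v) (a, n)"
      using a(2) by (simp add: count_bracket)
    moreover have "count (bracket n u) b = count (bracket n v) b" if "((a, n), b) \<in> Delta_less s" for b
      using that a(3) by (cases b) (auto simp: Delta_less_def count_bracket)
    moreover have "size (bracket n u) = size (bracket n v)" using a(1) by (simp add: bracket_def)
    ultimately show "size (bracket n u) < size (bracket n v) \<or> size (bracket n u) = size (bracket n v) \<and>
      (\<exists>a. count (bracket n u) a < count (bracket n v) a \<and>
        (\<forall>b. (a, b) \<in> Delta_less s \<longrightarrow> count (bracket n u) b = count (bracket n v) b))" by blast
  qed (simp add: bracket_def)
  thus ?thesis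
    using deglex_iff_count_less[OF D.total D.trans D.irrefl bracket_monomials bracket_monomials] assms(2,3)
    by blast
qed

text \<open>Degree is compared first, hence the condition on sizes. At equal degree the greatest
  letter of \<open>v\<close>, placed at level \<open>n\<close>, exceeds everything at level
  \<open>k\<close>; a nonempty \<open>v\<close> guarantees that this letter exists.\<close>

lemma deglex_bracket_level:
  assumes V: "letter_order V s" and "u \<in> monomials V" "v \<in> monomials V" "size u \<le> size v" "v \<noteq> {#}" "k < n"
  shows "(bracket k u, bracket n v) \<in> deglex (Delta_less s)"
proof -
  interpret letter_order V s by (rule V)
  interpret D: letter_order "Delta V" "Delta_less s" by (rule Delta_less_letter_order[OF V])
  obtain a where a: "a \<in># v" "\<forall>b\<in>#v. (b, a) \<in> s\<^sup>="
    using total_on_greatest[OF finite_set_mset _ _ total trans, of v] assms(3,5)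
    by (auto simp: monomials_def)
  have asym: "(a, b) \<in> s \<Longrightarrow> b \<notin># v" for b
    using a(2) irrefl trans unfolding irrefl_def by (metis pair_in_Id_conv UnE transD)
  have "count (bracket k u) (a, n) < count (bracket n v) (a, n)"
    using a(1) assms(6) by (simp add: count_bracket)
  moreover have "count (bracket k u) b = count (bracket n v) b" if "((a, n), b) \<in> Delta_less s" for b
  proof (cases b)
    case (Pair y m)
    hence "n < m \<or> n = m \<and> (a, y) \<in> s" using that by (simp add: Delta_less_def)
    thus ?thesis using asym[of y] assms(6) by (auto simp: Pair count_bracket not_in_iff)
  qed
  ultimately have "count_less (Delta_less s) (bracket k u) (bracket n v)"
    using assms(4) unfolding count_less_def bracket_def size_image_mset by fastforce
  thus ?thesis
    using deglex_iff_count_less[OF D.total D.trans D.irrefl bracket_monomials bracket_monomials] assms(2,3)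
    by blast
qed

lemma shift_split:
  assumes V: "letter_order V s" and p: "p \<in> carrier (poly_alg V)" "monic s p"
  obtains q where "shift n p = mon_poly (bracket n (lead_mon s p)) + q" "q \<in> carrier (poly_alg (Delta V))"
    "\<And>m. m \<in> keys q \<Longrightarrow> (m, bracket n (lead_mon s p)) \<in> deglex (Delta_less s)"
proof -
  interpret letter_order V s by (rule V)
  obtain q where q: "p = mon_poly (lead_mon s p) + q" "q \<in> carrier (poly_alg V)"
    "\<And>m'. m' \<in> keys q \<Longrightarrow> m' \<sqsubset> lead_mon s p"
    using monic_split[OF p] by blast
  show ?thesis
  proof (rule that[of "shift n q"])
    have "shift n p = shift n (mon_poly (lead_mon s p) + q)" using q(1) by simp
    thus "shift n p = mon_poly (bracket n (lead_mon s p)) + shift n q"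
      by (simp only: mpol_hom_add[OF shift_hom] shift_mon)
    show "shift n q \<in> carrier (poly_alg (Delta V))" by (rule shift_in_poly_alg[OF q(2)])
    fix m assume "m \<in> keys (shift n q)"
    then obtain m' where m': "m = bracket n m'" "m' \<in> keys q" using shift_keys by blast
    have "lead_mon s p \<in> monomials V" using p lead_mon_in_monomials by (auto simp: monic_def)
    moreover have "m' \<in> monomials V" using m'(2) q(2) by (auto simp: carrier_poly_alg)
    ultimately show "(m, bracket n (lead_mon s p)) \<in> deglex (Delta_less s)"
      unfolding m'(1) by (intro deglex_bracket[OF V]) (use q(3) m' in auto)
  qed
qed

lemma shift_lead_mon:
  assumes V: "letter_order V s" and p: "p \<in> carrier (poly_alg V)" "monic s p"
  shows "lead_mon (Delta_less s) (shift n p) = bracket n (lead_mon s p)"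
    and "monic (Delta_less s) (shift n p)"
proof -
  interpret D: letter_order "Delta V" "Delta_less s" by (rule Delta_less_letter_order[OF V])
  obtain q where q: "shift n p = mon_poly (bracket n (lead_mon s p)) + q"
    "\<And>m. m \<in> keys q \<Longrightarrow> (m, bracket n (lead_mon s p)) \<in> deglex (Delta_less s)"
    using shift_split[OF V p] by blast
  note l = D.lead_mon_single_add[of 1 q, OF one_neq_zero q(2), folded mon_poly_def, folded q(1)]
  show 1: "lead_mon (Delta_less s) (shift n p) = bracket n (lead_mon s p)" by (rule l(1))
  show "monic (Delta_less s) (shift n p)" using l(2,3) by (simp add: monic_def 1)
qed

lemma mon_poly_add: "mon_poly (u + v) = mon_poly u * mon_poly v"
  by (simp add: mon_poly_def mult_single)

lemma scal_mult_mon_poly: "scal c (p * mon_poly u) = single u c * p"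
proof -
  have "single u c = single {#} c * mon_poly u"
    by (simp add: mon_poly_def mult_single)
  thus ?thesis unfolding scal_eq by (simp only: ac_simps)
qed

text \<open>Copies of a Groebner basis at different levels have coprime leading monomials, so the only
  S-polynomials to resolve are those inside one level, which are copies of the given ones.\<close>

lemma shift_groebner:
  assumes V: "letter_order V s" and G: "groebner_basis s V I S"
    and f: "f \<in> S" and g: "g \<in> S" and u: "u \<in> monomials (Delta V)" and v: "v \<in> monomials (Delta V)"
    and w: "w = bracket i (lead_mon s f) + u" "w = bracket j (lead_mon s g) + v"
  shows "shift i f * mon_poly u - shift j g * mon_poly v \<in>
    letter_order.reps (Delta V) (Delta_less s) (\<Union>n. shift n ` S) {m. (m, w) \<in> deglex (Delta_less s)}"
proof -
  interpret letter_order V s by (rule V)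
  interpret D: letter_order "Delta V" "Delta_less s" by (rule Delta_less_letter_order[OF V])
  let ?S = "\<Union>n. shift n ` S"
  have S: "S \<subseteq> carrier (poly_alg V)" "\<forall>f\<in>S. monic s f" using G by (auto simp: groebner_basis_def)
  have lS: "lead_mon s h \<in> monomials V" if "h \<in> S" for h
    using that S lead_mon_in_monomials by (auto simp: monic_def)
  have lead: "lead_mon (Delta_less s) (shift n h) = bracket n (lead_mon s h)" if "h \<in> S" for n h
    using shift_lead_mon(1)[OF V] S that by blast
  have S': "?S \<subseteq> carrier (poly_alg (Delta V))" "\<forall>f\<in>?S. monic (Delta_less s) f"
    using S shift_in_poly_alg shift_lead_mon(2)[OF V] by blast+
  let ?F = "bracket i (lead_mon s f)" and ?G = "bracket j (lead_mon s g)"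
  \<comment> \<open>If the product of both leading monomials divides \<open>w\<close>, cancellation
    determines \<open>u\<close> and \<open>v\<close>, and the product criterion applies.\<close>
  have coprime: ?thesis if c: "w = ?F + ?G + c" for c
  proof -
    have "?F + u = ?F + (?G + c)" "?G + v = ?G + (?F + c)" using w c by (simp_all only: ac_simps)
    hence "u = ?G + c" "v = ?F + c" by (simp_all only: add_left_cancel)
    moreover have "c \<in> monomials (Delta V)" using u calculation(1) by (simp add: monomials_add)
    ultimately show ?thesis
      using D.reps_coprime[of "shift i f" ?S "shift j g", OF _ _ S'] f g
      unfolding lead[OF f] lead[OF g] c by blast
  qed
  show ?thesis
  proof (cases "?F \<inter># ?G = {#}")
    \<comment> \<open>This covers all pairs on different levels and the coprime pairs on one level:
      two monomials without a common letter that both divide \<open>w\<close> have a product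
      dividing \<open>w\<close>.\<close>
    case True
    have "?F + ?G \<subseteq># w"
    proof (rule mset_subset_eqI)
      fix a
      have "min (count ?F a) (count ?G a) = 0" using True by (metis count_empty count_inter_mset)
      moreover have "count ?F a \<le> count w a" by (simp add: w(1))
      moreover have "count ?G a \<le> count w a" by (simp add: w(2))
      ultimately show "count (?F + ?G) a \<le> count w a" by (auto simp: min_def split: if_splits)
    qed
    thus ?thesis using coprime by (auto simp: mset_subset_eq_exists_conv)
  next
    case False
    \<comment> \<open>A common letter carries a single level.\<close>
    hence ij: "j = i"
      by (auto simp: bracket_def multiset_eq_iff in_image_mset dest!: multiset_nonemptyE)
    have img: "?F = bracket i (lead_mon s f)" "?G = bracket i (lead_mon s g)" using ij by auto
    \<comment> \<open>Multiset subtraction is truncated, so \<open>w0\<close> is the least common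
      multiple of the two leading monomials, with cofactors \<open>a\<close> and
      \<open>b\<close>.\<close>
    define a b where "a = lead_mon s g - lead_mon s f" and "b = lead_mon s f - lead_mon s g"
    define w0 where "w0 = lead_mon s f + a"
    have w0: "w0 = lead_mon s f + a" "w0 = lead_mon s g + b"
      by (auto simp: w0_def a_def b_def multiset_eq_iff)
    have ab: "a \<in> monomials V" "b \<in> monomials V"
      using lS[OF f] lS[OF g] by (auto simp: a_def b_def monomials_def dest: in_diffD)
    have w0V: "w0 \<in> monomials V" using ab lS[OF f] by (simp add: w0_def monomials_add)
    have "bracket i w0 \<subseteq># w"
    proof (rule mset_subset_eqI)
      fix x
      have "count (bracket i w0) x = max (count ?F x) (count ?G x)"
      proof (cases x)
        case (Pair y m)
        have "count w0 y = max (count (lead_mon s f) y) (count (lead_mon s g) y)"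
          unfolding w0_def a_def by (simp add: max_def)
        thus ?thesis unfolding Pair img(2) count_bracket by (cases "m = i") simp_all
      qed
      moreover have "count ?F x \<le> count w x" by (simp add: w(1))
      moreover have "count ?G x \<le> count w x" by (simp add: w(2))
      ultimately show "count (bracket i w0) x \<le> count w x" by simp
    qed
    then obtain c where c: "w = bracket i w0 + c" by (auto simp: mset_subset_eq_exists_conv)
    have uv: "u = bracket i a + c" "v = bracket i b + c"
    proof -
      have "?F + u = ?F + (bracket i a + c)"
        using w(1) c unfolding w0(1) bracket_add by (simp only: add.assoc)
      thus "u = bracket i a + c" by (simp only: add_left_cancel)
      have "?G + v = ?G + (bracket i b + c)"
        using w(2) c unfolding w0(2) bracket_add img by (simp only: add.assoc)
      thus "v = bracket i b + c" by (simp only: add_left_cancel)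
    qed
    have cD: "c \<in> monomials (Delta V)" using u uv by (simp add: monomials_add)
    \<comment> \<open>The Groebner hypothesis speaks only of common multiples of degree below the
      sum of the degrees; a shared letter makes \<open>w0\<close> that short.\<close>
    have "lead_mon s f \<inter># lead_mon s g \<noteq> {#}"
    proof
      assume "lead_mon s f \<inter># lead_mon s g = {#}"
      hence "min (count (lead_mon s f) x) (count (lead_mon s g) x) = 0" for x
        by (metis count_empty count_inter_mset)
      hence "?F \<inter># ?G = {#}"
        unfolding img(2)
        by (intro multiset_eqI) (auto simp: count_bracket split: prod.splits)
      with False show False by blast
    qed
    hence "size w0 < size (lead_mon s f) + size (lead_mon s g)"
    proof -
      assume ne: "lead_mon s f \<inter># lead_mon s g \<noteq> {#}"
      have "size (lead_mon s g) = size a + size (lead_mon s f \<inter># lead_mon s g)"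
      proof -
        have "lead_mon s g = a + lead_mon s f \<inter># lead_mon s g"
          by (rule multiset_eqI) (simp add: a_def)
        thus ?thesis by (metis size_union)
      qed
      moreover have "0 < size (lead_mon s f \<inter># lead_mon s g)" using ne by (simp only: nonempty_has_size)
      moreover have "size w0 = size (lead_mon s f) + size a" by (simp add: w0_def)
      ultimately show ?thesis by linarith
    qed
    then obtain N c' t q where
      t: "\<forall>j<(N::nat). t j \<in> S \<and> q j \<in> monomials V \<and> lead_mon s (t j) + q j \<sqsubset> w0"
      and eq: "f * mon_poly a - g * mon_poly b = (\<Sum>j<N. scal (c' j) (t j * mon_poly (q j)))"
      using G f g ab w0 unfolding groebner_basis_def by blast
    \<comment> \<open>The set is cut down to \<open>monomials (Delta V)\<close> because the order is
      shown compatible with the later factor \<open>c\<close> only there.\<close>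
    let ?W = "{m \<in> monomials (Delta V). (m, bracket i w0) \<in> deglex (Delta_less s)}"
    have "shift i f * mon_poly (bracket i a) - shift i g * mon_poly (bracket i b) =
      shift i (f * mon_poly a - g * mon_poly b)"
      by (simp only: mpol_hom_diff[OF shift_hom] mpol_hom_mult[OF shift_hom] shift_mon)
    also have "\<dots> = (\<Sum>j<N. single (bracket i (q j)) (c' j) * shift i (t j))"
      unfolding eq mpol_hom_sum[OF shift_hom] mpol_hom_scal[OF shift_hom] mpol_hom_mult[OF shift_hom] shift_mon
      by (simp only: scal_mult_mon_poly)
    also have "\<dots> \<in> D.reps ?S ?W"
    proof -
      have "(\<Sum>j<n. single (bracket i (q j)) (c' j) * shift i (t j)) \<in> D.reps ?S ?W"
        if "n \<le> N" for n
        using that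
      proof (induction n)
        case (Suc n)
        hence tn: "t n \<in> S" "q n \<in> monomials V" "lead_mon s (t n) + q n \<sqsubset> w0" using t by auto
        have "lead_mon (Delta_less s) (shift i (t n)) + bracket i (q n) \<in> ?W"
          unfolding lead[OF tn(1)] bracket_add[symmetric]
          using deglex_bracket[OF V _ w0V tn(3)] lS[OF tn(1)] tn(2)
          by (simp add: monomials_add bracket_monomials)
        hence "single (bracket i (q n)) (c' n) * shift i (t n) \<in> D.reps ?S ?W"
          using tn by (intro D.reps_term bracket_monomials) auto
        with Suc show ?case by (simp add: D.reps_add)
      qed (simp add: D.reps_zero)
      thus ?thesis by blast
    qed
    finally have "single c 1 *
        (shift i f * mon_poly (bracket i a) - shift i g * mon_poly (bracket i b)) \<in>
      D.reps ?S {m. (m, w) \<in> deglex (Delta_less s)}"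
    proof (rule D.reps_mult_single[OF _ cD])
      fix m assume "m \<in> ?W"
      thus "m + c \<in> {m. (m, w) \<in> deglex (Delta_less s)}"
        using D.mless_add_right[of m "bracket i w0" c] cD bracket_monomials[OF w0V] by (auto simp: c)
    qed
    moreover have "single c 1 *
        (shift i f * mon_poly (bracket i a) - shift i g * mon_poly (bracket i b)) =
      shift i f * mon_poly u - shift j g * mon_poly v"
      unfolding ij uv
      by (simp only: mon_poly_def[symmetric] mon_poly_add right_diff_distrib mult.assoc mult.commute
          mult.left_commute)
    ultimately show ?thesis by simp
  qed
qed

section \<open>The operators sigma, tau and theta\<close>

definition sigma :: "'k::field \<Rightarrow> ('x \<times> nat, 'k) mpol \<Rightarrow> ('x \<times> nat, 'k) mpol"
  where "sigma lam = mpol_subst (\<lambda>(x, n). mon_poly {#(x, n)#} + scal lam (mon_poly {#(x, Suc n)#}))"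

definition tau :: "('x \<times> nat, 'k::field) mpol \<Rightarrow> ('x \<times> nat, 'k) mpol"
  where "tau = mpol_subst (\<lambda>(x, n). mon_poly {#(x, Suc n)#})"

definition theta :: "'k::field \<Rightarrow> ('x \<times> nat, 'k) mpol \<Rightarrow> ('x \<times> nat, 'k) mpol"
  where "theta lam = mpol_subst (\<lambda>(x, n). (sigma lam ^^ n) (mon_poly {#(x, 0)#}))"

lemma sigma_hom: "sigma lam \<in> alg_hom (poly_alg UNIV) (poly_alg UNIV)"
  unfolding sigma_def by (rule mpol_subst_hom)

lemma tau_hom: "tau \<in> alg_hom (poly_alg UNIV) (poly_alg UNIV)"
  unfolding tau_def by (rule mpol_subst_hom)

lemma theta_hom: "theta lam \<in> alg_hom (poly_alg UNIV) (poly_alg UNIV)"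
  unfolding theta_def by (rule mpol_subst_hom)

lemma sigma_var: "sigma lam (mon_poly {#(x, n)#}) = mon_poly {#(x, n)#} + scal lam (mon_poly {#(x, Suc n)#})"
  by (simp only: sigma_def mpol_subst_var prod.case)

lemma tau_var: "tau (mon_poly {#(x, n)#}) = mon_poly {#(x, Suc n)#}"
  by (simp only: tau_def mpol_subst_var prod.case)

lemma theta_var: "theta lam (mon_poly {#(x, n)#}) = (sigma lam ^^ n) (mon_poly {#(x, 0)#})"
  by (simp only: theta_def mpol_subst_var prod.case)

text \<open>Both sides are homomorphisms, and on letters the equation is the definition of
  \<open>theta\<close>.\<close>

lemma theta_shift: "theta lam (shift n p) = (sigma lam ^^ n) (shift 0 p)"
  by (rule mpol_hom_eqI[OF alg_hom_comp[OF shift_hom theta_hom]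
        alg_hom_comp[OF shift_hom alg_hom_funpow[OF sigma_hom]]])
    (simp only: shift_var theta_var)

lemma theta_tau: "theta lam (tau p) = sigma lam (theta lam p)"
proof (rule mpol_hom_eqI[OF alg_hom_comp[OF tau_hom theta_hom] alg_hom_comp[OF theta_hom sigma_hom]])
  fix y :: "'a \<times> nat"
  obtain x n where y: "y = (x, n)" by fastforce
  show "theta lam (tau (mon_poly {#y#})) = sigma lam (theta lam (mon_poly {#y#}))"
    by (simp only: y tau_var theta_var funpow.simps comp_apply)
qed

lemma tau_shift: "tau (shift n p) = shift (Suc n) p"
  by (rule mpol_hom_eqI[OF alg_hom_comp[OF shift_hom tau_hom] shift_hom])
    (simp only: shift_var tau_var)

lemma letter_in_poly_alg: "x \<in> V \<Longrightarrow> mon_poly {#(x, n)#} \<in> carrier (poly_alg (Delta V))"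
  by (rule mon_poly_in_poly_alg) (simp add: monomials_def Delta_def)

lemma sigma_in_poly_alg:
  assumes "p \<in> carrier (poly_alg (Delta V))"
  shows "sigma lam p \<in> carrier (poly_alg (Delta V))"
  using sigma_hom _ assms
proof (rule mpol_hom_in_poly_alg)
  fix y assume "y \<in> Delta V"
  then obtain x n where y: "y = (x, n)" "x \<in> V" by (auto simp: Delta_def)
  show "sigma lam (mon_poly {#y#}) \<in> carrier (poly_alg (Delta V))"
    unfolding y(1) sigma_var by (intro add_in_poly_alg scal_in_poly_alg letter_in_poly_alg y(2))
qed

lemma sigma_pow_in_poly_alg:
  "p \<in> carrier (poly_alg (Delta V)) \<Longrightarrow> (sigma lam ^^ n) p \<in> carrier (poly_alg (Delta V))"
  by (induction n) (simp_all add: sigma_in_poly_alg)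

lemma tau_in_poly_alg:
  assumes "p \<in> carrier (poly_alg (Delta V))"
  shows "tau p \<in> carrier (poly_alg (Delta V))"
  using tau_hom _ assms
proof (rule mpol_hom_in_poly_alg)
  fix y assume "y \<in> Delta V"
  then obtain x n where y: "y = (x, n)" "x \<in> V" by (auto simp: Delta_def)
  show "tau (mon_poly {#y#}) \<in> carrier (poly_alg (Delta V))"
    unfolding y(1) tau_var by (rule letter_in_poly_alg[OF y(2)])
qed

lemma theta_in_poly_alg:
  assumes "p \<in> carrier (poly_alg (Delta V))"
  shows "theta lam p \<in> carrier (poly_alg (Delta V))"
  using theta_hom _ assms
proof (rule mpol_hom_in_poly_alg)
  fix y assume "y \<in> Delta V"
  then obtain x n where y: "y = (x, n)" "x \<in> V" by (auto simp: Delta_def)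
  show "theta lam (mon_poly {#y#}) \<in> carrier (poly_alg (Delta V))"
    unfolding y(1) theta_var by (intro sigma_pow_in_poly_alg letter_in_poly_alg y(2))
qed

lemma scal_scal: "scal c (scal d p) = scal (c * d) p"
  unfolding scal_eq mult.assoc[symmetric] mult_single by simp

lemma scal_one: "scal 1 p = p"
  unfolding scal_eq single_empty_one by simp

lemma scal_add: "scal c (p + q) = scal c p + scal c q"
  unfolding scal_eq by (rule distrib_left)

lemma scal_diff: "scal c (p - q) = scal c p - scal c q"
  unfolding scal_eq by (rule right_diff_distrib)

lemma scal_mult_left: "scal c p * q = scal c (p * q)"
  unfolding scal_eq by (rule mult.assoc)

lemma scal_mult_right: "p * scal c q = scal c (p * q)"
  unfolding scal_eq by (rule mult.left_commute)

lemma theta_surj: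
  assumes lam: "lam \<noteq> 0" and p: "p \<in> carrier (poly_alg (Delta V))"
  shows "\<exists>q\<in>carrier (poly_alg (Delta V)). theta lam q = p"
proof -
  let ?P = "carrier (poly_alg (Delta V))"
  have var: "\<exists>q\<in>?P. theta lam q = mon_poly {#(x, n)#}" if "x \<in> V" for x n
  proof (induction n)
    case 0
    show ?case
      by (rule bexI[OF _ letter_in_poly_alg[OF that, of 0]]) (simp add: theta_var)
  next
    case (Suc n)
    then obtain q where q: "q \<in> ?P" "theta lam q = mon_poly {#(x, n)#}" by blast
    \<comment> \<open>\<open>theta\<close> turns \<open>tau - 1\<close> into
      \<open>sigma - 1\<close>, which sends the letter at level \<open>n\<close> to
      \<open>lam\<close> times the letter at level \<open>n + 1\<close>; dividing by
      \<open>lam\<close> gives the preimage of the next letter.\<close>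
    have "theta lam (scal (1 / lam) (tau q - q)) =
      scal (1 / lam) (sigma lam (mon_poly {#(x, n)#}) - mon_poly {#(x, n)#})"
      by (simp only: mpol_hom_scal[OF theta_hom] mpol_hom_diff[OF theta_hom] theta_tau q(2))
    also have "\<dots> = scal (1 / lam * lam) (mon_poly {#(x, Suc n)#})"
      by (simp only: sigma_var add_diff_cancel_left' scal_scal)
    also have "1 / lam * lam = 1" using lam by simp
    finally have "theta lam (scal (1 / lam) (tau q - q)) = mon_poly {#(x, Suc n)#}" by (simp only: scal_one)
    moreover have "scal (1 / lam) (tau q - q) \<in> ?P"
      by (intro scal_in_poly_alg diff_in_poly_alg tau_in_poly_alg q(1))
    ultimately show ?case by blast
  qed
  have mon: "\<exists>q\<in>?P. theta lam q = mon_poly m" if "m \<in> monomials (Delta V)" for m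
    using that
  proof (induction m)
    case empty
    show ?case
      by (rule bexI[OF _ one_in_poly_alg]) (simp only: mon_poly_def single_empty_one mpol_hom_one[OF theta_hom])
  next
    case (add y m)
    obtain x n where y: "y = (x, n)" "x \<in> V" using add.prems by (auto simp: monomials_def Delta_def)
    have m: "m \<in> monomials (Delta V)" using add.prems by (auto simp: monomials_def)
    obtain q where q: "q \<in> ?P" "theta lam q = mon_poly {#(x, n)#}" using var[OF y(2)] by blast
    obtain q' where q': "q' \<in> ?P" "theta lam q' = mon_poly m" using add.IH[OF m] by blast
    have "theta lam (q * q') = mon_poly ({#y#} + m)"
      by (simp only: mpol_hom_mult[OF theta_hom] q(2) q'(2) y(1) mon_poly_add)
    moreover have "{#y#} + m = add_mset y m" by simp
    ultimately have "theta lam (q * q') = mon_poly (add_mset y m)" by (simp only:)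
    with mult_in_poly_alg[OF q(1) q'(1)] show ?case by blast
  qed
  from p show ?thesis
  proof (induction p rule: poly_alg_induct)
    case zero
    show ?case by (rule bexI[OF _ zero_in_poly_alg]) (simp only: mpol_hom_zero[OF theta_hom])
  next
    case (add u c p)
    obtain q where q: "q \<in> ?P" "theta lam q = mon_poly u" using mon[OF add.hyps(1)] by blast
    obtain q' where q': "q' \<in> ?P" "theta lam q' = p" using add.IH by blast
    have "theta lam (scal c q + q') = single u c + p"
      by (simp only: mpol_hom_add[OF theta_hom] mpol_hom_scal[OF theta_hom] q(2) q'(2) scal_mon_poly)
    moreover have "scal c q + q' \<in> ?P" by (intro add_in_poly_alg scal_in_poly_alg q q')
    ultimately show ?case by blast
  qed
qed

section \<open>The differential operator as a difference quotient of sigma\<close>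

definition sigma_diff :: "'k::field \<Rightarrow> ('x \<times> nat, 'k) mpol \<Rightarrow> ('x \<times> nat, 'k) mpol"
  where "sigma_diff lam p = scal (1 / lam) (sigma lam p - p)"

lemma sigma_eq: "lam \<noteq> 0 \<Longrightarrow> sigma lam p = p + scal lam (sigma_diff lam p)"
  by (simp add: sigma_diff_def scal_scal scal_one)

lemma sigma_diff_in_poly_alg:
  "p \<in> carrier (poly_alg (Delta V)) \<Longrightarrow> sigma_diff lam p \<in> carrier (poly_alg (Delta V))"
  unfolding sigma_diff_def by (intro scal_in_poly_alg diff_in_poly_alg sigma_in_poly_alg)

lemma sigma_diff_add: "sigma_diff lam (p + q) = sigma_diff lam p + sigma_diff lam q"
proof -
  have "sigma lam p + sigma lam q - (p + q) = (sigma lam p - p) + (sigma lam q - q)" by simp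
  thus ?thesis unfolding sigma_diff_def mpol_hom_add[OF sigma_hom] by (simp only: scal_add)
qed

lemma sigma_diff_scal: "sigma_diff lam (scal c p) = scal c (sigma_diff lam p)"
  unfolding sigma_diff_def mpol_hom_scal[OF sigma_hom] scal_diff[symmetric] scal_scal mult.commute[of c] ..

text \<open>With \<open>a = sigma p - p\<close> and \<open>b = sigma q - q\<close>, multiplicativity
  of \<open>sigma\<close> gives \<open>sigma (p q) - p q = a q + p b + a b\<close>. After division
  by \<open>lam\<close> the last summand is \<open>lam (a / lam) (b / lam)\<close>, the weight term
  of the Leibniz rule.\<close>

lemma sigma_diff_mult:
  assumes "lam \<noteq> 0"
  shows "sigma_diff lam (p * q) = sigma_diff lam p * q + p * sigma_diff lam q +
    scal lam (sigma_diff lam p * sigma_diff lam q)"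
proof -
  let ?s = "sigma lam"
  have "scal lam (sigma_diff lam p * sigma_diff lam q) = scal (1 / lam) ((?s p - p) * (?s q - q))"
    unfolding sigma_diff_def scal_mult_left scal_mult_right scal_scal using assms by simp
  moreover have "?s (p * q) - p * q = (?s p - p) * q + p * (?s q - q) + (?s p - p) * (?s q - q)"
    unfolding mpol_hom_mult[OF sigma_hom] by (simp add: algebra_simps)
  ultimately show ?thesis
    unfolding sigma_diff_def by (simp only: scal_mult_left scal_mult_right scal_add)
qed

lemma sigma_diff_comm_diff_algebra:
  fixes lam :: "'k::field"
  assumes "lam \<noteq> 0"
  shows "comm_diff_algebra (poly_alg (Delta V) :: ('k, ('x \<times> nat, 'k) mpol) module) lam (sigma_diff lam)"
proof -
  interpret algebra "ring_of_type_algebra :: 'k ring" "poly_alg (Delta V) :: ('k, ('x \<times> nat, 'k) mpol) module"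
    by (rule poly_alg_algebra)
  show ?thesis
  proof unfold_locales
    show "sigma_diff lam \<in> module_hom ring_of_type_algebra (poly_alg (Delta V)) (poly_alg (Delta V))"
      unfolding module_hom_def
      by (auto simp only: mem_Collect_eq poly_alg_sel sigma_diff_add sigma_diff_scal sigma_diff_in_poly_alg Pi_iff)
    show "sigma_diff lam \<one>\<^bsub>poly_alg (Delta V)\<^esub> = \<zero>\<^bsub>poly_alg (Delta V)\<^esub>"
      unfolding sigma_diff_def poly_alg_sel mpol_hom_one[OF sigma_hom] by (simp add: scal_eq)
  qed (simp only: poly_alg_sel sigma_diff_mult[OF assms])
qed

text \<open>Expanding \<open>(x + lam d x) (y + lam d y)\<close> yields \<open>x y\<close> plus
  \<open>lam\<close> times the weighted Leibniz rule. A derivation is thereby governed by a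
  homomorphism, which its values on letters determine.\<close>

lemma (in comm_diff_algebra) weight_endo: "(\<lambda>x. x \<oplus> lam \<odot> d x) \<in> alg_hom R R"
proof -
  \<comment> \<open>As a ring element, the scalar \<open>lam\<close> takes part in the rewriting
    with the ring laws.\<close>
  define L where "L = lam \<odot> \<one>"
  have sc: "c \<odot> x \<in> carrier R" if "x \<in> carrier R" for c x using smult_closed[of c x] that by simp
  have L: "L \<in> carrier R" unfolding L_def by (rule sc) (rule one_closed)
  have lam: "lam \<odot> x = L \<otimes> x" if "x \<in> carrier R" for x
    using smult_assoc2[OF _ one_closed that, of lam] that by (simp add: L_def)
  have dc: "d x \<in> carrier R" if "x \<in> carrier R" for x using module_hom_closed[OF d_linear] that by blast
  show ?thesis
  proof (rule alg_homI)
    fix x y assume xy: "x \<in> carrier R" "y \<in> carrier R"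
    note D = dc[OF xy(1)] dc[OF xy(2)]
    have "d (x \<otimes> y) = d x \<otimes> y \<oplus> x \<otimes> d y \<oplus> L \<otimes> (d x \<otimes> d y)"
      unfolding d_mult[OF xy] by (simp only: lam m_closed D)
    thus "x \<otimes> y \<oplus> lam \<odot> d (x \<otimes> y) = (x \<oplus> lam \<odot> d x) \<otimes> (y \<oplus> lam \<odot> d y)"
      using xy D L
      by (simp only: lam dc m_closed a_closed l_distr r_distr a_assoc a_comm a_lcomm
          m_assoc m_comm m_lcomm)
    have "d (x \<oplus> y) = d x \<oplus> d y" using module_hom_add[OF d_linear xy] .
    thus "x \<oplus> y \<oplus> lam \<odot> d (x \<oplus> y) = x \<oplus> lam \<odot> d x \<oplus> (y \<oplus> lam \<odot> d y)"
      using xy D L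
      by (simp only: lam dc m_closed a_closed r_distr a_assoc a_comm a_lcomm)
  next
    fix x assume "x \<in> carrier R"
    thus "x \<oplus> lam \<odot> d x \<in> carrier R" by (intro a_closed sc dc)
  next
    show "\<one> \<oplus> lam \<odot> d \<one> = \<one>" unfolding d_one using smult_r_null[of lam] by simp
  next
    fix c x assume x: "x \<in> carrier R"
    have 1: "d (c \<odot> x) = c \<odot> d x" using module_hom_smult[OF d_linear _ x, of c] by simp
    have "lam \<odot> (c \<odot> d x) = (lam * c) \<odot> d x"
      using smult_assoc1[OF _ _ dc[OF x], of lam c] by simp
    also have "\<dots> = c \<odot> (lam \<odot> d x)"
      using smult_assoc1[OF _ _ dc[OF x], of c lam] by (simp add: mult.commute)
    finally show "c \<odot> x \<oplus> lam \<odot> d (c \<odot> x) = c \<odot> (x \<oplus> lam \<odot> d x)"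
      unfolding 1 using smult_r_distr[OF _ x sc[OF dc[OF x]], of c lam] by simp
  qed
qed

text \<open>\<open>diff_op\<close> is singled out among extensional functions, so a candidate has to
  be cut down to the carrier.\<close>

lemma (in comm_diff_algebra) restrict_comm_diff_algebra:
  "comm_diff_algebra R lam (restrict d (carrier R))"
proof -
  have r: "restrict d (carrier R) x = d x" if "x \<in> carrier R" for x using that by simp
  have sc: "c \<odot> x \<in> carrier R" if "x \<in> carrier R" for c x using smult_closed[of c x] that by simp
  show ?thesis
  proof unfold_locales
    show "restrict d (carrier R) \<in> module_hom ring_of_type_algebra R R"
      unfolding module_hom_def
    proof (intro CollectI conjI allI impI Pi_I)
      fix x assume "x \<in> carrier R"
      thus "restrict d (carrier R) x \<in> carrier R" using module_hom_closed[OF d_linear] r by auto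
    next
      fix x y assume xy: "x \<in> carrier R \<and> y \<in> carrier R"
      thus "restrict d (carrier R) (x \<oplus> y) = restrict d (carrier R) x \<oplus> restrict d (carrier R) y"
        using module_hom_add[OF d_linear, of x y] by (simp only: r a_closed)
    next
      fix c x assume "c \<in> carrier (ring_of_type_algebra :: 'k ring) \<and> x \<in> carrier R"
      thus "restrict d (carrier R) (c \<odot> x) = c \<odot> restrict d (carrier R) x"
        using module_hom_smult[OF d_linear, of c x] by (simp only: r sc)
    qed
    show "restrict d (carrier R) \<one> = \<zero>" unfolding r[OF one_closed] by (rule d_one)
    fix x y assume xy: "x \<in> carrier R" "y \<in> carrier R"
    show "restrict d (carrier R) (x \<otimes> y) = restrict d (carrier R) x \<otimes> y \<oplus> x \<otimes> restrict d (carrier R) y \<oplus>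
      lam \<odot> (restrict d (carrier R) x \<otimes> restrict d (carrier R) y)"
      unfolding r[OF m_closed[OF xy]] r[OF xy(1)] r[OF xy(2)] by (rule d_mult[OF xy])
  qed
qed

lemma mpol_hom_restrict:
  assumes "h \<in> alg_hom (poly_alg UNIV) (poly_alg UNIV)"
    and "\<And>p. p \<in> carrier (poly_alg Y) \<Longrightarrow> h p \<in> carrier (poly_alg Z)"
  shows "h \<in> alg_hom (poly_alg Y) (poly_alg Z)"
  by (rule alg_homI) (simp_all only: poly_alg_sel assms(2) mpol_hom_add[OF assms(1)]
    mpol_hom_mult[OF assms(1)] mpol_hom_one[OF assms(1)] mpol_hom_scal[OF assms(1)])

text \<open>Evaluates the definite description. For uniqueness, any candidate \<open>d\<close> makes
  \<open>1 + lam d\<close> an endomorphism that agrees with \<open>sigma\<close> on letters, hence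
  everywhere, and \<open>lam\<close> can be cancelled.\<close>

lemma diff_op_eq:
  fixes lam :: "'k::field" and V :: "'x set"
  assumes lam: "lam \<noteq> 0"
  shows "diff_op lam V = restrict (sigma_diff lam) (carrier (poly_alg (Delta V)))"
  unfolding diff_op_def
proof (rule the_equality)
  let ?P = "poly_alg (Delta V) :: ('k, ('x \<times> nat, 'k) mpol) module"
  interpret S: comm_diff_algebra ?P lam "sigma_diff lam"
    by (rule sigma_diff_comm_diff_algebra[OF lam])
  let ?r = "restrict (sigma_diff lam) (carrier ?P)"
  have r: "?r p = sigma_diff lam p" if "p \<in> carrier ?P" for p using that by simp
  have "comm_diff_algebra ?P lam ?r" by (rule S.restrict_comm_diff_algebra)
  moreover have "?r (mon_poly {#(x, n)#}) = mon_poly {#(x, Suc n)#}" if "x \<in> V" for x n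
    unfolding r[OF letter_in_poly_alg[OF that]] sigma_diff_def sigma_var add_diff_cancel_left' scal_scal
    using lam by (simp add: scal_one)
  ultimately show "?r \<in> extensional (carrier ?P) \<and> comm_diff_algebra ?P lam ?r \<and>
    (\<forall>x\<in>V. \<forall>n. ?r (mon_poly {#(x, n)#}) = mon_poly {#(x, Suc n)#})" by simp
  fix d assume d: "d \<in> extensional (carrier ?P) \<and> comm_diff_algebra ?P lam d \<and>
    (\<forall>x\<in>V. \<forall>n. d (mon_poly {#(x, n)#}) = mon_poly {#(x, Suc n)#})"
  then interpret D: comm_diff_algebra ?P lam d by blast
  show "d = ?r"
  proof (rule extensionalityI[of _ "carrier ?P"])
    show "d \<in> extensional (carrier ?P)" using d by blast
    fix p assume p: "p \<in> carrier ?P"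
    have "p \<oplus>\<^bsub>?P\<^esub> lam \<odot>\<^bsub>?P\<^esub> d p = sigma lam p"
    proof (rule poly_alg_hom_eqI[OF poly_alg_algebra D.weight_endo _ _ p])
      show "sigma lam \<in> alg_hom ?P ?P" by (rule mpol_hom_restrict[OF sigma_hom sigma_in_poly_alg])
      fix y assume "y \<in> Delta V"
      then obtain x n where y: "y = (x, n)" "x \<in> V" by (auto simp: Delta_def)
      show "mon_poly {#y#} \<oplus>\<^bsub>?P\<^esub> lam \<odot>\<^bsub>?P\<^esub> d (mon_poly {#y#}) = sigma lam (mon_poly {#y#})"
        unfolding y(1) sigma_var poly_alg_sel using d y(2) by simp
    qed
    hence "p + scal lam (d p) = p + scal lam (sigma_diff lam p)"
      unfolding poly_alg_sel sigma_eq[OF lam, of p] .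
    hence "scal (1 / lam) (scal lam (d p)) = scal (1 / lam) (scal lam (sigma_diff lam p))" by simp
    hence "d p = sigma_diff lam p" unfolding scal_scal using lam by (simp add: scal_one)
    thus "d p = ?r p" using r[OF p] by simp
  qed simp
qed

lemma diff_op_comm_diff_algebra:
  "lam \<noteq> 0 \<Longrightarrow> comm_diff_algebra (poly_alg (Delta V)) lam (diff_op lam V)"
  unfolding diff_op_eq
  by (rule comm_diff_algebra.restrict_comm_diff_algebra[OF sigma_diff_comm_diff_algebra])

lemma diff_op_pow:
  assumes "lam \<noteq> 0" "p \<in> carrier (poly_alg (Delta V))"
  shows "(diff_op lam V ^^ i) p = (sigma_diff lam ^^ i) p"
    and "(sigma_diff lam ^^ i) p \<in> carrier (poly_alg (Delta V))"
  by (induction i) (simp_all add: diff_op_eq[OF assms(1)] assms(2) sigma_diff_in_poly_alg)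

section \<open>Leading monomials under theta\<close>

lemma keys_sum_subset: "keys (\<Sum>i\<in>F. f i) \<subseteq> (\<Union>i\<in>F. keys (f i))"
proof (induction F rule: infinite_finite_induct)
  case (insert i F)
  have "keys (f i + (\<Sum>i\<in>F. f i)) \<subseteq>
    keys (f i) \<union> keys (\<Sum>i\<in>F. f i)" by (rule keys_add)
  with insert show ?case by auto
qed simp_all

lemma keys_scal_subset: "keys (scal c p) \<subseteq> keys p"
proof
  fix k assume "k \<in> keys (scal c p)"
  hence "k \<in> {a + b |a b. a \<in> keys (single {#} c) \<and> b \<in> keys p}"
    unfolding scal_eq using keys_mult by blast
  thus "k \<in> keys p" by (auto split: if_splits)
qed

lemma mpol_hom_keys:
  assumes "h \<in> alg_hom (poly_alg UNIV) (poly_alg UNIV)"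
  shows "keys (h p) \<subseteq> (\<Union>m\<in>keys p. keys (h (mon_poly m)))"
  unfolding mpol_hom_expand[OF assms, of p] by (rule order.trans[OF keys_sum_subset]) (intro UN_mono order.refl keys_scal_subset)

context letter_order
begin

section \<open>Polynomials with a prescribed leading monomial\<close>

text \<open>The leading coefficient \<open>c\<close> is left open: \<open>theta\<close> multiplies
  it by powers of \<open>lam\<close>, so being monic would not be preserved.\<close>

definition triangular :: "'v multiset \<Rightarrow> ('v, 'k::field) mpol \<Rightarrow> bool"
  where "triangular u p \<longleftrightarrow> (\<exists>c q. c \<noteq> 0 \<and> p = single u c + q \<and>
    q \<in> carrier (poly_alg Y) \<and> (\<forall>k\<in>keys q. k \<sqsubset> u))"

lemma triangular_lead_mon: "triangular u p \<Longrightarrow> lead_mon s p = u \<and> p \<noteq> 0"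
proof -
  assume "triangular u p"
  then obtain c q where q: "c \<noteq> 0" "p = single u c + q"
    "\<And>k. k \<in> keys q \<Longrightarrow> k \<sqsubset> u" unfolding triangular_def by blast
  from lead_mon_single_add(1,3)[OF q(1,3)] show ?thesis unfolding q(2) by simp
qed

lemma triangular_keys: "triangular u p \<Longrightarrow> k \<in> keys p \<Longrightarrow> k = u \<or> k \<sqsubset> u"
proof -
  assume "triangular u p" and k: "k \<in> keys p"
  then obtain c q where q: "p = single u c + q"
    "\<forall>k\<in>keys q. k \<sqsubset> u" unfolding triangular_def by blast
  have "keys (single u c + q) \<subseteq> insert u (keys q)"
    using keys_add[of "single u c" q] by (auto split: if_splits)
  with q(2) k show "k = u \<or> k \<sqsubset> u" unfolding q(1) by blast
qed

lemma triangular_self: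
  assumes "p \<in> carrier (poly_alg Y)" "p \<noteq> 0"
  shows "triangular (lead_mon s p) p"
proof -
  let ?l = "lead_mon s p"
  define q where "q = p - single ?l (lookup p ?l)"
  have l: "?l \<in> keys p" by (rule lead_mon_in_keys(1)[OF assms])
  have "q \<in> carrier (poly_alg Y)"
    unfolding q_def by (intro diff_in_poly_alg single_in_poly_alg assms(1) lead_mon_in_monomials[OF assms])
  moreover have "k \<sqsubset> ?l" if "k \<in> keys q" for k
  proof -
    have "k \<noteq> ?l" "k \<in> keys p"
      using that by (auto simp: q_def in_keys_iff lookup_minus lookup_single when_def split: if_splits)
    thus ?thesis using lead_mon_in_keys(2)[OF assms] by blast
  qed
  moreover have "p = single ?l (lookup p ?l) + q" by (simp add: q_def)
  moreover have "lookup p ?l \<noteq> 0" using l in_keys_iff[of ?l p] by blast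
  ultimately show ?thesis unfolding triangular_def by blast
qed

lemma triangular_mult:
  assumes "triangular u p" "triangular v q" "u \<in> monomials Y" "v \<in> monomials Y"
  shows "triangular (u + v) (p * q)"
proof -
  obtain c p' where p: "c \<noteq> 0" "p = single u c + p'" "p' \<in> carrier (poly_alg Y)"
    "\<And>k. k \<in> keys p' \<Longrightarrow> k \<sqsubset> u" using assms(1) unfolding triangular_def by blast
  obtain d q' where q: "d \<noteq> 0" "q = single v d + q'" "q' \<in> carrier (poly_alg Y)"
    "\<And>k. k \<in> keys q' \<Longrightarrow> k \<sqsubset> v" using assms(2) unfolding triangular_def by blast
  have qc: "q \<in> carrier (poly_alg Y)"
    unfolding q(2) by (intro add_in_poly_alg single_in_poly_alg assms(4) q(3))
  let ?r = "single u c * q' + p' * q"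
  have "p * q = single (u + v) (c * d) + ?r"
  proof -
    have "p * q = single u c * q + p' * q" unfolding p(2) by (rule distrib_right)
    also have "single u c * q = single (u + v) (c * d) + single u c * q'"
      unfolding q(2) by (simp only: distrib_left mult_single)
    finally show ?thesis by (simp only: add.assoc)
  qed
  moreover have "?r \<in> carrier (poly_alg Y)"
    by (intro add_in_poly_alg mult_in_poly_alg single_in_poly_alg assms(3) p(3) q(3) qc)
  moreover have "k \<sqsubset> u + v" if k: "k \<in> keys ?r" for k
  proof -
    have less: "a + b \<sqsubset> u + v" if "a \<sqsubset> u" "a \<in> monomials Y" "b \<in> monomials Y" "b = v \<or> b \<sqsubset> v" for a b
    proof -
      have 1: "a + b \<sqsubset> u + b" by (rule mless_add_right[OF that(1,2) assms(3) that(3)])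
      from that(4) show ?thesis
      proof
        assume "b \<sqsubset> v"
        from mless_add_right[OF this that(3) assms(4,3)] have "u + b \<sqsubset> u + v" by (simp only: add.commute)
        with 1 show ?thesis by (rule mless_trans)
      qed (use 1 in simp)
    qed
    from k consider "k \<in> keys (single u c * q')" | "k \<in> keys (p' * q)"
      using subsetD[OF keys_add k] by blast
    thus ?thesis
    proof cases
      case 1
      then obtain b where b: "b \<in> keys q'" "k = u + b"
        using keys_mult[of "single u c" q'] by (auto split: if_splits)
      have "b \<in> monomials Y" using b(1) q(3) by (auto simp: carrier_poly_alg)
      from mless_add_right[OF q(4)[OF b(1)] this assms(4,3)] show ?thesis
        unfolding b(2) by (simp only: add.commute)
    next
      case 2
      then obtain a b where ab: "a \<in> keys p'" "b \<in> keys q" "k = a + b"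
        using keys_mult[of p' q] by blast
      have "a \<in> monomials Y" "b \<in> monomials Y" using ab p(3) qc by (auto simp: carrier_poly_alg)
      thus ?thesis unfolding ab(3)
        using less[OF p(4)[OF ab(1)]] triangular_keys[OF assms(2) ab(2)] by blast
    qed
  qed
  ultimately show ?thesis unfolding triangular_def using p(1) q(1) by (meson mult_eq_0_iff)
qed

end

context
  fixes V :: "'x set" and s :: "'x rel"
  assumes V: "letter_order V s"
begin

interpretation V: letter_order V s by (rule V)
interpretation D: letter_order "Delta V" "Delta_less s" by (rule Delta_less_letter_order[OF V])

text \<open>The binomial expansion of \<open>(1 + lam d)^n\<close> at a letter, of which only the
  top coefficient \<open>lam ^ n\<close> is recorded exactly.\<close>

lemma sigma_pow_letter:
  "\<exists>q. (sigma lam ^^ n) (mon_poly {#(x, 0)#}) = single {#(x, n)#} (lam ^ n) + q \<and>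
    keys q \<subseteq> {{#(x, k)#} |k. k < n}"
proof (induction n)
  case 0
  show ?case by (intro exI[of _ 0]) (simp add: mon_poly_def)
next
  case (Suc n)
  then obtain q where q: "(sigma lam ^^ n) (mon_poly {#(x, 0)#}) = single {#(x, n)#} (lam ^ n) + q"
    "keys q \<subseteq> {{#(x, k)#} |k. k < n}" by blast
  let ?q = "single {#(x, n)#} (lam ^ n) + sigma lam q"
  have "(sigma lam ^^ Suc n) (mon_poly {#(x, 0)#}) =
      sigma lam (scal (lam ^ n) (mon_poly {#(x, n)#})) + sigma lam q"
    by (simp only: funpow.simps comp_apply q(1) mpol_hom_add[OF sigma_hom] scal_mon_poly)
  also have "\<dots> = single {#(x, Suc n)#} (lam ^ Suc n) + ?q"
    unfolding mpol_hom_scal[OF sigma_hom] sigma_var scal_add scal_scal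
    unfolding scal_mon_poly by (simp add: mult.commute add.assoc add.left_commute)
  finally have 1: "(sigma lam ^^ Suc n) (mon_poly {#(x, 0)#}) =
    single {#(x, Suc n)#} (lam ^ Suc n) + ?q" .
  have "keys (sigma lam (mon_poly {#(x, k)#})) \<subseteq> {{#(x, k)#}, {#(x, Suc k)#}}" for k
    unfolding sigma_var scal_mon_poly unfolding mon_poly_def
    by (rule order.trans[OF keys_add]) (simp split: if_splits)
  hence "keys (sigma lam q) \<subseteq> {{#(x, k)#} |k. k < Suc n}"
    using mpol_hom_keys[OF sigma_hom, of lam q] q(2) by fastforce
  moreover have "keys ?q \<subseteq> {{#(x, n)#}} \<union> keys (sigma lam q)"
    using keys_add[of "single {#(x, n)#} (lam ^ n)" "sigma lam q"] by (auto split: if_splits)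
  ultimately have "keys ?q \<subseteq> {{#(x, k)#} |k. k < Suc n}" by fastforce
  with 1 show ?case by blast
qed

text \<open>Being triangular is compatible with products, so it is enough to treat letters; there
  the nonzero weight enters as \<open>lam ^ n \<noteq> 0\<close>.\<close>

lemma triangular_theta:
  fixes lam :: "'b::field"
  assumes lam: "lam \<noteq> 0" and u: "u \<in> monomials (Delta V)"
  shows "D.triangular u (theta lam (mon_poly u))"
  using u
proof (induction u)
  case empty
  have "theta lam (mon_poly {#}) = single {#} 1 + 0"
    by (simp only: mon_poly_def single_empty_one mpol_hom_one[OF theta_hom] add_0_right)
  thus ?case
    unfolding D.triangular_def
    by (intro exI[where x = "1 :: 'b"] exI[where x = "0 :: ('x \<times> nat, 'b) mpol"]) (simp add: zero_in_poly_alg)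
next
  case (add y u)
  obtain x n where y: "y = (x, n)" "x \<in> V" using add.prems by (auto simp: monomials_def Delta_def)
  have u: "u \<in> monomials (Delta V)" "{#y#} \<in> monomials (Delta V)"
    using add.prems by (auto simp: monomials_def)
  have "D.triangular {#y#} (theta lam (mon_poly {#y#}))"
  proof -
    obtain q where q0: "(sigma lam ^^ n) (mon_poly {#(x, 0)#}) = single {#(x, n)#} (lam ^ n) + q"
      "keys q \<subseteq> {{#(x, k)#} |k. k < n}"
      using sigma_pow_letter[where lam = lam and n = n and x = x] by (elim exE conjE) rule
    have "theta lam (mon_poly {#y#}) = single {#(x, n)#} (lam ^ n) + q"
      unfolding y(1) theta_var by (rule q0(1))
    note q = this q0(2)
    have "q \<in> carrier (poly_alg (Delta V))"
      using q(2) y(2) by (auto simp: carrier_poly_alg monomials_def Delta_def)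
    moreover have "(k, {#(x, n)#}) \<in> deglex (Delta_less s)" if k: "k \<in> keys q" for k
    proof -
      obtain m where m: "k = {#(x, m)#}" "m < n" using subsetD[OF q(2) k] by (elim CollectE exE conjE) rule
      have "{#x#} \<in> monomials V" using y(2) by (simp add: monomials_def)
      from deglex_bracket_level[OF V this this _ _ m(2)] show ?thesis
        unfolding m(1) bracket_def by simp
    qed
    moreover have "lam ^ n \<noteq> 0" using lam by simp
    ultimately show ?thesis unfolding D.triangular_def q(1) unfolding y(1) by blast
  qed
  from D.triangular_mult[OF this add.IH[OF u(1)] u(2,1)]
  have "D.triangular ({#y#} + u) (theta lam (mon_poly ({#y#} + u)))"
    by (simp only: mon_poly_add mpol_hom_mult[OF theta_hom])
  thus ?case by simp
qed

text \<open>The image of a smaller monomial of \<open>p\<close> consists of that monomial and still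
  smaller ones, so nothing cancels the image of the leading term. In particular \<open>theta\<close>
  maps no nonzero polynomial over \<open>Delta V\<close> to 0.\<close>

lemma theta_lead_mon:
  assumes lam: "lam \<noteq> 0" and p: "p \<in> carrier (poly_alg (Delta V))" "p \<noteq> 0"
  shows "D.triangular (lead_mon (Delta_less s) p) (theta lam p)"
proof -
  let ?l = "lead_mon (Delta_less s) p"
  obtain c q where q: "c \<noteq> 0" "p = single ?l c + q" "q \<in> carrier (poly_alg (Delta V))"
    "\<And>k. k \<in> keys q \<Longrightarrow> (k, ?l) \<in> deglex (Delta_less s)"
    using D.triangular_self[OF p] unfolding D.triangular_def by blast
  have l: "?l \<in> monomials (Delta V)" by (rule D.lead_mon_in_monomials[OF p])
  obtain d r where r: "d \<noteq> 0" "theta lam (mon_poly ?l) = single ?l d + r"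
    "r \<in> carrier (poly_alg (Delta V))" "\<And>k. k \<in> keys r \<Longrightarrow> (k, ?l) \<in> deglex (Delta_less s)"
    using triangular_theta[OF lam l] unfolding D.triangular_def by blast
  let ?q = "scal c r + theta lam q"
  have "theta lam p = theta lam (single ?l c + q)" using q(2) by simp
  also have "\<dots> = scal c (scal d (mon_poly ?l)) + ?q"
    by (simp only: mpol_hom_add[OF theta_hom] mpol_hom_single[OF theta_hom] r(2) scal_add
        scal_mon_poly add.assoc)
  also have "scal c (scal d (mon_poly ?l)) = single ?l (c * d)"
    unfolding scal_scal by (rule scal_mon_poly)
  finally have "theta lam p = single ?l (c * d) + ?q" .
  moreover have "?q \<in> carrier (poly_alg (Delta V))"
    by (intro add_in_poly_alg scal_in_poly_alg theta_in_poly_alg q(3) r(3))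
  moreover have "(k, ?l) \<in> deglex (Delta_less s)" if "k \<in> keys ?q" for k
  proof -
    from that consider "k \<in> keys r" | "k \<in> keys (theta lam q)"
      using keys_add[of "scal c r" "theta lam q"] keys_scal_subset[of c r] by blast
    thus ?thesis
    proof cases
      case 2
      from subsetD[OF mpol_hom_keys[OF theta_hom] this]
      obtain m where m: "m \<in> keys q" "k \<in> keys (theta lam (mon_poly m))" by blast
      have "m \<in> monomials (Delta V)" using m(1) q(3) by (auto simp: carrier_poly_alg)
      from D.triangular_keys[OF triangular_theta[OF lam this] m(2)] q(4)[OF m(1)] D.mless_trans
      show ?thesis by blast
    qed (rule r(4))
  qed
  moreover have "c * d \<noteq> 0" using q(1) r(1) by simp
  ultimately show ?thesis unfolding D.triangular_def by blast
qed

end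

section \<open>Iterated derivatives of a level 0 copy\<close>

text \<open>The linear span of the copies of \<open>p\<close> at levels below \<open>n\<close>; it
  absorbs the lower terms in the expansion of a power of \<open>(tau - 1) / lam\<close>.\<close>

inductive_set lower_shifts :: "('x, 'k::field) mpol \<Rightarrow> nat \<Rightarrow> ('x \<times> nat, 'k) mpol set" for p n where
  lower_zero: "0 \<in> lower_shifts p n"
| lower_step: "k < n \<Longrightarrow> r \<in> lower_shifts p n \<Longrightarrow> scal c (shift k p) + r \<in> lower_shifts p n"

lemma lower_shifts_add: "q \<in> lower_shifts p n \<Longrightarrow> r \<in> lower_shifts p n \<Longrightarrow> q + r \<in> lower_shifts p n"
  by (induction rule: lower_shifts.induct) (simp_all add: add.assoc lower_step)

lemma lower_shifts_scal: "r \<in> lower_shifts p n \<Longrightarrow> scal c r \<in> lower_shifts p n"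
proof (induction rule: lower_shifts.induct)
  case lower_zero
  show ?case by (simp add: scal_eq lower_shifts.lower_zero)
qed (simp only: scal_add scal_scal lower_shifts.lower_step)

lemma lower_shifts_Suc: "r \<in> lower_shifts p n \<Longrightarrow> r \<in> lower_shifts p (Suc n)"
  by (induction rule: lower_shifts.induct) (simp_all add: lower_shifts.intros)

lemma tau_lower_shifts: "r \<in> lower_shifts p n \<Longrightarrow> tau r \<in> lower_shifts p (Suc n)"
proof (induction rule: lower_shifts.induct)
  case lower_zero
  show ?case by (simp only: mpol_hom_zero[OF tau_hom] lower_shifts.lower_zero)
next
  case (lower_step k r c)
  thus ?case
    by (simp only: mpol_hom_add[OF tau_hom] mpol_hom_scal[OF tau_hom] tau_shift Suc_less_eq
        lower_shifts.lower_step)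
qed

text \<open>Transported by \<open>theta\<close>, \<open>sigma_diff\<close> becomes the difference operator \<open>(tau - 1) / lam\<close>.\<close>

lemma sigma_diff_pow_shift:
  fixes p :: "('x, 'k::field) mpol"
  assumes lam: "lam \<noteq> 0"
  shows "\<exists>c r. c \<noteq> 0 \<and> r \<in> lower_shifts p i \<and>
    (sigma_diff lam ^^ i) (shift 0 p) = theta lam (scal c (shift i p + r))"
proof (induction i)
  case 0
  have "(sigma_diff lam ^^ 0) (shift 0 p) = theta lam (scal 1 (shift 0 p + 0))"
    by (simp only: funpow.simps id_apply scal_one add_0_right theta_shift)
  thus ?case using lower_zero by (metis one_neq_zero)
next
  case (Suc i)
  then obtain c r where c: "c \<noteq> 0" "r \<in> lower_shifts p i"
    "(sigma_diff lam ^^ i) (shift 0 p) = theta lam (scal c (shift i p + r))" by blast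
  let ?q = "scal c (shift i p + r)"
  \<comment> \<open>\<open>tau r\<close> reaches level \<open>i\<close> at most, and subtracting the
    old polynomial adds its copy at level \<open>i\<close> and lower ones. The factor
    \<open>scal 1\<close> matches the form of \<open>lower_step\<close>.\<close>
  let ?r = "tau r + scal (- 1) (scal 1 (shift i p) + r)"
  have "(sigma_diff lam ^^ Suc i) (shift 0 p) = sigma_diff lam (theta lam ?q)"
    by (simp only: funpow.simps comp_apply c(3))
  also have "\<dots> = theta lam (scal (1 / lam) (tau ?q - ?q))"
    by (simp only: sigma_diff_def mpol_hom_scal[OF theta_hom] mpol_hom_diff[OF theta_hom] theta_tau)
  also have "scal (1 / lam) (tau ?q - ?q) = scal (1 / lam * c) (shift (Suc i) p + ?r)"
  proof -
    have "scal (- 1) x = - x" for x :: "('x \<times> nat, 'k) mpol"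
      unfolding scal_eq by (simp add: uminus_eq_single)
    hence "shift (Suc i) p + ?r = tau (shift i p + r) - (shift i p + r)"
      by (simp add: mpol_hom_add[OF tau_hom] tau_shift scal_one)
    thus ?thesis by (simp only: mpol_hom_scal[OF tau_hom] scal_scal[symmetric] scal_diff)
  qed
  finally have "(sigma_diff lam ^^ Suc i) (shift 0 p) = theta lam (scal (1 / lam * c) (shift (Suc i) p + ?r))" .
  moreover have "?r \<in> lower_shifts p (Suc i)"
    by (intro lower_shifts_add tau_lower_shifts lower_shifts_scal lower_shifts.lower_step c(2)
        lower_shifts_Suc lessI)
  moreover have "1 / lam * c \<noteq> 0" using lam c(1) by simp
  ultimately show ?case by blast
qed

text \<open>Copies of \<open>p\<close> at lower levels have words of no larger degree, so they lie
  below the leading monomial of the copy at level \<open>i\<close>, and \<open>theta\<close>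
  preserves that monomial. The assumption \<open>nc\<close> matters: for \<open>p = 1\<close> the
  copies at all levels coincide and cancel.\<close>

lemma sigma_diff_pow_lead_mon:
  assumes V: "letter_order V s" and lam: "lam \<noteq> 0"
    and p: "p \<in> carrier (poly_alg V)" "monic s p" and nc: "lead_mon s p \<noteq> {#}"
  shows "lead_mon (Delta_less s) ((sigma_diff lam ^^ i) (shift 0 p)) = bracket i (lead_mon s p)"
    and "(sigma_diff lam ^^ i) (shift 0 p) \<noteq> 0"
proof -
  interpret V: letter_order V s by (rule V)
  interpret D: letter_order "Delta V" "Delta_less s" by (rule Delta_less_letter_order[OF V])
  let ?l = "lead_mon s p" and ?less = "deglex (Delta_less s)"
  have l: "?l \<in> monomials V" using p V.lead_mon_in_monomials by (auto simp: monic_def)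
  have low: "r \<in> carrier (poly_alg (Delta V)) \<and> (\<forall>k\<in>keys r. (k, bracket i ?l) \<in> ?less)"
    if "r \<in> lower_shifts p i" for r
    using that
  proof (induction rule: lower_shifts.induct)
    case lower_zero
    show ?case using zero_in_poly_alg by simp
  next
    case (lower_step j r c)
    have 1: "scal c (shift j p) + r \<in> carrier (poly_alg (Delta V))"
      using lower_step.IH by (intro add_in_poly_alg scal_in_poly_alg shift_in_poly_alg p(1)) blast
    have "(k, bracket i ?l) \<in> ?less" if k: "k \<in> keys (shift j p)" for k
    proof -
      obtain m where m: "k = bracket j m" "m \<in> keys p" using subsetD[OF shift_keys k] by blast
      have mV: "m \<in> monomials V" using m(2) p(1) by (auto simp: carrier_poly_alg)
      have "size m \<le> size ?l"
      proof (cases "m = ?l")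
        case False
        have "p \<noteq> 0" using p(2) by (simp add: monic_def)
        from V.lead_mon_in_keys(2)[OF p(1) this m(2) False]
        have "count_less s m ?l" by (rule deglex_imp_count_less[OF V.trans V.irrefl])
        thus ?thesis by (auto simp: count_less_def)
      qed simp
      thus ?thesis unfolding m(1) using deglex_bracket_level[OF V mV l _ nc lower_step.hyps(1)] by blast
    qed
    with lower_step.IH 1 keys_add[of "scal c (shift j p)" r] keys_scal_subset[of c "shift j p"]
    show ?case by blast
  qed
  obtain c r where c: "c \<noteq> 0" "r \<in> lower_shifts p i"
    "(sigma_diff lam ^^ i) (shift 0 p) = theta lam (scal c (shift i p + r))"
    using sigma_diff_pow_shift[OF lam] by blast
  obtain q where q: "shift i p = mon_poly (bracket i ?l) + q" "q \<in> carrier (poly_alg (Delta V))"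
    "\<And>m. m \<in> keys q \<Longrightarrow> (m, bracket i ?l) \<in> ?less"
    using shift_split[OF V p] by blast
  have eq: "scal c (shift i p + r) = single (bracket i ?l) c + scal c (q + r)"
    unfolding q(1) by (simp only: scal_add scal_mon_poly add.assoc)
  have "(k, bracket i ?l) \<in> ?less" if "k \<in> keys (scal c (q + r))" for k
    using that keys_scal_subset[of c "q + r"] keys_add[of q r] q(3) low[OF c(2)] by blast
  note less = this
  have L: "lead_mon (Delta_less s) (scal c (shift i p + r)) = bracket i ?l" "scal c (shift i p + r) \<noteq> 0"
    unfolding eq by (rule D.lead_mon_single_add(1)[OF c(1)], erule less)
      (rule D.lead_mon_single_add(3)[OF c(1)], erule less)
  have "scal c (shift i p + r) \<in> carrier (poly_alg (Delta V))"
    using low[OF c(2)] by (intro scal_in_poly_alg add_in_poly_alg shift_in_poly_alg p(1)) blast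
  from D.triangular_lead_mon[OF theta_lead_mon[OF V lam this L(2)]]
  show "lead_mon (Delta_less s) ((sigma_diff lam ^^ i) (shift 0 p)) = bracket i ?l"
    "(sigma_diff lam ^^ i) (shift 0 p) \<noteq> 0"
    unfolding c(3) L(1) by blast+
qed

text \<open>No word lies below the empty one, so there is no room for a tail.\<close>

lemma (in letter_order) monic_constant:
  assumes "p \<in> carrier (poly_alg Y)" "monic s p" "lead_mon s p = {#}"
  shows "p = 1"
proof -
  obtain q where q: "p = mon_poly {#} + q" "\<And>m'. m' \<in> keys q \<Longrightarrow> m' \<sqsubset> {#}"
    using monic_split[OF assms(1,2)] unfolding assms(3) by blast
  have "\<not> m' \<sqsubset> {#}" for m'
  proof
    assume "m' \<sqsubset> {#}"
    hence "count_less s m' {#}" by (rule deglex_imp_count_less[OF trans irrefl])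
    thus False by (simp add: count_less_def)
  qed
  with q(2) have "keys q = {}" by blast
  with q(1) show ?thesis by (simp add: mon_poly_def single_empty_one)
qed

lemma sigma_diff_pow_one: "(sigma_diff lam ^^ Suc i) 1 = 0"
proof (induction i)
  case 0
  show ?case by (simp add: sigma_diff_def mpol_hom_one[OF sigma_hom] scal_eq)
next
  case (Suc i)
  have "sigma_diff lam 0 = 0" by (simp add: sigma_diff_def mpol_hom_zero[OF sigma_hom] scal_eq)
  with Suc show ?case by (simp only: funpow.simps(2)[of "Suc i"] comp_apply)
qed

text \<open>Both sides remove the same multiples. Only \<open>f = 1\<close> needs separate care: its
  proper derivatives vanish and have no leading monomial, but \<open>bracket n {#}\<close> is empty
  for every \<open>n\<close>, so \<open>i = 0\<close> alone accounts for all levels.\<close>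

theorem DIrr_hat_i:
  fixes lam :: "'k::field"
  assumes V: "letter_order V s" and lam: "lam \<noteq> 0"
    and S: "S \<subseteq> carrier (poly_alg V)" "\<forall>f\<in>S. monic s f"
  shows "DIrr lam s V (hat_i ` S) = {u \<in> monomials (Delta V).
    \<forall>t \<in> lead_mon s ` S. \<forall>n. \<not> mon_dvd (Delta V) (bracket n t) u}"
proof -
  interpret V: letter_order V s by (rule V)
  have pow: "(diff_op lam V ^^ i) (hat_i f) = (sigma_diff lam ^^ i) (shift 0 f)" if "f \<in> S" for f i
    unfolding hat_i_eq_shift using S(1) that by (intro diff_op_pow(1)[OF lam] shift_in_poly_alg) blast
  have 1: "\<exists>n. lead_mon (Delta_less s) ((diff_op lam V ^^ i) (hat_i f)) = bracket n (lead_mon s f)"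
    if f: "f \<in> S" and nz: "(diff_op lam V ^^ i) (hat_i f) \<noteq> 0" for f i
  proof (cases "lead_mon s f = {#}")
    case True
    have f1: "f = 1" using S f True by (intro V.monic_constant) auto
    have sh: "shift 0 f = 1" unfolding f1 by (rule mpol_hom_one[OF shift_hom])
    have "i = 0"
    proof (rule ccontr)
      assume "i \<noteq> 0"
      then obtain j where "i = Suc j" by (cases i) auto
      with nz show False unfolding pow[OF f] sh using sigma_diff_pow_one by metis
    qed
    moreover have "lead_mon (Delta_less s) (shift 0 f) = bracket 0 (lead_mon s f)"
      using S f by (intro shift_lead_mon(1)[OF V]) auto
    ultimately show ?thesis unfolding pow[OF f] by auto
  next
    case False
    thus ?thesis unfolding pow[OF f] using sigma_diff_pow_lead_mon(1)[OF V lam _ _ False] S f by blast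
  qed
  have 2: "\<exists>i. (diff_op lam V ^^ i) (hat_i f) \<noteq> 0 \<and>
      lead_mon (Delta_less s) ((diff_op lam V ^^ i) (hat_i f)) = bracket n (lead_mon s f)"
    if f: "f \<in> S" for f n
  proof (cases "lead_mon s f = {#}")
    case True
    have "lead_mon (Delta_less s) (shift 0 f) = bracket 0 (lead_mon s f)" "monic (Delta_less s) (shift 0 f)"
      using S f by (intro shift_lead_mon[OF V]; auto)+
    thus ?thesis unfolding pow[OF f] using True by (intro exI[of _ 0]) (simp add: monic_def bracket_def)
  next
    case False
    thus ?thesis unfolding pow[OF f] using sigma_diff_pow_lead_mon[OF V lam _ _ False] S f by blast
  qed
  have "{lead_mon (Delta_less s) ((diff_op lam V ^^ i) f) + u |f u i.
       f \<in> hat_i ` S \<and> u \<in> monomials (Delta V) \<and> (diff_op lam V ^^ i) f \<noteq> 0} =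
    {bracket n t + u |n t u. t \<in> lead_mon s ` S \<and> u \<in> monomials (Delta V)}" (is "?A = ?B")
  proof
    show "?A \<subseteq> ?B"
    proof
      fix m assume "m \<in> ?A"
      then obtain f u i where m: "f \<in> S" "u \<in> monomials (Delta V)"
        "(diff_op lam V ^^ i) (hat_i f) \<noteq> 0"
        "m = lead_mon (Delta_less s) ((diff_op lam V ^^ i) (hat_i f)) + u" by blast
      from 1[OF m(1,3)] obtain n where
        n: "lead_mon (Delta_less s) ((diff_op lam V ^^ i) (hat_i f)) = bracket n (lead_mon s f)" by blast
      show "m \<in> ?B" unfolding m(4) n using m(1,2) by blast
    qed
    show "?B \<subseteq> ?A"
    proof
      fix m assume "m \<in> ?B"
      then obtain n f u where m: "f \<in> S" "u \<in> monomials (Delta V)" "m = bracket n (lead_mon s f) + u" by blast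
      obtain i where i: "(diff_op lam V ^^ i) (hat_i f) \<noteq> 0"
        "lead_mon (Delta_less s) ((diff_op lam V ^^ i) (hat_i f)) = bracket n (lead_mon s f)"
        using 2[OF m(1)] by blast
      show "m \<in> ?A" unfolding m(3) i(2)[symmetric] using m(1,2) i(1) by blast
    qed
  qed
  thus ?thesis unfolding DIrr_def mon_dvd_def by blast
qed

section \<open>The differential ideal and its normal forms\<close>

lemma poly_alg_a_minus:
  assumes "p \<in> carrier (poly_alg Y)" "q \<in> carrier (poly_alg Y)"
  shows "\<ominus>\<^bsub>poly_alg Y\<^esub> q = - q" "p \<ominus>\<^bsub>poly_alg Y\<^esub> q = p - q"
proof -
  interpret algebra "ring_of_type_algebra :: 'b ring" "poly_alg Y :: ('b, ('a, 'b) mpol) module"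
    by (rule poly_alg_algebra)
  show 1: "\<ominus>\<^bsub>poly_alg Y\<^esub> q = - q"
    using assms uminus_in_poly_alg by (intro minus_equality) simp_all
  show "p \<ominus>\<^bsub>poly_alg Y\<^esub> q = p - q" unfolding a_minus_def 1 by simp
qed

lemma poly_alg_idealI:
  fixes J :: "('v, 'k::field) mpol set"
  assumes "J \<subseteq> carrier (poly_alg Y)" "0 \<in> J" "\<And>p q. p \<in> J \<Longrightarrow> q \<in> J \<Longrightarrow> p + q \<in> J"
    and mult: "\<And>p q. p \<in> carrier (poly_alg Y) \<Longrightarrow> q \<in> J \<Longrightarrow> p * q \<in> J"
  shows "ideal J (poly_alg Y)"
proof -
  interpret algebra "ring_of_type_algebra :: 'k ring" "poly_alg Y :: ('k, ('v, 'k) mpol) module"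
    by (rule poly_alg_algebra)
  show ?thesis
  proof (rule idealI)
    show "ring (poly_alg Y :: ('k, ('v, 'k) mpol) module)" by (rule ring_axioms)
    show "subgroup J (add_monoid (poly_alg Y))"
    proof (rule add.subgroupI)
      fix p assume p: "p \<in> J"
      hence "p \<in> carrier (poly_alg Y)" using assms(1) by blast
      from poly_alg_a_minus(1)[OF this this] have "\<ominus>\<^bsub>poly_alg Y\<^esub> p = single {#} (- 1) * p"
        by (simp only: uminus_eq_single)
      thus "\<ominus>\<^bsub>poly_alg Y\<^esub> p \<in> J"
        using mult[OF single_in_poly_alg[OF monomials_empty(1)] p] by (simp only:)
    qed (use assms in auto)
    fix p q :: "('v, 'k) mpol" assume "p \<in> J" "q \<in> carrier (poly_alg Y)"
    thus "q \<otimes>\<^bsub>poly_alg Y\<^esub> p \<in> J" "p \<otimes>\<^bsub>poly_alg Y\<^esub> q \<in> J"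
      using mult[of q p] by (simp_all only: poly_alg_sel mult.commute)
  qed
qed

lemma poly_alg_idealD:
  fixes J :: "('v, 'k::field) mpol set"
  assumes "ideal J (poly_alg Y)"
  shows "J \<subseteq> carrier (poly_alg Y)" "0 \<in> J" "p \<in> J \<Longrightarrow> q \<in> J \<Longrightarrow> p + q \<in> J"
    and "p \<in> carrier (poly_alg Y) \<Longrightarrow> q \<in> J \<Longrightarrow> p * q \<in> J"
    and "q \<in> J \<Longrightarrow> scal c q \<in> J" "p \<in> J \<Longrightarrow> q \<in> J \<Longrightarrow> p - q \<in> J"
proof -
  interpret ideal J "poly_alg Y" by (rule assms)
  show "J \<subseteq> carrier (poly_alg Y)" by (rule a_subset)
  show "0 \<in> J" using additive_subgroup.zero_closed[OF ideal.axioms(1)[OF assms]] by simp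
  show add: "p + q \<in> J" if "p \<in> J" "q \<in> J" for p q using additive_subgroup.a_closed[OF ideal.axioms(1)[OF assms] that] by simp
  show mult: "p * q \<in> J" if "p \<in> carrier (poly_alg Y)" "q \<in> J" for p q
    using I_l_closed[OF that(2,1)] by simp
  show "scal c q \<in> J" if "q \<in> J" for c q
    unfolding scal_eq by (rule mult[OF single_in_poly_alg[OF monomials_empty(1)] that])
  show "p - q \<in> J" if "p \<in> J" "q \<in> J" for p q
    using add[OF that(1) mult[OF single_in_poly_alg[OF monomials_empty(1)] that(2)], of "- 1"]
    by (simp only: uminus_eq_single[symmetric] diff_conv_add_uminus)
qed

locale diff_groebner = letter_order V s for V :: "'x set" and s +
  fixes lam :: "'k::field" and I S :: "('x, 'k) mpol set"
  assumes lam: "lam \<noteq> 0" and groebner: "groebner_basis s V I S"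
begin

sublocale D: letter_order "Delta V" "Delta_less s"
  by (rule Delta_less_letter_order) unfold_locales

lemma V_order: "letter_order V s"
  by unfold_locales

abbreviation P :: "('k, ('x \<times> nat, 'k) mpol) module" where "P \<equiv> poly_alg (Delta V)"

abbreviation dless (infix \<open>\<prec>\<close> 50) where "u \<prec> v \<equiv> (u, v) \<in> deglex (Delta_less s)"

section \<open>The ideal of all copies and its image under theta\<close>

text \<open>The ideal generated by the copies at all levels, given through \<open>D.reps\<close> so
  that Buchberger's criterion applies to its elements directly.\<close>

definition B :: "('x \<times> nat, 'k) mpol set"
  where "B = D.reps (\<Union>n. shift n ` S) (monomials (Delta V))"

definition J :: "('x \<times> nat, 'k) mpol set"
  where "J = theta lam ` B"

definition Red :: "('x \<times> nat) multiset set"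
  where "Red = {u \<in> monomials (Delta V). \<forall>t \<in> lead_mon s ` S. \<forall>n. \<not> mon_dvd (Delta V) (bracket n t) u}"

lemma S_poly: "S \<subseteq> carrier (poly_alg V)" and S_monic: "\<forall>f\<in>S. monic s f"
  using groebner by (auto simp: groebner_basis_def)

lemma shifts_poly: "(\<Union>n. shift n ` S) \<subseteq> carrier P"
  using S_poly shift_in_poly_alg by blast

lemma lead_S: "f \<in> S \<Longrightarrow> lead_mon s f \<in> monomials V"
  using S_poly S_monic by (intro lead_mon_in_monomials) (auto simp: monic_def)

lemma lead_shift: "f \<in> S \<Longrightarrow> lead_mon (Delta_less s) (shift n f) = bracket n (lead_mon s f)"
  using S_poly S_monic by (intro shift_lead_mon(1)[OF V_order]) auto

lemma B_poly: "B \<subseteq> carrier P"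
  using D.reps_in_poly_alg[OF _ shifts_poly] unfolding B_def by blast

lemma B_add: "p \<in> B \<Longrightarrow> q \<in> B \<Longrightarrow> p + q \<in> B"
  unfolding B_def by (rule D.reps_add)

lemma B_zero: "0 \<in> B"
  unfolding B_def by (rule D.reps_zero)

lemma B_mult:
  assumes "p \<in> carrier P" "b \<in> B"
  shows "p * b \<in> B"
  using assms(1)
proof (induction p rule: poly_alg_induct)
  case zero
  show ?case by (simp add: B_zero)
next
  case (add u c p)
  have "single u c * b \<in> B"
    using assms(2) add.hyps(1) unfolding B_def by (rule D.reps_mult_single) (simp add: monomials_add add.hyps)
  with add.IH show ?case unfolding distrib_right by (intro B_add)
qed

lemma B_shift:
  assumes "f \<in> S"
  shows "shift n f \<in> B"
proof -
  have "single {#} 1 * shift n f \<in> B"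
    unfolding B_def
    by (rule D.reps_term) (use assms lead_S bracket_monomials in \<open>auto simp: lead_shift\<close>)
  thus ?thesis by (simp add: single_empty_one)
qed

text \<open>\<open>tau\<close> moves a generator to the next level, where it is again a generator.
  Under \<open>theta\<close> this becomes the stability of \<open>J\<close> under
  \<open>sigma\<close>.\<close>

lemma B_tau: "p \<in> B \<Longrightarrow> tau p \<in> B"
  unfolding B_def
proof (induction rule: D.reps.induct)
  case reps_zero
  show ?case unfolding mpol_hom_zero[OF tau_hom] by (rule D.reps_zero)
next
  case (reps_step f u p c)
  obtain n g where f: "g \<in> S" "f = shift n g" using reps_step.hyps(1) by blast
  have "tau (single u c) * shift (Suc n) g \<in> B"
    by (intro B_mult B_shift f(1) tau_in_poly_alg single_in_poly_alg reps_step.hyps(2))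
  with reps_step.IH show ?case
    unfolding mpol_hom_add[OF tau_hom] mpol_hom_mult[OF tau_hom] f(2) tau_shift B_def
    by (rule D.reps_add[rotated])
qed

lemma J_ideal: "ideal J P"
proof (rule poly_alg_idealI)
  show "J \<subseteq> carrier P" unfolding J_def using B_poly theta_in_poly_alg by blast
  show "0 \<in> J" unfolding J_def by (rule image_eqI[OF _ B_zero]) (simp only: mpol_hom_zero[OF theta_hom])
  fix p q assume "p \<in> J" "q \<in> J"
  then obtain a b where "a \<in> B" "p = theta lam a" "b \<in> B" "q = theta lam b" unfolding J_def by blast
  thus "p + q \<in> J" unfolding J_def
    by (intro image_eqI[of _ _ "a + b"] B_add) (simp_all only: mpol_hom_add[OF theta_hom])
next
  fix p q assume p: "p \<in> carrier P" and q: "q \<in> J"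
  \<comment> \<open>The image of an ideal is an ideal here because \<open>theta\<close> is onto:
    every multiplier is itself an image.\<close>
  obtain a where a: "a \<in> carrier P" "theta lam a = p" using theta_surj[OF lam p] by blast
  obtain b where b: "b \<in> B" "q = theta lam b" using q unfolding J_def by blast
  show "p * q \<in> J" unfolding J_def
    by (rule image_eqI[OF _ B_mult[OF a(1) b(1)]]) (simp only: mpol_hom_mult[OF theta_hom] a(2) b(2))
qed

lemmas J_closed = poly_alg_idealD[OF J_ideal]

lemma J_sigma_diff: "p \<in> J \<Longrightarrow> sigma_diff lam p \<in> J"
proof -
  assume p: "p \<in> J"
  then obtain b where b: "b \<in> B" "p = theta lam b" unfolding J_def by blast
  have "sigma lam p \<in> J" unfolding J_def b(2) theta_tau[symmetric] by (intro imageI B_tau b(1))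
  with p show ?thesis unfolding sigma_diff_def by (intro J_closed)
qed

lemma diff_op_J: "diff_op lam V ` J \<subseteq> J"
proof
  fix q assume "q \<in> diff_op lam V ` J"
  then obtain p where p: "p \<in> J" "q = diff_op lam V p" by blast
  hence "q = sigma_diff lam p" using J_closed(1) by (auto simp: diff_op_eq[OF lam])
  thus "q \<in> J" using J_sigma_diff[OF p(1)] by simp
qed

lemma hat_i_J: "f \<in> S \<Longrightarrow> hat_i f \<in> J"
  unfolding hat_i_eq_shift J_def
  by (rule image_eqI[OF _ B_shift[of f 0]]) (simp_all only: theta_shift funpow.simps id_apply)

text \<open>\<open>K\<close> is stable under \<open>sigma = 1 + lam d\<close>, so it contains
  \<open>sigma^n\<close> of every level 0 copy, which is \<open>theta\<close> of the copy at level
  \<open>n\<close>; these generate \<open>J\<close>. The lemma is applied again to the kernel of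
  \<open>lift\<close>.\<close>

lemma J_minimal:
  assumes K: "ideal K P" and d: "diff_op lam V ` K \<subseteq> K" and S: "hat_i ` S \<subseteq> K"
  shows "J \<subseteq> K"
proof -
  note KD = poly_alg_idealD[OF K]
  have sig: "sigma lam p \<in> K" if "p \<in> K" for p
  proof -
    have "diff_op lam V p = sigma_diff lam p" using that KD(1) by (auto simp: diff_op_eq[OF lam])
    hence "sigma_diff lam p \<in> K" using d that by (metis image_subset_iff)
    with that show ?thesis unfolding sigma_eq[OF lam, of p] by (intro KD)
  qed
  have sh: "(sigma lam ^^ n) (shift 0 f) \<in> K" if "f \<in> S" for f n
  proof (induction n)
    case 0
    show ?case using S that unfolding hat_i_eq_shift by auto
  next
    case (Suc n)
    from sig[OF this] show ?case by simp
  qed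
  have "theta lam b \<in> K" if "b \<in> B" for b
    using that unfolding B_def
  proof (induction rule: D.reps.induct)
    case reps_zero
    show ?case unfolding mpol_hom_zero[OF theta_hom] by (rule KD(2))
  next
    case (reps_step f u p c)
    obtain n g where f: "g \<in> S" "f = shift n g" using reps_step.hyps(1) by blast
    show ?case
      unfolding mpol_hom_add[OF theta_hom] mpol_hom_mult[OF theta_hom] f(2) theta_shift
      by (intro KD(3,4) theta_in_poly_alg single_in_poly_alg reps_step.hyps(2) sh f(1) reps_step.IH)
  qed
  thus ?thesis unfolding J_def by blast
qed

lemma diff_ideal_gen_eq: "diff_ideal_gen P (diff_op lam V) (hat_i ` S) = J"
proof
  show "diff_ideal_gen P (diff_op lam V) (hat_i ` S) \<subseteq> J"
    unfolding diff_ideal_gen_def using J_ideal diff_op_J hat_i_J by (intro Inter_lower) blast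
  show "J \<subseteq> diff_ideal_gen P (diff_op lam V) (hat_i ` S)"
    unfolding diff_ideal_gen_def by (rule Inter_greatest) (use J_minimal in blast)
qed

text \<open>\<open>theta\<close> preserves leading monomials, so the question moves to a preimage in
  \<open>B\<close>, where Buchberger's criterion answers it.\<close>

lemma J_lead_mon:
  assumes "p \<in> J" "p \<noteq> 0"
  shows "\<exists>f\<in>S. \<exists>n. \<exists>u\<in>monomials (Delta V). lead_mon (Delta_less s) p = bracket n (lead_mon s f) + u"
proof -
  obtain b where b: "b \<in> B" "p = theta lam b" using assms(1) unfolding J_def by blast
  have b0: "b \<noteq> 0" using assms(2) b(2) mpol_hom_zero[OF theta_hom] by metis
  have "b \<in> carrier P" using b(1) B_poly by blast
  from D.triangular_lead_mon[OF theta_lead_mon[OF V_order lam this b0]]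
  have l: "lead_mon (Delta_less s) p = lead_mon (Delta_less s) b" unfolding b(2) by blast
  have "\<exists>f\<in>\<Union>n. shift n ` S. \<exists>u\<in>monomials (Delta V).
    lead_mon (Delta_less s) b = lead_mon (Delta_less s) f + u"
  proof (rule D.reps_lead_mon[OF _ shifts_poly _ _ b0])
    show "\<forall>f\<in>\<Union>n. shift n ` S. monic (Delta_less s) f"
      using S_poly S_monic shift_lead_mon(2)[OF V_order] by blast
    show "b \<in> D.reps (\<Union>n. shift n ` S) (monomials (Delta V))" using b(1) unfolding B_def .
    fix f g u v w
    assume fg: "f \<in> (\<Union>n. shift n ` S)" "g \<in> (\<Union>n. shift n ` S)"
      and uv: "u \<in> monomials (Delta V)" "v \<in> monomials (Delta V)"
      and w: "w = lead_mon (Delta_less s) f + u" "w = lead_mon (Delta_less s) g + v"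
    obtain i f' where f: "f' \<in> S" "f = shift i f'" using fg(1) by blast
    obtain j g' where g: "g' \<in> S" "g = shift j g'" using fg(2) by blast
    have "w = bracket i (lead_mon s f') + u" "w = bracket j (lead_mon s g') + v"
      using w unfolding f(2) g(2) lead_shift[OF f(1)] lead_shift[OF g(1)] .
    from shift_groebner[OF V_order groebner f(1) g(1) uv this]
    show "f * mon_poly u - g * mon_poly v \<in> D.reps (\<Union>n. shift n ` S) {m. m \<prec> w}"
      unfolding f(2) g(2) .
  qed
  then obtain n f u where "f \<in> S" "u \<in> monomials (Delta V)"
    "lead_mon (Delta_less s) b = lead_mon (Delta_less s) (shift n f) + u" by blast
  thus ?thesis unfolding l using lead_shift by metis
qed

section \<open>Normal forms modulo J\<close>

text \<open>Supplies the elements used for reduction: \<open>theta\<close> of a monomial multiple of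
  a copy lies in \<open>J\<close> and keeps the leading monomial of that multiple.\<close>

lemma J_reducer:
  assumes "f \<in> S" "u \<in> monomials (Delta V)"
  shows "\<exists>p\<in>J. D.triangular (bracket n (lead_mon s f) + u) p"
proof -
  have f: "shift n f \<in> carrier P" "shift n f \<noteq> 0"
    using shifts_poly shift_lead_mon(2)[OF V_order, of f n] S_poly S_monic assms(1) by (auto simp: monic_def)
  have u: "D.triangular u (mon_poly u)"
    unfolding D.triangular_def mon_poly_def
    by (rule exI[of _ 1], rule exI[of _ 0]) (simp add: zero_in_poly_alg)
  have "D.triangular (bracket n (lead_mon s f) + u) (shift n f * mon_poly u)"
    using D.triangular_mult[OF D.triangular_self[OF f] u] assms(2) lead_S[OF assms(1)]
    unfolding lead_shift[OF assms(1)] by (simp add: bracket_monomials)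
  note t = D.triangular_lead_mon[OF this]
  have c: "shift n f * mon_poly u \<in> carrier P"
    by (intro mult_in_poly_alg f(1) mon_poly_in_poly_alg assms(2))
  have "shift n f * mon_poly u \<in> B"
    using B_mult[OF mon_poly_in_poly_alg[OF assms(2)] B_shift[OF assms(1)]] by (simp only: mult.commute)
  hence "theta lam (shift n f * mon_poly u) \<in> J" unfolding J_def by (rule imageI)
  with theta_lead_mon[OF V_order lam c] t show ?thesis by metis
qed

lemma not_Red:
  "u \<in> monomials (Delta V) \<Longrightarrow> u \<notin> Red \<Longrightarrow>
    \<exists>f\<in>S. \<exists>n. \<exists>v\<in>monomials (Delta V). u = bracket n (lead_mon s f) + v"
  unfolding Red_def mon_dvd_def by blast

lemma Red_not:
  "u \<in> Red \<Longrightarrow> f \<in> S \<Longrightarrow> v \<in> monomials (Delta V) \<Longrightarrow> u \<noteq> bracket n (lead_mon s f) + v"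
  unfolding Red_def mon_dvd_def by blast

lemma Red_unique:
  assumes "p \<in> J" "keys p \<subseteq> Red"
  shows "p = 0"
proof (rule ccontr)
  assume nz: "p \<noteq> 0"
  have "p \<in> carrier P" using J_closed(1) assms(1) by blast
  from D.lead_mon_in_keys(1)[OF this nz] have "lead_mon (Delta_less s) p \<in> Red" using assms(2) by blast
  with J_lead_mon[OF assms(1) nz] Red_not show False by blast
qed

text \<open>Normal forms of the single words are a hypothesis because the lemma serves inside the
  induction on words, for tails, as well as after it.\<close>

lemma normal_form_sum:
  assumes "\<And>m. m \<in> keys p \<Longrightarrow>
    \<exists>q\<in>carrier P. keys q \<subseteq> Red \<and> mon_poly m - q \<in> J"
  shows "\<exists>q\<in>carrier P. keys q \<subseteq> Red \<and> p - q \<in> J"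
proof -
  obtain n where n: "\<And>m. m \<in> keys p \<Longrightarrow>
    n m \<in> carrier P \<and> keys (n m) \<subseteq> Red \<and> mon_poly m - n m \<in> J"
    using assms by metis
  let ?c = "lookup p"
  have "(\<Sum>m\<in>F. scal (?c m) (n m)) \<in> carrier P \<and> keys (\<Sum>m\<in>F. scal (?c m) (n m)) \<subseteq> Red \<and>
      (\<Sum>m\<in>F. single m (?c m)) - (\<Sum>m\<in>F. scal (?c m) (n m)) \<in> J"
    if "finite F" "F \<subseteq> keys p" for F
    using that
  proof (induction F)
    case empty
    show ?case using zero_in_poly_alg J_closed(2) by simp
  next
    case (insert m F)
    let ?s = "\<Sum>m\<in>F. scal (?c m) (n m)" and ?t = "\<Sum>m\<in>F. single m (?c m)"
    have IH: "?s \<in> carrier P" "keys ?s \<subseteq> Red" "?t - ?s \<in> J" using insert by auto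
    have m: "n m \<in> carrier P" "keys (n m) \<subseteq> Red" "mon_poly m - n m \<in> J"
      using n[of m] insert.prems by auto
    have "scal (?c m) (n m) + ?s \<in> carrier P" by (intro add_in_poly_alg scal_in_poly_alg m(1) IH(1))
    moreover have "keys (scal (?c m) (n m) + ?s) \<subseteq> Red"
      using keys_add[of "scal (?c m) (n m)" ?s] keys_scal_subset[of "?c m" "n m"] m(2) IH(2) by blast
    moreover have "single m (?c m) + ?t - (scal (?c m) (n m) + ?s) \<in> J"
    proof -
      have "single m (?c m) + ?t - (scal (?c m) (n m) + ?s) =
        scal (?c m) (mon_poly m - n m) + (?t - ?s)"
        unfolding scal_diff scal_mon_poly by simp
      thus ?thesis using J_closed(3)[OF J_closed(5)[OF m(3)] IH(3)] by (simp only:)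
    qed
    ultimately show ?case using insert.hyps by simp
  qed
  from this[OF finite_keys order.refl] show ?thesis unfolding mpol_sum_single by blast
qed

lemma normal_form_mon:
  "u \<in> monomials (Delta V) \<Longrightarrow> \<exists>q\<in>carrier P. keys q \<subseteq> Red \<and> mon_poly u - q \<in> J"
proof (induction u rule: wf_induct_rule[OF deglex_wf[OF D.trans D.wf]])
  case (1 u)
  show ?case
  proof (cases "u \<in> Red")
    case True
    have "keys (mon_poly u) \<subseteq> Red" using True by (simp add: mon_poly_def)
    moreover have "mon_poly u - mon_poly u \<in> J" using J_closed(2) by simp
    ultimately show ?thesis using mon_poly_in_poly_alg[OF 1(2)] by blast
  next
    case False
    then obtain p where p: "p \<in> J" "D.triangular u p"
      using not_Red[OF 1(2)] J_reducer by blast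
    then obtain c q where q: "c \<noteq> 0" "p = single u c + q" "q \<in> carrier P"
      "\<And>k. k \<in> keys q \<Longrightarrow> k \<prec> u" unfolding D.triangular_def by blast
    have "\<exists>r\<in>carrier P. keys r \<subseteq> Red \<and> q - r \<in> J"
    proof (rule normal_form_sum)
      fix m assume m: "m \<in> keys q"
      hence "m \<in> monomials (Delta V)" using q(3) by (auto simp: carrier_poly_alg)
      from 1(1)[OF q(4)[OF m] this]
      show "\<exists>q\<in>carrier P. keys q \<subseteq> Red \<and> mon_poly m - q \<in> J" .
    qed
    then obtain r where r: "r \<in> carrier P" "keys r \<subseteq> Red" "q - r \<in> J" by blast
    \<comment> \<open>This difference equals \<open>single u c + r\<close>: the tail
      \<open>q\<close> has been replaced by its normal form \<open>r\<close>, and dividing by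
      \<open>c\<close> leaves the normal form of \<open>u\<close>.\<close>
    have "p - (q - r) \<in> J" by (rule J_closed(6)[OF p(1) r(3)])
    hence "scal (1 / c) (single u c + r) \<in> J" unfolding q(2) by (simp add: J_closed(5))
    also have "scal (1 / c) (single u c + r) = mon_poly u - scal (- (1 / c)) r"
    proof -
      have "scal (- (1 / c)) r = - scal (1 / c) r" unfolding scal_eq by (simp add: single_uminus)
      moreover have "scal (1 / c) (single u c) = mon_poly u"
        using q(1) by (simp add: mon_poly_def)
      ultimately show ?thesis by (simp add: scal_add)
    qed
    finally have "mon_poly u - scal (- (1 / c)) r \<in> J" .
    moreover have "scal (- (1 / c)) r \<in> carrier P" by (rule scal_in_poly_alg[OF r(1)])
    moreover have "keys (scal (- (1 / c)) r) \<subseteq> Red" using keys_scal_subset r(2) by blast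
    ultimately show ?thesis by blast
  qed
qed

lemma normal_form:
  assumes "p \<in> carrier P"
  shows "\<exists>q\<in>carrier P. keys q \<subseteq> Red \<and> p - q \<in> J"
  by (rule normal_form_sum, rule normal_form_mon) (use assms in \<open>auto simp: carrier_poly_alg\<close>)

section \<open>The residue classes of reduced words as a basis\<close>

abbreviation Q :: "('k, ('x \<times> nat, 'k) mpol set) module" where "Q \<equiv> quot_alg P J"

abbreviation res :: "('x \<times> nat, 'k) mpol \<Rightarrow> ('x \<times> nat, 'k) mpol set" where "res p \<equiv> J +>\<^bsub>P\<^esub> p"

lemmas Q_algebra = quot_alg_algebra[OF poly_alg_algebra J_ideal]
lemmas res_hom = quot_alg_res_hom[OF poly_alg_algebra J_ideal]
lemmas Q_carrier = quot_alg_carrier[OF poly_alg_algebra J_ideal]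

lemma res_eq_iff: "p \<in> carrier P \<Longrightarrow> q \<in> carrier P \<Longrightarrow> res p = res q \<longleftrightarrow> p - q \<in> J"
  using quot_alg_eq_iff[OF poly_alg_algebra J_ideal, of p q] poly_alg_a_minus(2)[of p "Delta V" q] by simp

lemma Red_monomials: "Red \<subseteq> monomials (Delta V)"
  unfolding Red_def by blast

text \<open>A difference of two reduced words is supported on \<open>Red\<close>, so it lies in
  \<open>J\<close> only if it is 0. This also underlies the work with linear combinations, which sum
  over a set of vectors and would count equal residues once.\<close>

lemma inj_on_res: "inj_on (\<lambda>u. res (mon_poly u)) Red"
proof (rule inj_onI)
  fix u v assume uv: "u \<in> Red" "v \<in> Red" "res (mon_poly u) = res (mon_poly v)"
  have "mon_poly u - mon_poly v \<in> J"
    using uv Red_monomials res_eq_iff[of "mon_poly u" "mon_poly v"] mon_poly_in_poly_alg by blast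
  moreover have "keys (mon_poly u - mon_poly v :: ('x \<times> nat, 'k) mpol) \<subseteq> Red"
  proof
    fix k assume "k \<in> keys (mon_poly u - mon_poly v :: ('x \<times> nat, 'k) mpol)"
    hence "k = u \<or> k = v"
      by (auto simp: in_keys_iff lookup_minus mon_poly_def lookup_single when_def split: if_splits)
    thus "k \<in> Red" using uv by blast
  qed
  ultimately have "mon_poly u - mon_poly v = (0 :: ('x \<times> nat, 'k) mpol)" by (rule Red_unique)
  hence "(mon_poly u :: ('x \<times> nat, 'k) mpol) = mon_poly v" by simp
  hence "lookup (mon_poly u :: ('x \<times> nat, 'k) mpol) v = 1"
    by (simp add: mon_poly_def)
  thus "u = v" by (simp add: mon_poly_def lookup_single when_def split: if_splits)
qed

sublocale Q: vectorspace "ring_of_type_algebra :: 'k ring" Q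
proof -
  interpret algebra "ring_of_type_algebra :: 'k ring" Q by (rule Q_algebra)
  interpret field "ring_of_type_algebra :: 'k ring" by (rule field_from_type_algebra)
  show "vectorspace (ring_of_type_algebra :: 'k ring) Q" by unfold_locales
qed

text \<open>Coefficients in \<open>lincomb\<close> are attached to vectors. By injectivity they can
  be read as coefficients of words, so a combination is the residue of one polynomial supported on
  \<open>Red\<close>, to which \<open>Red_unique\<close> and \<open>normal_form\<close>
  apply.\<close>

lemma lincomb_res:
  assumes "finite U" "U \<subseteq> Red"
  shows "Q.lincomb a ((\<lambda>u. res (mon_poly u)) ` U) =
    res (\<Sum>u\<in>U. single u (a (res (mon_poly u))))"
  using assms
proof (induction U)
  case empty
  show ?case
    by (simp add: Q.lincomb_def quot_alg_zero[OF poly_alg_algebra J_ideal])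
next
  case (insert u U)
  let ?r = "\<lambda>u. res (mon_poly u)" and ?s = "\<lambda>u. single u (a (res (mon_poly u)))"
  have mon: "v \<in> monomials (Delta V)" if "v \<in> insert u U" for v using that insert.prems Red_monomials by blast
  have rc: "?r v \<in> carrier Q" if "v \<in> insert u U" for v
    using alg_homD(1)[OF res_hom] mon_poly_in_poly_alg[OF mon[OF that]] by blast
  have sc: "c \<odot>\<^bsub>Q\<^esub> x \<in> carrier Q" if "x \<in> carrier Q" for c x using Q.smult_closed[of c x] that by simp
  have "inj_on ?r (insert u U)" using inj_on_res insert.prems by (rule inj_on_subset)
  hence nin: "?r u \<notin> ?r ` U" using insert.hyps(2) by (simp add: inj_on_insert)
  have sumc: "(\<Sum>v\<in>F. ?s v) \<in> carrier P" if "finite F" "F \<subseteq> insert u U" for F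
    using that by (induction F) (simp_all add: zero_in_poly_alg add_in_poly_alg single_in_poly_alg mon)
  have "Q.lincomb a (?r ` insert u U) = a (?r u) \<odot>\<^bsub>Q\<^esub> ?r u \<oplus>\<^bsub>Q\<^esub> Q.lincomb a (?r ` U)"
    unfolding Q.lincomb_def image_insert
    by (rule Q.finsum_insert) (use insert.hyps nin rc sc in \<open>auto simp: Pi_def\<close>)
  also have "\<dots> = a (?r u) \<odot>\<^bsub>Q\<^esub> ?r u \<oplus>\<^bsub>Q\<^esub> res (\<Sum>v\<in>U. ?s v)"
    using insert.IH insert.prems by simp
  also have "a (?r u) \<odot>\<^bsub>Q\<^esub> ?r u = res (?s u)"
    using alg_homD(5)[OF res_hom mon_poly_in_poly_alg[OF mon], of u "a (?r u)"] by (simp add: mon_poly_def)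
  also have "res (?s u) \<oplus>\<^bsub>Q\<^esub> res (\<Sum>v\<in>U. ?s v) = res (?s u + (\<Sum>v\<in>U. ?s v))"
  proof -
    have c: "?s u \<in> carrier P" "(\<Sum>v\<in>U. ?s v) \<in> carrier P"
      using insert.hyps by (auto intro: single_in_poly_alg mon sumc)
    from alg_homD(3)[OF res_hom c] show ?thesis by (simp only: poly_alg_sel)
  qed
  also have "?s u + (\<Sum>v\<in>U. ?s v) = (\<Sum>v\<in>insert u U. ?s v)" using insert.hyps by simp
  finally show ?case .
qed

theorem basis_Red: "Q.basis ((\<lambda>u. res (mon_poly u)) ` Red)"
proof -
  let ?r = "\<lambda>u. res (mon_poly u)"
  have carr: "?r ` Red \<subseteq> carrier Q"
    using Red_monomials alg_homD(1)[OF res_hom] mon_poly_in_poly_alg by blast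
  have "\<not> Q.lin_dep (?r ` Red)"
  proof
    assume "Q.lin_dep (?r ` Red)"
    then obtain A a v where A: "finite A" "A \<subseteq> ?r ` Red" "Q.lincomb a A = \<zero>\<^bsub>Q\<^esub>" "v \<in> A"
      "a v \<noteq> \<zero>\<^bsub>(ring_of_type_algebra :: 'k ring)\<^esub>"
      unfolding Q.lin_dep_def by blast
    obtain U where U: "U \<subseteq> Red" "finite U" "A = ?r ` U"
      using finite_subset_image[OF A(1,2)] by blast
    obtain u where u: "u \<in> U" "v = ?r u" using A(4) U(3) by blast
    define p where "p = (\<Sum>u\<in>U. single u (a (?r u)))"
    have pk: "keys p \<subseteq> U"
      using keys_sum_subset[of "\<lambda>u. single u (a (?r u))" U] unfolding p_def
      by (auto split: if_splits)
    have pP: "p \<in> carrier P" using pk U(1) Red_monomials by (auto simp: carrier_poly_alg)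
    have "res p = res 0"
      using A(3) lincomb_res[OF U(2,1), of a] quot_alg_zero[OF poly_alg_algebra J_ideal]
      unfolding U(3) p_def by simp
    hence "p \<in> J" using res_eq_iff[OF pP zero_in_poly_alg] by simp
    hence "p = 0" using pk U(1) by (intro Red_unique) auto
    moreover have "lookup p u = a (?r u)"
      unfolding p_def lookup_sum lookup_single when_def using u(1) U(2) by simp
    ultimately show False using A(5) u(2) by simp
  qed
  moreover have "Q.span (?r ` Red) = carrier Q"
  proof
    show "Q.span (?r ` Red) \<subseteq> carrier Q" by (rule Q.span_is_subset2[OF carr])
    show "carrier Q \<subseteq> Q.span (?r ` Red)"
    proof
      fix C assume "C \<in> carrier Q"
      then obtain p where p: "p \<in> carrier P" "C = res p" unfolding Q_carrier by blast
      obtain q where q: "q \<in> carrier P" "keys q \<subseteq> Red" "p - q \<in> J"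
        using normal_form[OF p(1)] by blast
      \<comment> \<open>Coefficients are indexed by residue classes; \<open>inv_into\<close>
        recovers the reduced word behind a class.\<close>
      define a where "a = (\<lambda>C. lookup q (inv_into Red ?r C))"
      have a: "a (?r u) = lookup q u" if "u \<in> keys q" for u
        unfolding a_def using inv_into_f_f[OF inj_on_res] q(2) that by (simp add: subset_iff)
      have "Q.lincomb a (?r ` keys q) =
        res (\<Sum>u\<in>keys q. single u (a (?r u)))"
        by (rule lincomb_res[OF finite_keys q(2)])
      also have "(\<Sum>u\<in>keys q. single u (a (?r u))) = q"
        using a mpol_sum_single[of q] by simp
      also have "res q = C" using res_eq_iff[OF p(1) q(1)] q(3) p(2) by simp
      finally have "C = Q.lincomb a (?r ` keys q)" ..
      moreover have "finite (?r ` keys q)" "?r ` keys q \<subseteq> ?r ` Red"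
        using q(2) by auto
      ultimately show "C \<in> Q.span (?r ` Red)" unfolding Q.span_def
        by (intro CollectI exI[of _ a] exI[of _ "?r ` keys q"] conjI) simp_all
    qed
  qed
  ultimately show ?thesis unfolding Q.basis_def using carr by blast
qed

end

section \<open>The universal property\<close>

lemma quot_comm_diff_algebra:
  fixes R :: "('k::field, 'r) module"
  assumes R: "comm_diff_algebra R lam d" and J: "ideal J R" and dJ: "d ` J \<subseteq> J"
  shows "comm_diff_algebra (quot_alg R J) lam (quot_op R J d)"
proof -
  interpret R: comm_diff_algebra R lam d by (rule R)
  have alg: "algebra (ring_of_type_algebra :: 'k ring) R" by unfold_locales
  interpret Q: algebra "ring_of_type_algebra :: 'k ring" "quot_alg R J" by (rule quot_alg_algebra[OF alg J])
  note res = alg_homD[OF quot_alg_res_hom[OF alg J]]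
  note op = quot_op_coset[OF alg J R.d_linear dJ]
  have dc: "d x \<in> carrier R" if "x \<in> carrier R" for x using module_hom_closed[OF R.d_linear] that by blast
  have sc: "c \<odot>\<^bsub>R\<^esub> x \<in> carrier R" if "x \<in> carrier R" for c x using R.smult_closed[of c x] that by simp
  have rep: "\<exists>x\<in>carrier R. C = J +>\<^bsub>R\<^esub> x" if "C \<in> carrier (quot_alg R J)" for C
    using that unfolding quot_alg_carrier[OF alg J] by (rule imageE) blast
  show ?thesis
  proof unfold_locales
    show "quot_op R J d \<in> module_hom ring_of_type_algebra (quot_alg R J) (quot_alg R J)"
      unfolding module_hom_def
    proof (intro CollectI conjI allI impI Pi_I)
      fix C assume "C \<in> carrier (quot_alg R J)"
      then obtain x where x: "x \<in> carrier R" "C = J +>\<^bsub>R\<^esub> x" using rep by blast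
      show "quot_op R J d C \<in> carrier (quot_alg R J)"
        unfolding x(2) op[OF x(1)] by (rule res(1)[OF dc[OF x(1)]])
    next
      fix C D assume "C \<in> carrier (quot_alg R J) \<and> D \<in> carrier (quot_alg R J)"
      then obtain x y where x: "x \<in> carrier R" "C = J +>\<^bsub>R\<^esub> x" and y: "y \<in> carrier R" "D = J +>\<^bsub>R\<^esub> y"
        using rep by metis
      show "quot_op R J d (C \<oplus>\<^bsub>quot_alg R J\<^esub> D) = quot_op R J d C \<oplus>\<^bsub>quot_alg R J\<^esub> quot_op R J d D"
        unfolding x(2) y(2) op[OF x(1)] op[OF y(1)] res(3)[OF x(1) y(1), symmetric]
          res(3)[OF dc[OF x(1)] dc[OF y(1)], symmetric] op[OF R.a_closed[OF x(1) y(1)]]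
          module_hom_add[OF R.d_linear x(1) y(1)] ..
    next
      fix c C assume "c \<in> carrier (ring_of_type_algebra :: 'k ring) \<and> C \<in> carrier (quot_alg R J)"
      then obtain x where x: "x \<in> carrier R" "C = J +>\<^bsub>R\<^esub> x" using rep by blast
      have "d (c \<odot>\<^bsub>R\<^esub> x) = c \<odot>\<^bsub>R\<^esub> d x" using module_hom_smult[OF R.d_linear _ x(1), of c] by simp
      thus "quot_op R J d (c \<odot>\<^bsub>quot_alg R J\<^esub> C) = c \<odot>\<^bsub>quot_alg R J\<^esub> quot_op R J d C"
        unfolding x(2) op[OF x(1)] res(5)[OF x(1), symmetric] res(5)[OF dc[OF x(1)], symmetric]
          op[OF sc[OF x(1)]] by simp
    qed
    show "quot_op R J d \<one>\<^bsub>quot_alg R J\<^esub> = \<zero>\<^bsub>quot_alg R J\<^esub>"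
      unfolding quot_alg_one[OF alg J] op[OF R.one_closed] R.d_one quot_alg_zero[OF alg J] ..
    fix C D assume "C \<in> carrier (quot_alg R J)" "D \<in> carrier (quot_alg R J)"
    then obtain x y where x: "x \<in> carrier R" "C = J +>\<^bsub>R\<^esub> x" and y: "y \<in> carrier R" "D = J +>\<^bsub>R\<^esub> y"
      using rep by metis
    note m = R.m_closed and dx = dc[OF x(1)] and dy = dc[OF y(1)]
    show "quot_op R J d (C \<otimes>\<^bsub>quot_alg R J\<^esub> D) =
      quot_op R J d C \<otimes>\<^bsub>quot_alg R J\<^esub> D \<oplus>\<^bsub>quot_alg R J\<^esub> C \<otimes>\<^bsub>quot_alg R J\<^esub> quot_op R J d D
      \<oplus>\<^bsub>quot_alg R J\<^esub> lam \<odot>\<^bsub>quot_alg R J\<^esub> (quot_op R J d C \<otimes>\<^bsub>quot_alg R J\<^esub> quot_op R J d D)"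
      unfolding x(2) y(2) op[OF x(1)] op[OF y(1)] res(2)[OF x(1) y(1), symmetric] op[OF m[OF x(1) y(1)]]
        res(2)[OF dx y(1), symmetric] res(2)[OF x(1) dy, symmetric] res(2)[OF dx dy, symmetric]
        res(5)[OF m[OF dx dy], symmetric] res(3)[OF m[OF dx y(1)] m[OF x(1) dy], symmetric]
        res(3)[OF R.a_closed[OF m[OF dx y(1)] m[OF x(1) dy]] sc[OF m[OF dx dy]], symmetric]
        R.d_mult[OF x(1) y(1)] ..
  qed
qed

lemma (in comm_diff_algebra) d_pow_closed: "x \<in> carrier R \<Longrightarrow> (d ^^ n) x \<in> carrier R"
  by (induction n) (use module_hom_closed[OF d_linear] in auto)

section \<open>The structure map from A to the quotient\<close>

locale diff_groebner_presentation = diff_groebner V s lam I S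
  for V :: "'x set" and s and lam :: "'k::field" and I S :: "('x, 'k) mpol set" +
  fixes A :: "('k, 'a) module" and prj :: "('x, 'k) mpol \<Rightarrow> 'a"
  assumes presentation: "presentation V I A prj"
begin

lemma A_algebra: "algebra (ring_of_type_algebra :: 'k ring) A"
  and prj_hom: "prj \<in> alg_hom (poly_alg V) A"
  and prj_surj: "prj ` carrier (poly_alg V) = carrier A"
  and prj_kernel: "a_kernel (poly_alg V) A prj = I"
  using presentation unfolding presentation_def by blast+

lemma hat_i_hom: "hat_i \<in> alg_hom (poly_alg V) P"
  unfolding hat_i_eq_shift by (rule mpol_hom_restrict[OF shift_hom shift_in_poly_alg])

lemma hat_i_poly: "p \<in> carrier (poly_alg V) \<Longrightarrow> hat_i p \<in> carrier P"
  by (rule alg_homD(1)[OF hat_i_hom])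

lemma res_hat_i_hom: "(\<lambda>p. res (hat_i p)) \<in> alg_hom (poly_alg V) Q"
  by (rule alg_hom_comp[OF hat_i_hom res_hom])

text \<open>The polynomials that \<open>hat_i\<close> sends into \<open>J\<close> form an ideal
  containing \<open>S\<close>, hence all of \<open>I\<close>. This is what lets the map factor
  through \<open>A\<close>.\<close>

lemma hat_i_I:
  assumes "p \<in> I"
  shows "hat_i p \<in> J"
proof -
  interpret PV: algebra "ring_of_type_algebra :: 'k ring" "poly_alg V :: ('k, ('x, 'k) mpol) module"
    by (rule poly_alg_algebra)
  have add: "hat_i (p + q) = hat_i p + hat_i q" for p q :: "('x, 'k) mpol"
    unfolding hat_i_eq_shift by (rule mpol_hom_add[OF shift_hom])
  have mult: "hat_i (p * q) = hat_i p * hat_i q" for p q :: "('x, 'k) mpol"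
    unfolding hat_i_eq_shift by (rule mpol_hom_mult[OF shift_hom])
  have zero: "hat_i 0 = (0 :: ('x \<times> nat, 'k) mpol)"
    unfolding hat_i_eq_shift by (rule mpol_hom_zero[OF shift_hom])
  have "ideal {p \<in> carrier (poly_alg V). hat_i p \<in> J} (poly_alg V)"
  proof (rule poly_alg_idealI)
    show "0 \<in> {p \<in> carrier (poly_alg V). hat_i p \<in> J}"
      using zero_in_poly_alg J_closed(2) zero by simp
    fix p q assume "p \<in> {p \<in> carrier (poly_alg V). hat_i p \<in> J}" "q \<in> {p \<in> carrier (poly_alg V). hat_i p \<in> J}"
    thus "p + q \<in> {p \<in> carrier (poly_alg V). hat_i p \<in> J}"
      using add_in_poly_alg[of p V q] J_closed(3) by (simp add: add)
  next
    fix p q :: "('x, 'k) mpol" assume "p \<in> carrier (poly_alg V)" "q \<in> {p \<in> carrier (poly_alg V). hat_i p \<in> J}"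
    thus "p * q \<in> {p \<in> carrier (poly_alg V). hat_i p \<in> J}"
      using mult_in_poly_alg[of p V q] J_closed(4)[OF hat_i_poly] by (simp add: mult)
  qed blast
  moreover have "S \<subseteq> {p \<in> carrier (poly_alg V). hat_i p \<in> J}" using S_poly hat_i_J by blast
  ultimately have "Idl\<^bsub>poly_alg V\<^esub> S \<subseteq> {p \<in> carrier (poly_alg V). hat_i p \<in> J}" by (rule PV.genideal_minimal)
  moreover have "Idl\<^bsub>poly_alg V\<^esub> S = I" using groebner unfolding groebner_basis_def by blast
  ultimately show ?thesis using assms by blast
qed

lemma S_subset_I: "S \<subseteq> I"
proof -
  interpret PV: algebra "ring_of_type_algebra :: 'k ring" "poly_alg V :: ('k, ('x, 'k) mpol) module"
    by (rule poly_alg_algebra)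
  have "S \<subseteq> Idl\<^bsub>poly_alg V\<^esub> S" by (rule PV.genideal_self[OF S_poly])
  moreover have "Idl\<^bsub>poly_alg V\<^esub> S = I" using groebner unfolding groebner_basis_def by blast
  ultimately show ?thesis by simp
qed

lemma in_I_iff: "p \<in> I \<longleftrightarrow> p \<in> carrier (poly_alg V) \<and> prj p = \<zero>\<^bsub>A\<^esub>"
  unfolding prj_kernel[symmetric] a_kernel_def' by blast

text \<open>\<open>A\<close> is known only through the surjection \<open>prj\<close>, so a
  representative has to be chosen; \<open>incl_prj\<close> shows that the choice does not
  matter.\<close>

definition incl :: "'a \<Rightarrow> ('x \<times> nat, 'k) mpol set"
  where "incl a = res (hat_i (SOME p. p \<in> carrier (poly_alg V) \<and> prj p = a))"

lemma incl_prj: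
  assumes "p \<in> carrier (poly_alg V)"
  shows "incl (prj p) = res (hat_i p)"
proof -
  interpret A: algebra "ring_of_type_algebra :: 'k ring" A by (rule A_algebra)
  define q where "q = (SOME q. q \<in> carrier (poly_alg V) \<and> prj q = prj p)"
  have q: "q \<in> carrier (poly_alg V)" "prj q = prj p"
    unfolding q_def using someI[of "\<lambda>q. q \<in> carrier (poly_alg V) \<and> prj q = prj p" p] assms by blast+
  have "prj (q - p) = prj q \<ominus>\<^bsub>A\<^esub> prj p"
    using alg_hom_minus[OF A_algebra poly_alg_algebra prj_hom q(1) assms]
    unfolding poly_alg_a_minus(2)[OF q(1) assms] .
  also have "\<dots> = \<zero>\<^bsub>A\<^esub>"
    unfolding q(2) a_minus_def by (rule A.r_neg[OF alg_homD(1)[OF prj_hom assms]])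
  finally have "q - p \<in> I" unfolding in_I_iff using diff_in_poly_alg[OF q(1) assms] by blast
  hence "hat_i (q - p) \<in> J" by (rule hat_i_I)
  hence "hat_i q - hat_i p \<in> J"
    unfolding hat_i_eq_shift mpol_hom_diff[OF shift_hom] .
  thus ?thesis
    unfolding incl_def q_def[symmetric] using res_eq_iff[OF hat_i_poly[OF q(1)] hat_i_poly[OF assms]] by blast
qed

lemma A_rep: "a \<in> carrier A \<Longrightarrow> \<exists>p\<in>carrier (poly_alg V). a = prj p"
  unfolding prj_surj[symmetric] by blast

lemma incl_hom: "incl \<in> alg_hom A Q"
proof (rule alg_homI)
  note rh = alg_homD[OF res_hat_i_hom] and ph = alg_homD[OF prj_hom]
  interpret PV: algebra "ring_of_type_algebra :: 'k ring" "poly_alg V :: ('k, ('x, 'k) mpol) module"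
    by (rule poly_alg_algebra)
  have sc: "c \<odot>\<^bsub>poly_alg V\<^esub> p \<in> carrier (poly_alg V)" if "p \<in> carrier (poly_alg V)" for c and p :: "('x, 'k) mpol"
    using scal_in_poly_alg[OF that, of c] by simp
  show "incl \<one>\<^bsub>A\<^esub> = \<one>\<^bsub>Q\<^esub>"
    unfolding ph(4)[symmetric] incl_prj[OF PV.one_closed] by (rule rh(4))
  fix a assume "a \<in> carrier A"
  then obtain p where p: "p \<in> carrier (poly_alg V)" "a = prj p" using A_rep by blast
  show "incl a \<in> carrier Q" unfolding p(2) incl_prj[OF p(1)] by (rule rh(1)[OF p(1)])
  show "incl (c \<odot>\<^bsub>A\<^esub> a) = c \<odot>\<^bsub>Q\<^esub> incl a" for c
    unfolding p(2) ph(5)[OF p(1), symmetric] incl_prj[OF p(1)] incl_prj[OF sc[OF p(1)]] by (rule rh(5)[OF p(1)])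
  fix b assume "b \<in> carrier A"
  then obtain q where q: "q \<in> carrier (poly_alg V)" "b = prj q" using A_rep by blast
  show "incl (a \<otimes>\<^bsub>A\<^esub> b) = incl a \<otimes>\<^bsub>Q\<^esub> incl b"
    unfolding p(2) q(2) ph(2)[OF p(1) q(1), symmetric] incl_prj[OF p(1)] incl_prj[OF q(1)]
      incl_prj[OF PV.m_closed[OF p(1) q(1)]] by (rule rh(2)[OF p(1) q(1)])
  show "incl (a \<oplus>\<^bsub>A\<^esub> b) = incl a \<oplus>\<^bsub>Q\<^esub> incl b"
    unfolding p(2) q(2) ph(3)[OF p(1) q(1), symmetric] incl_prj[OF p(1)] incl_prj[OF q(1)]
      incl_prj[OF PV.a_closed[OF p(1) q(1)]] by (rule rh(3)[OF p(1) q(1)])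
qed

abbreviation dQ where "dQ \<equiv> quot_op P J (diff_op lam V)"

lemma dQ_res: "p \<in> carrier P \<Longrightarrow> dQ (res p) = res (diff_op lam V p)"
  by (rule quot_op_coset[OF poly_alg_algebra J_ideal
      comm_diff_algebra.d_linear[OF diff_op_comm_diff_algebra[OF lam]] diff_op_J])

lemma Q_diff_algebra: "comm_diff_algebra Q lam dQ"
  by (rule quot_comm_diff_algebra[OF diff_op_comm_diff_algebra[OF lam] J_ideal diff_op_J])

lemma diff_op_poly: "p \<in> carrier P \<Longrightarrow> diff_op lam V p \<in> carrier P"
  by (simp add: diff_op_eq[OF lam] sigma_diff_in_poly_alg)

lemma diff_op_letter:
  assumes "x \<in> V"
  shows "diff_op lam V (mon_poly {#(x, n)#}) = mon_poly {#(x, Suc n)#}"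
  using lam by (simp add: diff_op_eq letter_in_poly_alg[OF assms] sigma_diff_def sigma_var scal_scal scal_one)

lemma sigma_eq_diff_op: "p \<in> carrier P \<Longrightarrow> sigma lam p = p + scal lam (diff_op lam V p)"
  using sigma_eq[OF lam, of p] by (simp add: diff_op_eq[OF lam])

section \<open>Extending a homomorphism from A to the quotient\<close>

context
  fixes R :: "('k, 'r) module" and d :: "'r \<Rightarrow> 'r" and \<phi> :: "'a \<Rightarrow> 'r"
  assumes R: "comm_diff_algebra R lam d" and \<phi>: "\<phi> \<in> alg_hom A R"
begin

interpretation R: comm_diff_algebra R lam d by (rule R)

lemma R_algebra: "algebra (ring_of_type_algebra :: 'k ring) R"
  by unfold_locales

text \<open>The values are forced: a differential homomorphism compatible with \<open>\<phi>\<close>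
  must send the letter \<open>(x, n)\<close> to the \<open>n\<close>-th derivative of the image of
  \<open>x\<close>.\<close>

definition lift :: "('x \<times> nat, 'k) mpol \<Rightarrow> 'r"
  where "lift = poly_eval R (\<lambda>(x, n). (d ^^ n) (\<phi> (prj (mon_poly {#x#}))))"

lemma lift_letters: "(\<lambda>(x, n). (d ^^ n) (\<phi> (prj (mon_poly {#x#})))) \<in> Delta V \<rightarrow> carrier R"
proof
  fix y assume "y \<in> Delta V"
  then obtain x n where y: "y = (x, n)" "x \<in> V" by (auto simp: Delta_def)
  have "mon_poly {#x#} \<in> carrier (poly_alg V)"
    using y(2) by (intro mon_poly_in_poly_alg) (simp add: monomials_def)
  thus "(case y of (x, n) \<Rightarrow> (d ^^ n) (\<phi> (prj (mon_poly {#x#})))) \<in> carrier R"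
    unfolding y(1) prod.case by (intro R.d_pow_closed alg_homD(1)[OF \<phi>] alg_homD(1)[OF prj_hom])
qed

lemma lift_hom: "lift \<in> alg_hom P R"
  unfolding lift_def by (rule poly_eval_hom[OF R_algebra lift_letters])

lemma lift_letter: "x \<in> V \<Longrightarrow> lift (mon_poly {#(x, n)#}) = (d ^^ n) (\<phi> (prj (mon_poly {#x#})))"
  unfolding lift_def by (subst poly_eval_var[OF R_algebra lift_letters]) (simp_all add: Delta_def)

text \<open>Agreement on letters does not settle commutation with derivations, as these are not
  homomorphisms. The composites of \<open>lift\<close> with \<open>sigma\<close> and with
  \<open>1 + lam d\<close> are homomorphisms that agree on letters; cancelling \<open>lift p\<close>
  and then \<open>lam\<close> leaves the claim.\<close>

lemma lift_diff_op:
  assumes p: "p \<in> carrier P"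
  shows "lift (diff_op lam V p) = d (lift p)"
proof -
  note l = alg_homD[OF lift_hom]
  have dc: "d x \<in> carrier R" if "x \<in> carrier R" for x using module_hom_closed[OF R.d_linear] that by blast
  have sc: "c \<odot>\<^bsub>R\<^esub> x \<in> carrier R" if "x \<in> carrier R" for c x using R.smult_closed[of c x] that by simp
  have ls: "lift (sigma lam q) = lift q \<oplus>\<^bsub>R\<^esub> lam \<odot>\<^bsub>R\<^esub> lift (diff_op lam V q)" if q: "q \<in> carrier P" for q
    unfolding sigma_eq_diff_op[OF q]
    using l(3)[OF q, of "scal lam (diff_op lam V q)"] l(5)[OF diff_op_poly[OF q], of lam]
      scal_in_poly_alg[OF diff_op_poly[OF q]] by simp
  have "lift (sigma lam p) = lift p \<oplus>\<^bsub>R\<^esub> lam \<odot>\<^bsub>R\<^esub> d (lift p)"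
  proof (rule poly_alg_hom_eqI[OF R_algebra _ _ _ p])
    show "(\<lambda>p. lift (sigma lam p)) \<in> alg_hom P R"
      by (rule alg_hom_comp[OF mpol_hom_restrict[OF sigma_hom sigma_in_poly_alg] lift_hom])
    show "(\<lambda>p. lift p \<oplus>\<^bsub>R\<^esub> lam \<odot>\<^bsub>R\<^esub> d (lift p)) \<in> alg_hom P R"
      by (rule alg_hom_comp[OF lift_hom R.weight_endo])
    fix y assume "y \<in> Delta V"
    then obtain x n where y: "y = (x, n)" "x \<in> V" by (auto simp: Delta_def)
    show "lift (sigma lam (mon_poly {#y#})) =
      lift (mon_poly {#y#}) \<oplus>\<^bsub>R\<^esub> lam \<odot>\<^bsub>R\<^esub> d (lift (mon_poly {#y#}))"
      unfolding y(1) ls[OF letter_in_poly_alg[OF y(2)]] diff_op_letter[OF y(2)] lift_letter[OF y(2)]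
      by simp
  qed
  hence "lift p \<oplus>\<^bsub>R\<^esub> lam \<odot>\<^bsub>R\<^esub> lift (diff_op lam V p) = lift p \<oplus>\<^bsub>R\<^esub> lam \<odot>\<^bsub>R\<^esub> d (lift p)"
    unfolding ls[OF p] .
  hence eq: "lam \<odot>\<^bsub>R\<^esub> lift (diff_op lam V p) = lam \<odot>\<^bsub>R\<^esub> d (lift p)"
    by (rule R.add.l_cancel) (intro sc dc l(1) diff_op_poly p)+
  have inv: "(1 / lam) \<odot>\<^bsub>R\<^esub> (lam \<odot>\<^bsub>R\<^esub> x) = x" if "x \<in> carrier R" for x
  proof -
    have "(1 / lam) \<odot>\<^bsub>R\<^esub> (lam \<odot>\<^bsub>R\<^esub> x) = (1 / lam * lam) \<odot>\<^bsub>R\<^esub> x"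
      using R.smult_assoc1[OF _ _ that, of "1 / lam" lam] by simp
    also have "1 / lam * lam = 1" using lam by simp
    also have "1 \<odot>\<^bsub>R\<^esub> x = x" using R.smult_one[OF that] by (simp only: ring_of_type_algebra_sel)
    finally show ?thesis .
  qed
  from inv[OF l(1)[OF diff_op_poly[OF p]]] inv[OF dc[OF l(1)[OF p]]] show ?thesis unfolding eq by simp
qed

lemma lift_hat_i:
  assumes p: "p \<in> carrier (poly_alg V)"
  shows "lift (hat_i p) = \<phi> (prj p)"
proof (rule poly_alg_hom_eqI[OF R_algebra alg_hom_comp[OF hat_i_hom lift_hom] alg_hom_comp[OF prj_hom \<phi>] _ p])
  fix x assume x: "x \<in> V"
  show "lift (hat_i (mon_poly {#x#})) = \<phi> (prj (mon_poly {#x#}))"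
    unfolding hat_i_eq_shift shift_var lift_letter[OF x] by simp
qed

text \<open>The kernel of \<open>lift\<close> is a differential ideal, and it contains the level 0
  copy of \<open>S\<close> because \<open>\<phi> (prj f)\<close> vanishes for \<open>f\<close> in
  \<open>I\<close>; minimality of \<open>J\<close> does the rest.\<close>

lemma lift_J:
  assumes "p \<in> J"
  shows "lift p = \<zero>\<^bsub>R\<^esub>"
proof -
  note l = alg_homD[OF lift_hom]
  let ?K = "{p \<in> carrier P. lift p = \<zero>\<^bsub>R\<^esub>}"
  have l0: "lift 0 = \<zero>\<^bsub>R\<^esub>" using alg_hom_zero[OF R_algebra poly_alg_algebra lift_hom] by simp
  have "ideal ?K P"
  proof (rule poly_alg_idealI)
    show "0 \<in> ?K" using l0 zero_in_poly_alg by simp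
    fix p q assume "p \<in> ?K" "q \<in> ?K"
    thus "p + q \<in> ?K" using l(3)[of p q] add_in_poly_alg[of p "Delta V" q] by simp
  next
    fix p q assume pq: "p \<in> carrier P" "q \<in> ?K"
    hence "lift (p * q) = lift p \<otimes>\<^bsub>R\<^esub> \<zero>\<^bsub>R\<^esub>" using l(2)[of p q] by simp
    also have "\<dots> = \<zero>\<^bsub>R\<^esub>" by (rule R.r_null[OF l(1)[OF pq(1)]])
    finally show "p * q \<in> ?K" using pq mult_in_poly_alg[of p "Delta V" q] by simp
  qed blast
  moreover have "diff_op lam V ` ?K \<subseteq> ?K"
  proof
    fix q assume "q \<in> diff_op lam V ` ?K"
    then obtain p where p: "p \<in> carrier P" "lift p = \<zero>\<^bsub>R\<^esub>" "q = diff_op lam V p" by blast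
    have "d \<zero>\<^bsub>R\<^esub> = \<zero>\<^bsub>R\<^esub>"
      using module_hom_smult[OF R.d_linear _ R.zero_closed, of 0]
        R.smult_l_null[OF R.zero_closed] R.smult_l_null[OF module_hom_closed[OF R.d_linear, THEN funcset_mem, OF R.zero_closed]]
      by simp
    hence "lift q = \<zero>\<^bsub>R\<^esub>" unfolding p(3) lift_diff_op[OF p(1)] p(2) .
    thus "q \<in> ?K" using diff_op_poly[OF p(1)] p(3) by simp
  qed
  moreover have "hat_i ` S \<subseteq> ?K"
  proof
    fix q assume "q \<in> hat_i ` S"
    then obtain f where f: "f \<in> S" "q = hat_i f" by blast
    have fI: "f \<in> carrier (poly_alg V)" "prj f = \<zero>\<^bsub>A\<^esub>" using S_subset_I f(1) in_I_iff by blast+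
    have "lift q = \<zero>\<^bsub>R\<^esub>"
      unfolding f(2) lift_hat_i[OF fI(1)] fI(2) by (rule alg_hom_zero[OF R_algebra A_algebra \<phi>])
    thus "q \<in> ?K" using hat_i_poly[OF fI(1)] f(2) by simp
  qed
  ultimately have "J \<subseteq> ?K" by (rule J_minimal)
  thus ?thesis using assms by blast
qed

text \<open>\<open>restrict\<close> provides the extensionality required of the mediating map; the
  choice of a representative is harmless by \<open>lift_J\<close>.\<close>

definition lift_Q :: "('x \<times> nat, 'k) mpol set \<Rightarrow> 'r"
  where "lift_Q = restrict (\<lambda>C. lift (SOME p. p \<in> carrier P \<and> res p = C)) (carrier Q)"

lemma lift_Q_res:
  assumes p: "p \<in> carrier P"
  shows "lift_Q (res p) = lift p"
proof -
  note l = alg_homD[OF lift_hom]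
  define q where "q = (SOME q. q \<in> carrier P \<and> res q = res p)"
  have q: "q \<in> carrier P" "res q = res p"
    unfolding q_def using someI[of "\<lambda>q. q \<in> carrier P \<and> res q = res p" p] p by blast+
  have "q - p \<in> J" using res_eq_iff[OF q(1) p] q(2) by blast
  hence "lift (q - p) = \<zero>\<^bsub>R\<^esub>" by (rule lift_J)
  hence "lift q \<ominus>\<^bsub>R\<^esub> lift p = \<zero>\<^bsub>R\<^esub>"
    using alg_hom_minus[OF R_algebra poly_alg_algebra lift_hom q(1) p]
    unfolding poly_alg_a_minus(2)[OF q(1) p] by simp
  hence "lift q = lift p" using R.r_right_minus_eq[OF l(1)[OF q(1)] l(1)[OF p]] by simp
  thus ?thesis unfolding lift_Q_def q_def[symmetric] using alg_homD(1)[OF res_hom p] by (simp add: q_def)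
qed

lemma Q_rep: "C \<in> carrier Q \<Longrightarrow> \<exists>p\<in>carrier P. C = res p"
  unfolding Q_carrier by blast

lemma lift_Q_hom: "lift_Q \<in> diff_alg_hom Q dQ R d"
proof -
  note l = alg_homD[OF lift_hom] and r = alg_homD[OF res_hom]
  interpret P: algebra "ring_of_type_algebra :: 'k ring" P by (rule poly_alg_algebra)
  have sc: "c \<odot>\<^bsub>P\<^esub> p \<in> carrier P" if "p \<in> carrier P" for c p using scal_in_poly_alg[OF that] by simp
  have "lift_Q \<in> alg_hom Q R"
  proof (rule alg_homI)
    show "lift_Q \<one>\<^bsub>Q\<^esub> = \<one>\<^bsub>R\<^esub>" unfolding r(4)[symmetric] lift_Q_res[OF P.one_closed] by (rule l(4))
    fix C assume "C \<in> carrier Q"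
    then obtain p where p: "p \<in> carrier P" "C = res p" using Q_rep by blast
    show "lift_Q C \<in> carrier R" unfolding p(2) lift_Q_res[OF p(1)] by (rule l(1)[OF p(1)])
    show "lift_Q (c \<odot>\<^bsub>Q\<^esub> C) = c \<odot>\<^bsub>R\<^esub> lift_Q C" for c
      unfolding p(2) r(5)[OF p(1), symmetric] lift_Q_res[OF p(1)] lift_Q_res[OF sc[OF p(1)]] by (rule l(5)[OF p(1)])
    fix D assume "D \<in> carrier Q"
    then obtain q where q: "q \<in> carrier P" "D = res q" using Q_rep by blast
    show "lift_Q (C \<otimes>\<^bsub>Q\<^esub> D) = lift_Q C \<otimes>\<^bsub>R\<^esub> lift_Q D"
      unfolding p(2) q(2) r(2)[OF p(1) q(1), symmetric] lift_Q_res[OF p(1)] lift_Q_res[OF q(1)]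
        lift_Q_res[OF P.m_closed[OF p(1) q(1)]] by (rule l(2)[OF p(1) q(1)])
    show "lift_Q (C \<oplus>\<^bsub>Q\<^esub> D) = lift_Q C \<oplus>\<^bsub>R\<^esub> lift_Q D"
      unfolding p(2) q(2) r(3)[OF p(1) q(1), symmetric] lift_Q_res[OF p(1)] lift_Q_res[OF q(1)]
        lift_Q_res[OF P.a_closed[OF p(1) q(1)]] by (rule l(3)[OF p(1) q(1)])
  qed
  moreover have "lift_Q (dQ C) = d (lift_Q C)" if C: "C \<in> carrier Q" for C
  proof -
    obtain p where p: "p \<in> carrier P" "C = res p" using Q_rep[OF C] by blast
    show ?thesis
      unfolding p(2) dQ_res[OF p(1)] lift_Q_res[OF p(1)] lift_Q_res[OF diff_op_poly[OF p(1)]]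
      by (rule lift_diff_op[OF p(1)])
  qed
  ultimately show ?thesis unfolding diff_alg_hom_def by blast
qed

text \<open>Composed with the residue map, \<open>\<psi>\<close> is a homomorphism on polynomials,
  so its values on letters decide. Compatibility with \<open>incl\<close> fixes level 0, and
  commuting with the derivations fixes each next level.\<close>

lemma lift_Q_unique:
  assumes \<psi>: "\<psi> \<in> diff_alg_hom Q dQ R d" and ext: "\<psi> \<in> extensional (carrier Q)"
    and incl: "\<And>a. a \<in> carrier A \<Longrightarrow> \<psi> (incl a) = \<phi> a"
  shows "\<psi> = lift_Q"
proof (rule extensionalityI[OF ext])
  show "lift_Q \<in> extensional (carrier Q)" unfolding lift_Q_def by simp
  have hom: "\<psi> \<in> alg_hom Q R" and comm: "\<And>C. C \<in> carrier Q \<Longrightarrow> \<psi> (dQ C) = d (\<psi> C)"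
    using \<psi> unfolding diff_alg_hom_def by blast+
  fix C assume "C \<in> carrier Q"
  then obtain p where p: "p \<in> carrier P" "C = res p" using Q_rep by blast
  have "\<psi> (res p) = lift p"
  proof (rule poly_alg_hom_eqI[OF R_algebra alg_hom_comp[OF res_hom hom] lift_hom _ p(1)])
    fix y assume "y \<in> Delta V"
    then obtain x n where y: "y = (x, n)" "x \<in> V" by (auto simp: Delta_def)
    have xV: "mon_poly {#x#} \<in> carrier (poly_alg V)"
      using y(2) by (intro mon_poly_in_poly_alg) (simp add: monomials_def)
    have "\<psi> (res (mon_poly {#(x, n)#})) = (d ^^ n) (\<phi> (prj (mon_poly {#x#})))"
    proof (induction n)
      case 0
      have "res (mon_poly {#(x, 0)#}) = incl (prj (mon_poly {#x#}))"
        unfolding incl_prj[OF xV] hat_i_eq_shift shift_var ..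
      thus ?case using incl[OF alg_homD(1)[OF prj_hom xV]] by simp
    next
      case (Suc n)
      note x = letter_in_poly_alg[OF y(2), of n]
      have "res (mon_poly {#(x, Suc n)#}) = dQ (res (mon_poly {#(x, n)#}))"
        unfolding dQ_res[OF x] diff_op_letter[OF y(2)] ..
      thus ?case using comm[OF alg_homD(1)[OF res_hom x]] Suc by simp
    qed
    thus "\<psi> (res (mon_poly {#y#})) = lift (mon_poly {#y#})"
      unfolding y(1) lift_letter[OF y(2)] .
  qed
  thus "\<psi> C = lift_Q C" unfolding p(2) lift_Q_res[OF p(1)] .
qed

lemma lift_Q_incl: "a \<in> carrier A \<Longrightarrow> lift_Q (incl a) = \<phi> a"
  using A_rep[of a] incl_prj lift_Q_res[OF hat_i_poly] lift_hat_i by auto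

lemma ex1_lift_Q:
  "\<exists>!\<psi>. \<psi> \<in> extensional (carrier Q) \<and> \<psi> \<in> diff_alg_hom Q dQ R d \<and> (\<forall>a\<in>carrier A. \<psi> (incl a) = \<phi> a)"
proof (rule ex1I[of _ lift_Q])
  show "lift_Q \<in> extensional (carrier Q) \<and> lift_Q \<in> diff_alg_hom Q dQ R d \<and>
    (\<forall>a\<in>carrier A. lift_Q (incl a) = \<phi> a)"
    using lift_Q_hom lift_Q_incl by (simp add: lift_Q_def)
  fix \<psi> assume "\<psi> \<in> extensional (carrier Q) \<and> \<psi> \<in> diff_alg_hom Q dQ R d \<and> (\<forall>a\<in>carrier A. \<psi> (incl a) = \<phi> a)"
  thus "\<psi> = lift_Q" by (intro lift_Q_unique) auto
qed

end

theorem free_Q: "free_comm_diff_algebra TYPE('r) lam A Q dQ incl"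
  unfolding free_comm_diff_algebra_def
proof (intro conjI allI impI)
  show "comm_diff_algebra Q lam dQ" by (rule Q_diff_algebra)
  show "incl \<in> alg_hom A Q" by (rule incl_hom)
  fix R :: "('k, 'r) module" and d \<phi>
  assume "comm_diff_algebra R lam d \<and> \<phi> \<in> alg_hom A R"
  thus "\<exists>!\<psi>. \<psi> \<in> extensional (carrier Q) \<and> \<psi> \<in> diff_alg_hom Q dQ R d \<and>
      (\<forall>a\<in>carrier A. \<psi> (incl a) = \<phi> a)"
    by (elim conjE) (rule ex1_lift_Q)
qed

end

theorem proposition3p6:
  fixes lam :: "'k::field_char_0"
    and V :: "'x set" and r :: "'x rel"
    and A :: "('k, 'a) module"
    and prj :: "('x, 'k) mpol \<Rightarrow> 'a"
    and I\<^sub>A S\<^sub>A :: "('x, 'k) mpol set"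
  assumes "lam \<noteq> 0"
    and "well_order_on V r"
    and "presentation V I\<^sub>A A prj"
    and "groebner_basis (r - Id) V I\<^sub>A S\<^sub>A"
  shows "DIrr lam (r - Id) V (hat_i ` S\<^sub>A) =
      {\<xx> \<in> monomials (Delta V).
         \<forall>t \<in> lead_mon (r - Id) ` S\<^sub>A. \<forall>n. \<not> mon_dvd (Delta V) (bracket n t) \<xx>} \<and>
    (let P = poly_alg (Delta V);
         J = diff_ideal_gen P (diff_op lam V) (hat_i ` S\<^sub>A);
         Q = quot_alg P J;
         res = (\<lambda>u. J +>\<^bsub>P\<^esub> mon_poly u);
         D = DIrr lam (r - Id) V (hat_i ` S\<^sub>A)
     in inj_on res D \<and>
        vectorspace.basis (ring_of_type_algebra :: 'k ring) Q (res ` D) \<and>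
        (\<exists>i. (\<forall>p \<in> carrier (poly_alg V). i (prj p) = J +>\<^bsub>P\<^esub> hat_i p) \<and>
             free_comm_diff_algebra TYPE('r) lam A Q (quot_op P J (diff_op lam V)) i))"
proof -
  have wo: "well_order_on V r" by (rule assms(2))
  have "letter_order V (r - Id)"
  proof
    show "total_on V (r - Id)"
      using wo by (auto simp: well_order_on_def linear_order_on_def total_on_def)
    have "trans r" "antisym r"
      using wo by (auto simp: well_order_on_def linear_order_on_def partial_order_on_def preorder_on_def)
    thus "trans (r - Id)" by (rule trans_diff_Id)
    show "wf (r - Id)" using wo by (simp add: well_order_on_def)
  qed
  then interpret diff_groebner_presentation V "r - Id" lam I\<^sub>A S\<^sub>A A prj
    using assms by (intro diff_groebner_presentation.intro diff_groebner.intro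
        diff_groebner_axioms.intro diff_groebner_presentation_axioms.intro)
  have D: "DIrr lam (r - Id) V (hat_i ` S\<^sub>A) = Red"
    unfolding Red_def by (rule DIrr_hat_i[OF V_order lam S_poly S_monic])
  \<comment> \<open>Once \<open>DIrr\<close> is identified with \<open>Red\<close>, the results on
    injectivity and the basis apply as they stand; the structure map \<open>i\<close> is
    \<open>incl\<close>.\<close>
  show ?thesis
    unfolding Let_def diff_ideal_gen_eq D
    using inj_on_res basis_Red incl_prj free_Q Red_def by blast
qed

end
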